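(* Let $M$ be a helix surface in $\mathbb{H}^3_{1,\tau}\subset\mathbb{R}^4_2$, with $\lambda=g_\tau(N,N)$ and constant angle function $\nu\neq0$ such that $B=\nu^2(\tau^2-1)-\lambda=0$. Then, with respect to the local coordinates $(x,y)$ described in the context, the position vector $F$ of $M$ in $\mathbb{R}^4_2$ is given by $$F(x,y)=A(y)\gamma(x),$$ where $$\gamma(x)=\Big(\nu^2\tau x,\,0,\,\frac{2}{\sqrt\kappa},\,\nu^2\tau\lambda x\Big)$$ is a straight line of $\mathbb{H}^3_{1,\tau}$ (contained in the plane $x_2=x_3-\frac{2}{\sqrt\kappa}=0$) and $A(y)=A(\xi,\xi_1,\xi_2,\xi_3)(y)$ is a $1$-parameter family of $4\times4$ indefinite orthogonal matrices commuting with $J_1$ (of the form described in the context), with $$\begin{aligned}&[\xi_2'(y)+\xi_3'(y)-\xi'(y)]\sin(\xi_2(y)-\xi_3(y))\sinh(2\xi_1(y))-2\lambda(\xi'(y)-\xi_2'(y))\cosh^2\xi_1(y)\\&\quad+2\big[\xi_1'(y)\cos(\xi_2(y)-\xi_3(y))+\lambda\,\xi_3'(y)\sinh^2\xi_1(y)\big]=0.\end{aligned}$$ Conversely, a parametrization (immersion) $$F(x,y)=A(y)\Big(\nu^2\tau x,\,0,\,\frac{2}{\sqrt\kappa},\,\nu^2\tau\lambda x\Big),$$ with $A(y)$ as just described, defines a helix surface in the anti-de Sitter space $\mathbb{H}^3_{1,\tau}$ with constant angle function $\nu$ (for a suitable choice of the unit normal $N$).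
   Context: Let $\kappa>0$ and $\tau>0$ be real constants. $\mathbb{R}^4_2$ is $\mathbb{R}^4$ with the metric $g_0=dx_1^2+dx_2^2-dx_3^2-dx_4^2$, also denoted $\langle\,,\rangle$. The anti-de Sitter space is $\mathbb{H}^3_1(\kappa/4)=\{x\in\mathbb{R}^4: x_1^2+x_2^2-x_3^2-x_4^2=-4/\kappa\}$ with the induced Lorentzian metric $\langle\,,\rangle$. Define linear maps of $\mathbb{R}^4$ by $J_1(x)=(-x_2,x_1,-x_4,x_3)$, $J_2(x)=(x_3,-x_4,x_1,-x_2)$, $J_3(x)=(x_4,x_3,x_2,x_1)$, and $X_i(q)=\frac{\sqrt\kappa}{2}J_iq$. The Berger-like metric is $g_\tau(X,Y)=\langle X,Y\rangle+(1-\tau^2)\langle X,X_1\rangle\langle Y,X_1\rangle$; $E_1=\tau^{-1}X_1$, $E_2=X_2$, $E_3=X_3$ is a $g_\tau$-pseudo-orthonormal frame with $E_1$ timelike; $\mathbb{H}^3_{1,\tau}=(\mathbb{H}^3_1(\kappa/4),g_\tau)$ with Levi-Civita connection $\nabla^\tau$. The wedge product is the bilinear skew product with $E_1\wedge E_2=E_3$, $E_2\wedge E_3=-E_1$, $E_3\wedge E_1=E_2$. For an oriented pseudo-Riemannian surface $M$ immersed in $\mathbb{H}^3_{1,\tau}$ with unit normal $N$, put $\lambda=g_\tau(N,N)\in\{-1,1\}$, angle function $\nu=\lambda g_\tau(N,E_1)$, $E_1=T+\nu N$ with $T$ tangent to $M$, and $JX=N\wedge X$. $M$ is a helix surface if $\nu$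 is constant; throughout $\nu\neq0$, and then $\lambda+\nu^2>0$. On a helix surface the shape operator $A(X)=-\nabla^\tau_XN$ satisfies $A(JT)=-\frac{\sqrt\kappa}{2}\lambda\tau T+\mu JT$ for a smooth function $\mu$. Local coordinates (case $B=0$): $(x,y)$ are local coordinates on $M$ (on a product of intervals) with $\partial_x=T$, $\partial_y=a\,T+b\,JT$, where $\mu=\frac{1}{\nu x+\eta(y)}$ for a smooth function $\eta(y)$, $b=\nu x+\eta(y)$ and $a=-\frac{\sqrt\kappa}{2}\lambda\nu\tau\,x(\nu x+2\eta(y))$. Indefinite (pseudo-)orthogonal matrices: those preserving $g_0$. For real functions $\xi,\xi_1,\xi_2,\xi_3$ of $y$, $A(\xi,\xi_1,\xi_2,\xi_3)(y)$ is the matrix (commuting with $J_1$) with rows $\mathbf r_1=(\cosh\xi_1\cos\xi_2,-\cosh\xi_1\sin\xi_2,\sinh\xi_1\cos\xi_3,-\sinh\xi_1\sin\xi_3)$, $\mathbf r_2=J_1\mathbf r_1$, $\mathbf r_3=\sin\xi\,J_2\mathbf r_1+\cos\xi\,J_3\mathbf r_1$, $\mathbf r_4=J_1\mathbf r_3=-\cos\xi\,J_2\mathbf r_1+\sin\xi\,J_3\mathbf r_1$.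
   Formalization: When the x-interval omits 0 and η has zeros, smooth ξ₁, ξ₃ need not exist; A, ξ, ξ₂ are then smooth throughout, but ξ₁, ξ₃ and the relation are claimed only on a dense open set of y containing all y with η(y)≠0. If 0 is in the x-interval, the statement is literal. *)

theory Defs
  imports "HOL-Analysis.Analysis"
begin

section \<open>Smooth maps\<close>

text \<open>Only used on open sets \<open>S\<close>.\<close>

primrec Ck_on :: "nat \<Rightarrow> 'a::real_normed_vector set \<Rightarrow> ('a \<Rightarrow> 'b::real_normed_vector) \<Rightarrow> bool" where
  "Ck_on 0 S f \<longleftrightarrow> continuous_on S f"
| "Ck_on (Suc k) S f \<longleftrightarrow>
     (\<forall>p\<in>S. f differentiable (at p)) \<and> (\<forall>v. Ck_on k S (\<lambda>p. frechet_derivative f (at p) v))"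

definition smooth_on :: "'a::real_normed_vector set \<Rightarrow> ('a \<Rightarrow> 'b::real_normed_vector) \<Rightarrow> bool" where
  "smooth_on S f \<longleftrightarrow> (\<forall>k. Ck_on k S f)"


section \<open>Anti-de Sitter space with the Berger-like metric\<close>

lemma vector_4 [simp]:
  "(vector [a, b, c, d] :: ('a::zero)^4) $ 1 = a"
  "(vector [a, b, c, d] :: ('a::zero)^4) $ 2 = b"
  "(vector [a, b, c, d] :: ('a::zero)^4) $ 3 = c"
  "(vector [a, b, c, d] :: ('a::zero)^4) $ 4 = d"
  by (simp_all add: vector_def)

definition g0 :: "real^4 \<Rightarrow> real^4 \<Rightarrow> real" where
  "g0 u v = u$1 * v$1 + u$2 * v$2 - u$3 * v$3 - u$4 * v$4"

definition AdS :: "real \<Rightarrow> (real^4) set" where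
  "AdS \<kappa> = {q. g0 q q = - 4 / \<kappa>}"

definition AdS_tangent :: "real^4 \<Rightarrow> (real^4) set" where
  "AdS_tangent q = {v. g0 q v = 0}"

definition J1 :: "real^4 \<Rightarrow> real^4" where
  "J1 x = vector [- x$2, x$1, - x$4, x$3]"

definition J2 :: "real^4 \<Rightarrow> real^4" where
  "J2 x = vector [x$3, - x$4, x$1, - x$2]"

definition J3 :: "real^4 \<Rightarrow> real^4" where
  "J3 x = vector [x$4, x$3, x$2, x$1]"

definition X1 :: "real \<Rightarrow> real^4 \<Rightarrow> real^4" where "X1 \<kappa> q = (sqrt \<kappa> / 2) *\<^sub>R J1 q"
definition X2 :: "real \<Rightarrow> real^4 \<Rightarrow> real^4" where "X2 \<kappa> q = (sqrt \<kappa> / 2) *\<^sub>R J2 q"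
definition X3 :: "real \<Rightarrow> real^4 \<Rightarrow> real^4" where "X3 \<kappa> q = (sqrt \<kappa> / 2) *\<^sub>R J3 q"

definition g_berger :: "real \<Rightarrow> real \<Rightarrow> real^4 \<Rightarrow> real^4 \<Rightarrow> real^4 \<Rightarrow> real" where
  "g_berger \<kappa> \<tau> q u v = g0 u v + (1 - \<tau>\<^sup>2) * g0 u (X1 \<kappa> q) * g0 v (X1 \<kappa> q)"

definition E :: "real \<Rightarrow> real \<Rightarrow> 3 \<Rightarrow> real^4 \<Rightarrow> real^4" where
  "E \<kappa> \<tau> i q = (if i = 1 then (1 / \<tau>) *\<^sub>R X1 \<kappa> q else if i = 2 then X2 \<kappa> q else X3 \<kappa> q)"

definition eps :: "3 \<Rightarrow> real" where
  "eps i = (if i = 1 then - 1 else 1)"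

definition frame_coord :: "real \<Rightarrow> real \<Rightarrow> real^4 \<Rightarrow> real^4 \<Rightarrow> 3 \<Rightarrow> real" where
  "frame_coord \<kappa> \<tau> q v i = eps i * g_berger \<kappa> \<tau> q v (E \<kappa> \<tau> i q)"

definition wedge :: "real \<Rightarrow> real \<Rightarrow> real^4 \<Rightarrow> real^4 \<Rightarrow> real^4 \<Rightarrow> real^4" where
  "wedge \<kappa> \<tau> q u v =
     (let a = frame_coord \<kappa> \<tau> q u; b = frame_coord \<kappa> \<tau> q v in
        (a 1 * b 2 - a 2 * b 1) *\<^sub>R E \<kappa> \<tau> 3 q
      - (a 2 * b 3 - a 3 * b 2) *\<^sub>R E \<kappa> \<tau> 1 q
      + (a 3 * b 1 - a 1 * b 3) *\<^sub>R E \<kappa> \<tau> 2 q)"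


section \<open>Levi-Civita connection\<close>

text \<open>
  Vector fields are maps on the ambient \<open>\<real>\<^sup>4\<close>, differentiable near the point considered and tangent
  along \<open>AdS \<kappa>\<close>. Functions are only differentiated in directions tangent to \<open>AdS \<kappa>\<close>, so the values at
  points of \<open>AdS \<kappa>\<close> depend only on the restrictions of the fields to \<open>AdS \<kappa>\<close>.
\<close>

definition lie_bracket :: "(real^4 \<Rightarrow> real^4) \<Rightarrow> (real^4 \<Rightarrow> real^4) \<Rightarrow> real^4 \<Rightarrow> real^4" where
  "lie_bracket V W q = frechet_derivative W (at q) (V q) - frechet_derivative V (at q) (W q)"

definition koszul :: "real \<Rightarrow> real \<Rightarrow> (real^4 \<Rightarrow> real^4) \<Rightarrow> (real^4 \<Rightarrow> real^4) \<Rightarrow> (real^4 \<Rightarrow> real^4)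
    \<Rightarrow> real^4 \<Rightarrow> real" where
  "koszul \<kappa> \<tau> V W Z q =
     (let g = g_berger \<kappa> \<tau> in
        frechet_derivative (\<lambda>p. g p (W p) (Z p)) (at q) (V q)
      + frechet_derivative (\<lambda>p. g p (V p) (Z p)) (at q) (W q)
      - frechet_derivative (\<lambda>p. g p (V p) (W p)) (at q) (Z q)
      + g q (lie_bracket V W q) (Z q)
      - g q (lie_bracket V Z q) (W q)
      - g q (lie_bracket W Z q) (V q)) / 2"

text \<open>
  \<open>\<nabla>\<^sub>V W\<close>, defined by the Koszul formula \<open>g(\<nabla>\<^sub>V W, Z) = koszul V W Z\<close>; the right-hand side is
  tensorial in \<open>Z\<close>, so it suffices to impose it for the frame fields \<open>Z = E\<^sub>k\<close>.
\<close>

definition levi_civita :: "real \<Rightarrow> real \<Rightarrow> (real^4 \<Rightarrow> real^4) \<Rightarrow> (real^4 \<Rightarrow> real^4) \<Rightarrow> real^4 \<Rightarrow> real^4" where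
  "levi_civita \<kappa> \<tau> V W q = (\<Sum>k\<in>UNIV. (eps k * koszul \<kappa> \<tau> V W (E \<kappa> \<tau> k) q) *\<^sub>R E \<kappa> \<tau> k q)"

text \<open>
  Covariant derivative, in the direction of the parameter vector \<open>u\<close>, of a field \<open>V\<close> along the map
  \<open>F\<close> (the pulled-back connection): writing \<open>V = \<Sum>j. v\<^sub>j (E\<^sub>j \<circ> F)\<close>, the Leibniz rule gives
  \<open>\<Sum>j. dv\<^sub>j(u) E\<^sub>j + v\<^sub>j \<nabla>\<^bsub>dF(u)\<^esub> E\<^sub>j\<close>.
\<close>

definition cov_along :: "real \<Rightarrow> real \<Rightarrow> (real \<times> real \<Rightarrow> real^4) \<Rightarrow> (real \<times> real \<Rightarrow> real^4)
    \<Rightarrow> real \<times> real \<Rightarrow> real \<times> real \<Rightarrow> real^4" where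
  "cov_along \<kappa> \<tau> F V p u =
     (\<Sum>j\<in>UNIV.
        frechet_derivative (\<lambda>r. frame_coord \<kappa> \<tau> (F r) (V r) j) (at p) u *\<^sub>R E \<kappa> \<tau> j (F p)
      + frame_coord \<kappa> \<tau> (F p) (V p) j *\<^sub>R
          (\<Sum>i\<in>UNIV. frame_coord \<kappa> \<tau> (F p) (frechet_derivative F (at p) u) i *\<^sub>R
             levi_civita \<kappa> \<tau> (E \<kappa> \<tau> i) (E \<kappa> \<tau> j) (F p)))"


section \<open>Helix surfaces\<close>

text \<open>
  A surface is given by a parametrization \<open>F\<close> on an open set \<open>U\<close> of the plane. The induced metric is
  nondegenerate because there is a unit normal.
\<close>

definition oriented_surface :: "real \<Rightarrow> real \<Rightarrow> real \<Rightarrow> (real \<times> real) set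
    \<Rightarrow> (real \<times> real \<Rightarrow> real^4) \<Rightarrow> (real \<times> real \<Rightarrow> real^4) \<Rightarrow> bool" where
  "oriented_surface \<kappa> \<tau> lam U F N \<longleftrightarrow>
     open U \<and> smooth_on U F \<and> smooth_on U N \<and>
     (\<forall>p\<in>U. F p \<in> AdS \<kappa> \<and> inj (frechet_derivative F (at p)) \<and>
        N p \<in> AdS_tangent (F p) \<and> g_berger \<kappa> \<tau> (F p) (N p) (N p) = lam \<and>
        (\<forall>u. g_berger \<kappa> \<tau> (F p) (N p) (frechet_derivative F (at p) u) = 0))"

definition angle_fun :: "real \<Rightarrow> real \<Rightarrow> real \<Rightarrow> (real \<times> real \<Rightarrow> real^4) \<Rightarrow> (real \<times> real \<Rightarrow> real^4)
    \<Rightarrow> real \<times> real \<Rightarrow> real" where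
  "angle_fun \<kappa> \<tau> lam F N p = lam * g_berger \<kappa> \<tau> (F p) (N p) (E \<kappa> \<tau> 1 (F p))"

definition helix_surface :: "real \<Rightarrow> real \<Rightarrow> real \<Rightarrow> real \<Rightarrow> (real \<times> real) set
    \<Rightarrow> (real \<times> real \<Rightarrow> real^4) \<Rightarrow> (real \<times> real \<Rightarrow> real^4) \<Rightarrow> bool" where
  "helix_surface \<kappa> \<tau> lam \<nu> U F N \<longleftrightarrow>
     oriented_surface \<kappa> \<tau> lam U F N \<and> (\<forall>p\<in>U. angle_fun \<kappa> \<tau> lam F N p = \<nu>)"

definition T_field :: "real \<Rightarrow> real \<Rightarrow> real \<Rightarrow> (real \<times> real \<Rightarrow> real^4) \<Rightarrow> (real \<times> real \<Rightarrow> real^4)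
    \<Rightarrow> real \<times> real \<Rightarrow> real^4" where
  "T_field \<kappa> \<tau> lam F N p = E \<kappa> \<tau> 1 (F p) - angle_fun \<kappa> \<tau> lam F N p *\<^sub>R N p"

definition JT_field :: "real \<Rightarrow> real \<Rightarrow> real \<Rightarrow> (real \<times> real \<Rightarrow> real^4) \<Rightarrow> (real \<times> real \<Rightarrow> real^4)
    \<Rightarrow> real \<times> real \<Rightarrow> real^4" where
  "JT_field \<kappa> \<tau> lam F N p = wedge \<kappa> \<tau> (F p) (N p) (T_field \<kappa> \<tau> lam F N p)"

text \<open>\<open>X\<close> is a vector of \<open>\<real>\<^sup>4\<close> tangent to the surface at \<open>F p\<close>.\<close>

definition shape_operator :: "real \<Rightarrow> real \<Rightarrow> (real \<times> real \<Rightarrow> real^4) \<Rightarrow> (real \<times> real \<Rightarrow> real^4)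
    \<Rightarrow> real \<times> real \<Rightarrow> real^4 \<Rightarrow> real^4" where
  "shape_operator \<kappa> \<tau> F N p X =
     - cov_along \<kappa> \<tau> F N p (THE u. frechet_derivative F (at p) u = X)"

definition helix_coordinates :: "real \<Rightarrow> real \<Rightarrow> real \<Rightarrow> real \<Rightarrow> real set \<Rightarrow> real set
    \<Rightarrow> (real \<times> real \<Rightarrow> real^4) \<Rightarrow> (real \<times> real \<Rightarrow> real^4)
    \<Rightarrow> (real \<times> real \<Rightarrow> real) \<Rightarrow> (real \<Rightarrow> real) \<Rightarrow> bool" where
  "helix_coordinates \<kappa> \<tau> lam \<nu> I K F N \<mu> \<eta> \<longleftrightarrow>
     smooth_on (I \<times> K) \<mu> \<and> smooth_on K \<eta> \<and>
     (\<forall>x\<in>I. \<forall>y\<in>K.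
        let p = (x, y); T = T_field \<kappa> \<tau> lam F N p; JT = JT_field \<kappa> \<tau> lam F N p;
            a = - (sqrt \<kappa> / 2) * lam * \<nu> * \<tau> * x * (\<nu> * x + 2 * \<eta> y);
            b = \<nu> * x + \<eta> y
        in shape_operator \<kappa> \<tau> F N p JT = - (sqrt \<kappa> / 2 * lam * \<tau>) *\<^sub>R T + \<mu> p *\<^sub>R JT \<and>
           \<mu> p = 1 / (\<nu> * x + \<eta> y) \<and>
           frechet_derivative F (at p) (1, 0) = T \<and>
           frechet_derivative F (at p) (0, 1) = a *\<^sub>R T + b *\<^sub>R JT)"


section \<open>The line and the matrices\<close>

definition gamma_line :: "real \<Rightarrow> real \<Rightarrow> real \<Rightarrow> real \<Rightarrow> real \<Rightarrow> real^4" where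
  "gamma_line \<kappa> \<tau> lam \<nu> x = vector [\<nu>\<^sup>2 * \<tau> * x, 0, 2 / sqrt \<kappa>, \<nu>\<^sup>2 * \<tau> * lam * x]"

definition pseudo_orthogonal :: "real^4^4 \<Rightarrow> bool" where
  "pseudo_orthogonal M \<longleftrightarrow> (\<forall>u v. g0 (M *v u) (M *v v) = g0 u v)"

definition A_row1 :: "real \<Rightarrow> real \<Rightarrow> real \<Rightarrow> real^4" where
  "A_row1 t1 t2 t3 =
     vector [cosh t1 * cos t2, - cosh t1 * sin t2, sinh t1 * cos t3, - sinh t1 * sin t3]"

definition A_mat :: "real \<Rightarrow> real \<Rightarrow> real \<Rightarrow> real \<Rightarrow> real^4^4" where
  "A_mat t t1 t2 t3 =
     (let r1 = A_row1 t1 t2 t3; r3 = sin t *\<^sub>R J2 r1 + cos t *\<^sub>R J3 r1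
      in vector [r1, J1 r1, r3, J1 r3])"

definition A_relation :: "real \<Rightarrow> (real \<Rightarrow> real) \<Rightarrow> (real \<Rightarrow> real) \<Rightarrow> (real \<Rightarrow> real) \<Rightarrow> (real \<Rightarrow> real)
    \<Rightarrow> real \<Rightarrow> bool" where
  "A_relation lam \<xi> \<xi>1 \<xi>2 \<xi>3 y \<longleftrightarrow>
     (deriv \<xi>2 y + deriv \<xi>3 y - deriv \<xi> y) * sin (\<xi>2 y - \<xi>3 y) * sinh (2 * \<xi>1 y)
     - 2 * lam * (deriv \<xi> y - deriv \<xi>2 y) * (cosh (\<xi>1 y))\<^sup>2
     + 2 * (deriv \<xi>1 y * cos (\<xi>2 y - \<xi>3 y) + lam * deriv \<xi>3 y * (sinh (\<xi>1 y))\<^sup>2) = 0"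

text \<open>
  The matrix family with its parameter functions. The pair \<open>(\<xi>1, \<xi>3)\<close> is a polar decomposition of the
  plane curve \<open>sinh \<xi>1 (cos \<xi>3, - sin \<xi>3)\<close> of matrix entries. At a flat zero of a smooth plane curve
  there need not be a continuous polar angle, so the family of matrices is required to be smooth on
  the whole interval \<open>K\<close>, but \<open>\<xi>1\<close> and \<open>\<xi>3\<close> (and with them the differential relation) only on a
  dense open subset \<open>D\<close>; on \<open>K - D\<close> they are just numbers representing the matrix. For \<open>D = K\<close> this
  says that all four functions are smooth on \<open>K\<close> and satisfy the relation there.
\<close>

definition A_family :: "real \<Rightarrow> real set \<Rightarrow> real set \<Rightarrow> (real \<Rightarrow> real) \<Rightarrow> (real \<Rightarrow> real)
    \<Rightarrow> (real \<Rightarrow> real) \<Rightarrow> (real \<Rightarrow> real) \<Rightarrow> bool" where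
  "A_family lam K D \<xi> \<xi>1 \<xi>2 \<xi>3 \<longleftrightarrow>
     open D \<and> D \<subseteq> K \<and> K \<subseteq> closure D \<and>
     smooth_on K (\<lambda>y. A_mat (\<xi> y) (\<xi>1 y) (\<xi>2 y) (\<xi>3 y)) \<and>
     smooth_on K \<xi> \<and> smooth_on K \<xi>2 \<and> smooth_on D \<xi>1 \<and> smooth_on D \<xi>3 \<and>
     (\<forall>y\<in>D. A_relation lam \<xi> \<xi>1 \<xi>2 \<xi>3 y)"

end

theory Submission
  imports Defs
begin

text \<open>
  Write \<open>N = - \<lambda> \<nu> E\<^sub>1 + \<nu> \<tau> (c E\<^sub>2 + s E\<^sub>3)\<close>; for \<open>B = 0\<close> the unit length of \<open>N\<close> means \<open>c\<^sup>2 + s\<^sup>2 = 1\<close>, and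
  \<open>T\<close>, \<open>JT\<close> are constant multiples of \<open>L F\<close>, \<open>L' F\<close> with \<open>L = \<lambda> J\<^sub>1 - c J\<^sub>2 - s J\<^sub>3\<close> and
  \<open>L' = s J\<^sub>2 - c J\<^sub>3\<close>. Here \<open>L\<^sup>2 = 0\<close>, which makes the \<open>x\<close>-curves straight lines. Equality of the mixed
  partial derivatives of \<open>F\<close> forces \<open>(c, s)\<close> to be independent of \<open>x\<close> and to rotate with unit speed in
  \<open>y\<close>, so \<open>F = (1 + const x L) f\<close> for a curve \<open>f\<close> with \<open>f' = const \<eta> L' f\<close>, which is the third column of
  \<open>A\<close>. The angles of \<open>A\<close> come from smooth logarithms; where \<open>\<eta> \<noteq> 0\<close> the zeros of \<open>sinh \<xi>1\<close> are simple, and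
  where \<open>\<eta> = 0\<close> on an open set \<open>f\<close> is locally constant. Conversely, with \<open>c = - sin \<xi>\<close>, \<open>s = cos \<xi>\<close> the relation
  between the angles says precisely that the above \<open>N\<close> is orthogonal to \<open>\<partial>\<^sub>y F\<close>.
\<close>

section \<open>Calculus of smooth maps\<close>

text \<open>\<open>J1\<close>, \<open>J2\<close>, \<open>J3\<close> multiply like the units of the
  split quaternions, so \<open>L\<close> squares to \<open>c^2 + s^2 - lam^2\<close>, which
  \<open>B = 0\<close> turns into \<open>0\<close>. As \<open>A\<close> commutes with
  \<open>J1\<close>, the point \<open>A gamma(x)\<close> is
  \<open>(2 / sqrt \<kappa>) f + \<nu>^2 \<tau> x (A e_1 + lam J1 f)\<close> with
  \<open>f = A e_3\<close>, and the shape of \<open>A\<close> is what makes the bracket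
  \<open>L f\<close> for \<open>c = - sin \<xi>\<close>, \<open>s = cos \<xi>\<close>. Both
  directions are therefore about the one curve \<open>f\<close>, and the relation between the angles
  reads \<open>g0 (L f) f' = 0\<close>. In the direct part the coefficient \<open>a\<close> of
  \<open>\<partial>_y\<close> is quadratic in \<open>x\<close> precisely so that, with
  \<open>dL/dy = L'\<close> and \<open>L L' = - lam L\<close>, no \<open>x\<close> is left in
  \<open>f'\<close>. The obstacle is regularity: at a boundary point of the zero set of
  \<open>\<eta>\<close> a zero of \<open>sinh \<xi>1\<close> is degenerate, and the polar angle may
  fail to extend. Hence \<open>D\<close> is the nonzero set of \<open>\<eta>\<close> together with
  the interior of its zero set, which is dense; if \<open>0\<close> is in \<open>I\<close>, the
  coefficient \<open>b\<close> at \<open>x = 0\<close> is \<open>\<eta>\<close>, which cannot vanish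
  for an immersion, so \<open>D = K\<close>.\<close>

lemma Ck_on_cong:
  assumes "open S" "\<And>p. p \<in> S \<Longrightarrow> f p = g p"
  shows "Ck_on k S f \<longleftrightarrow> Ck_on k S g"
  using assms(2)
proof (induction k arbitrary: f g)
  case 0
  then show ?case by (auto intro: continuous_on_cong)
next
  case (Suc k)
  have d: "(f has_derivative D) (at p) \<longleftrightarrow> (g has_derivative D) (at p)" if "p \<in> S" for p D
    using Suc.prems that assms(1)
      has_derivative_transform_within_open[of f D p UNIV S g]
      has_derivative_transform_within_open[of g D p UNIV S f]
    by auto
  then have "f differentiable (at p) \<longleftrightarrow> g differentiable (at p)"
    and fd: "frechet_derivative f (at p) = frechet_derivative g (at p)" if "p \<in> S" for p
    using that by (auto simp: differentiable_def frechet_derivative_def)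
  moreover have "Ck_on k S (\<lambda>p. frechet_derivative f (at p) v) \<longleftrightarrow>
      Ck_on k S (\<lambda>p. frechet_derivative g (at p) v)" for v
    by (rule Suc.IH) (simp add: fd)
  ultimately show ?case by simp
qed

text \<open>Calculus rules produce derivatives in closed form; this replaces
  \<open>frechet_derivative\<close> by such a form, on which an induction hypothesis can
  act.\<close>

lemma Ck_on_SucI:
  assumes "open S" "\<And>p. p \<in> S \<Longrightarrow> (f has_derivative f' p) (at p)"
    and "\<And>v. Ck_on k S (\<lambda>p. f' p v)"
  shows "Ck_on (Suc k) S f"
proof -
  have eq: "f' p v = frechet_derivative f (at p) v" if "p \<in> S" for p v
    using frechet_derivative_at[OF assms(2)[OF that]] by simp
  have "Ck_on k S (\<lambda>p. frechet_derivative f (at p) v)" for v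
    by (rule iffD1[OF Ck_on_cong[OF \<open>open S\<close>] assms(3)]) (rule eq)
  then show ?thesis using assms(2) by (auto simp: differentiable_def)
qed

lemma Ck_on_SucD:
  assumes "Ck_on (Suc k) S f"
  shows "p \<in> S \<Longrightarrow> (f has_derivative frechet_derivative f (at p)) (at p)"
    and "Ck_on k S (\<lambda>p. frechet_derivative f (at p) v)"
  using assms by (auto simp: frechet_derivative_works)

lemma Ck_on_Suc_imp: "Ck_on (Suc k) S f \<Longrightarrow> Ck_on k S f"
proof (induction k arbitrary: f)
  case 0
  then show ?case
    by (auto intro!: continuous_at_imp_continuous_on differentiable_imp_continuous_within)
next
  case (Suc k)
  then show ?case by (metis Ck_on.simps(2))
qed

lemma Ck_on_subset: "Ck_on k S f \<Longrightarrow> T \<subseteq> S \<Longrightarrow> Ck_on k T f"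
  by (induction k arbitrary: f) (auto intro: continuous_on_subset)

lemma Ck_on_local:
  assumes "\<And>p. p \<in> S \<Longrightarrow> \<exists>U. open U \<and> p \<in> U \<and> Ck_on k U f"
  shows "Ck_on k S f"
  using assms
proof (induction k arbitrary: f)
  case 0
  then show ?case
    by (metis Ck_on.simps(1) continuous_at_imp_continuous_on continuous_on_eq_continuous_at)
next
  case (Suc k)
  have "f differentiable (at p)" if "p \<in> S" for p
    using Suc.prems[OF that] by auto
  moreover have "Ck_on k S (\<lambda>p. frechet_derivative f (at p) v)" for v
    by (rule Suc.IH) (use Suc.prems in fastforce)
  ultimately show ?case by simp
qed

lemma Ck_on_const: "open S \<Longrightarrow> Ck_on k S (\<lambda>p. c)"
proof (induction k arbitrary: c)
  case (Suc k)
  then show ?case by (intro Ck_on_SucI[where f'="\<lambda>p v. 0"]) auto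
qed auto

lemma Ck_on_linear: "open S \<Longrightarrow> bounded_linear h \<Longrightarrow> Ck_on k S h"
proof (cases k)
  case (Suc n)
  assume "open S" "bounded_linear h"
  then show ?thesis unfolding Suc
    by (intro Ck_on_SucI[where f'="\<lambda>p. h"] Ck_on_const) (auto intro: bounded_linear_imp_has_derivative)
qed (auto intro: linear_continuous_on)

lemma Ck_on_bounded_linear:
  assumes "open S" "bounded_linear h"
  shows "Ck_on k S f \<Longrightarrow> Ck_on k S (\<lambda>p. h (f p))"
proof (induction k arbitrary: f)
  case 0
  then show ?case using assms by (auto intro: bounded_linear.continuous_on)
next
  case (Suc k)
  show ?case
    using Ck_on_SucD[OF Suc.prems]
    by (intro Ck_on_SucI[where f'="\<lambda>p v. h (frechet_derivative f (at p) v)"] assms Suc.IH)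
      (auto intro: bounded_linear.has_derivative[OF assms(2)])
qed

lemma Ck_on_add:
  assumes "open S"
  shows "Ck_on k S f \<Longrightarrow> Ck_on k S g \<Longrightarrow> Ck_on k S (\<lambda>p. f p + g p)"
proof (induction k arbitrary: f g)
  case 0
  then show ?case by (auto intro: continuous_on_add)
next
  case (Suc k)
  show ?case
    using Ck_on_SucD[OF Suc.prems(1)] Ck_on_SucD[OF Suc.prems(2)]
    by (intro Ck_on_SucI[where f'="\<lambda>p v. frechet_derivative f (at p) v + frechet_derivative g (at p) v"]
        assms Suc.IH) (auto intro: has_derivative_add)
qed

lemma Ck_on_bilinear:
  assumes "open S" "bounded_bilinear h"
  shows "Ck_on k S f \<Longrightarrow> Ck_on k S g \<Longrightarrow> Ck_on k S (\<lambda>p. h (f p) (g p))"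
proof (induction k arbitrary: f g)
  case 0
  then show ?case using assms by (auto intro: bounded_bilinear.continuous_on)
next
  case (Suc k)
  show ?case
    using Ck_on_SucD[OF Suc.prems(1)] Ck_on_SucD[OF Suc.prems(2)] Suc.prems[THEN Ck_on_Suc_imp]
    by (intro Ck_on_SucI[where f'="\<lambda>p v. h (f p) (frechet_derivative g (at p) v) +
            h (frechet_derivative f (at p) v) (g p)"] assms Suc.IH Ck_on_add)
       (auto intro: bounded_bilinear.FDERIV[OF assms(2)])
qed

lemma Ck_on_affine:
  assumes "open U" "open S" "bounded_linear l" "\<And>t. t \<in> U \<Longrightarrow> c + l t \<in> S"
  shows "Ck_on k S f \<Longrightarrow> Ck_on k U (\<lambda>t. f (c + l t))"
proof (induction k arbitrary: f)
  case 0
  have "continuous_on U (\<lambda>t. c + l t)"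
    using assms(3) by (intro continuous_intros linear_continuous_on)
  then show ?case using 0 assms(4) by (auto intro: continuous_on_compose2)
next
  case (Suc k)
  have "((\<lambda>t. c + l t) has_derivative l) (at t)" for t
    using has_derivative_add[OF has_derivative_const bounded_linear_imp_has_derivative[OF assms(3)]]
    by simp
  then have "((\<lambda>t. f (c + l t)) has_derivative
      (\<lambda>v. frechet_derivative f (at (c + l t)) (l v))) (at t)" if "t \<in> U" for t
    using Ck_on_SucD(1)[OF Suc.prems assms(4)[OF that]]
    by (metis has_derivative_compose)
  then show ?case
    by (rule Ck_on_SucI[OF assms(1) _ Suc.IH[OF Ck_on_SucD(2)[OF Suc.prems]]])
qed

text \<open>A family closed under differentiation is handled in one induction over \<open>k\<close>
  with \<open>n\<close> arbitrary; for the shifts \<open>sin (x + n * pi / 2)\<close> this gives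
  sine and cosine together.\<close>

lemma Ck_on_derivative_sequence:
  fixes G :: "nat \<Rightarrow> real \<Rightarrow> real"
  assumes "open S" "\<And>n x. (G n has_real_derivative G (Suc n) x) (at x)"
  shows "Ck_on k S f \<Longrightarrow> Ck_on k S (\<lambda>p. G n (f p))"
proof (induction k arbitrary: n)
  case 0
  have "continuous_on UNIV (G n)"
    using assms(2) by (meson DERIV_isCont continuous_at_imp_continuous_on)
  then show ?case using 0 by (auto intro: continuous_on_compose2)
next
  case (Suc k)
  show ?case
    using Ck_on_SucD[OF Suc.prems] Suc.prems[THEN Ck_on_Suc_imp]
    by (intro Ck_on_SucI[where f'="\<lambda>p v. G (Suc n) (f p) * frechet_derivative f (at p) v"] assms(1)
        Suc.IH Ck_on_bilinear[OF _ bounded_bilinear_mult])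
      (auto intro!: has_derivative_eq_rhs[OF DERIV_compose_FDERIV[OF assms(2)]] simp: mult.commute)
qed

text \<open>The derivative is a product of \<open>inverse f\<close> and the derivative of
  \<open>f\<close>, so the induction hypothesis for the inverse itself closes the step;
  \<open>Ck_on_sqrt\<close> works in the same way.\<close>

lemma Ck_on_inverse:
  fixes f :: "'a::real_normed_vector \<Rightarrow> 'b::real_normed_field"
  assumes "open S" "\<And>p. p \<in> S \<Longrightarrow> f p \<noteq> 0"
  shows "Ck_on k S f \<Longrightarrow> Ck_on k S (\<lambda>p. inverse (f p))"
proof (induction k)
  case 0
  then show ?case using assms by (auto intro: continuous_on_inverse)
next
  case (Suc k)
  show ?case
    using Ck_on_SucD[OF Suc.prems] Suc.prems[THEN Ck_on_Suc_imp] assms(2)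
    by (intro Ck_on_SucI[where f'="\<lambda>p v. - (inverse (f p) * frechet_derivative f (at p) v * inverse (f p))"]
        assms(1) Suc.IH Ck_on_bilinear[OF _ bounded_bilinear_mult]
        Ck_on_bounded_linear[OF _ bounded_linear_minus[OF bounded_linear_ident]])
      (auto intro!: has_derivative_inverse)
qed

lemma Ck_on_sqrt:
  fixes f :: "'a::real_normed_vector \<Rightarrow> real"
  assumes "open S" "\<And>p. p \<in> S \<Longrightarrow> f p > 0"
  shows "Ck_on k S f \<Longrightarrow> Ck_on k S (\<lambda>p. sqrt (f p))"
proof (induction k)
  case 0
  then show ?case by (auto intro: continuous_on_real_sqrt)
next
  case (Suc k)
  show ?case
    using Ck_on_SucD[OF Suc.prems] Suc.prems[THEN Ck_on_Suc_imp] assms(2)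
    by (intro Ck_on_SucI[where f'="\<lambda>p v. frechet_derivative f (at p) v * (1/2 * inverse (sqrt (f p)))"]
        assms(1) Suc.IH Ck_on_const Ck_on_bilinear[OF _ bounded_bilinear_mult] Ck_on_inverse)
      (auto intro!: has_derivative_eq_rhs[OF has_derivative_real_sqrt] simp: less_imp_neq divide_simps 
        dest: assms(2))
qed

section \<open>Smoothness of all orders\<close>

lemma smooth_on_cong:
  "open S \<Longrightarrow> (\<And>p. p \<in> S \<Longrightarrow> f p = g p) \<Longrightarrow> smooth_on S f \<longleftrightarrow> smooth_on S g"
  unfolding smooth_on_def by (metis Ck_on_cong)

lemma smooth_on_subset: "smooth_on S f \<Longrightarrow> T \<subseteq> S \<Longrightarrow> smooth_on T f"
  unfolding smooth_on_def by (metis Ck_on_subset)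

lemma smooth_on_local:
  "(\<And>p. p \<in> S \<Longrightarrow> \<exists>U. open U \<and> p \<in> U \<and> smooth_on U f) \<Longrightarrow> smooth_on S f"
  unfolding smooth_on_def by (metis Ck_on_local)

lemma smooth_on_imp_continuous_on: "smooth_on S f \<Longrightarrow> continuous_on S f"
  unfolding smooth_on_def by (metis Ck_on.simps(1))

lemma smooth_on_has_derivative:
  "smooth_on S f \<Longrightarrow> p \<in> S \<Longrightarrow> (f has_derivative frechet_derivative f (at p)) (at p)"
  unfolding smooth_on_def by (metis Ck_on_SucD(1))

lemma smooth_on_frechet_derivative:
  "smooth_on S f \<Longrightarrow> smooth_on S (\<lambda>p. frechet_derivative f (at p) v)"
  unfolding smooth_on_def by (metis Ck_on_SucD(2))

lemma smooth_on_const: "open S \<Longrightarrow> smooth_on S (\<lambda>p. c)"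
  by (simp add: smooth_on_def Ck_on_const)

lemma smooth_on_linear: "open S \<Longrightarrow> bounded_linear h \<Longrightarrow> smooth_on S h"
  by (simp add: smooth_on_def Ck_on_linear)

lemma smooth_on_bounded_linear:
  "open S \<Longrightarrow> bounded_linear h \<Longrightarrow> smooth_on S f \<Longrightarrow> smooth_on S (\<lambda>p. h (f p))"
  by (simp add: smooth_on_def Ck_on_bounded_linear)

lemma smooth_on_bilinear:
  "open S \<Longrightarrow> bounded_bilinear h \<Longrightarrow> smooth_on S f \<Longrightarrow> smooth_on S g \<Longrightarrow> smooth_on S (\<lambda>p. h (f p) (g p))"
  by (simp add: smooth_on_def Ck_on_bilinear)

lemma smooth_on_add:
  "open S \<Longrightarrow> smooth_on S f \<Longrightarrow> smooth_on S g \<Longrightarrow> smooth_on S (\<lambda>p. f p + g p)"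
  by (simp add: smooth_on_def Ck_on_add)

lemma smooth_on_minus: "open S \<Longrightarrow> smooth_on S f \<Longrightarrow> smooth_on S (\<lambda>p. - f p)"
  by (rule smooth_on_bounded_linear[OF _ bounded_linear_minus[OF bounded_linear_ident]])

lemma smooth_on_diff:
  "open S \<Longrightarrow> smooth_on S f \<Longrightarrow> smooth_on S g \<Longrightarrow> smooth_on S (\<lambda>p. f p - g p)"
  using smooth_on_add[of S f "\<lambda>p. - g p"] smooth_on_minus by auto

lemma smooth_on_mult:
  fixes f g :: "'a::real_normed_vector \<Rightarrow> 'b::real_normed_algebra"
  shows "open S \<Longrightarrow> smooth_on S f \<Longrightarrow> smooth_on S g \<Longrightarrow> smooth_on S (\<lambda>p. f p * g p)"
  by (rule smooth_on_bilinear[OF _ bounded_bilinear_mult])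

lemma smooth_on_scaleR:
  "open S \<Longrightarrow> smooth_on S f \<Longrightarrow> smooth_on S g \<Longrightarrow> smooth_on S (\<lambda>p. f p *\<^sub>R g p)"
  by (rule smooth_on_bilinear[OF _ bounded_bilinear_scaleR])

lemma smooth_on_power:
  fixes f :: "'a::real_normed_vector \<Rightarrow> 'b::real_normed_algebra_1"
  shows "open S \<Longrightarrow> smooth_on S f \<Longrightarrow> smooth_on S (\<lambda>p. f p ^ n)"
  by (induction n) (simp_all add: smooth_on_const smooth_on_mult)

lemma smooth_on_divide:
  fixes f g :: "'a::real_normed_vector \<Rightarrow> 'b::real_normed_field"
  assumes "open S" "\<And>p. p \<in> S \<Longrightarrow> g p \<noteq> 0" "smooth_on S f" "smooth_on S g"
  shows "smooth_on S (\<lambda>p. f p / g p)"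
  unfolding divide_inverse using assms
  by (intro smooth_on_mult) (auto simp: smooth_on_def Ck_on_inverse)

lemma smooth_on_affine:
  "open U \<Longrightarrow> open S \<Longrightarrow> bounded_linear l \<Longrightarrow> (\<And>t. t \<in> U \<Longrightarrow> c + l t \<in> S) \<Longrightarrow> smooth_on S f
    \<Longrightarrow> smooth_on U (\<lambda>t. f (c + l t))"
  by (simp add: smooth_on_def Ck_on_affine)

lemma smooth_on_sin_cos:
  fixes f :: "'a::real_normed_vector \<Rightarrow> real"
  assumes "open S" "smooth_on S f"
  shows "smooth_on S (\<lambda>p. sin (f p))" "smooth_on S (\<lambda>p. cos (f p))"
proof -
  define G where "G n x = sin (x + real n * (pi / 2))" for n x
  have "(G n has_real_derivative G (Suc n) x) (at x)" for n x
  proof -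
    have "sin (x + real (Suc n) * (pi / 2)) = cos (x + real n * (pi / 2))"
      using sin_add[of "x + real n * (pi / 2)" "pi / 2"] by (simp add: algebra_simps add_divide_distrib)
    then show ?thesis unfolding G_def by (auto intro!: derivative_eq_intros)
  qed
  then have "smooth_on S (\<lambda>p. G n (f p))" for n
    using assms unfolding smooth_on_def by (metis Ck_on_derivative_sequence)
  from this[of 0] this[of 1]
  show "smooth_on S (\<lambda>p. sin (f p))" "smooth_on S (\<lambda>p. cos (f p))"
    by (simp_all add: G_def sin_add)
qed

text \<open>Makes an antiderivative of a smooth function smooth, which is how the logarithms below
  acquire their smoothness.\<close>

lemma smooth_on_vector_derivativeI:
  fixes f :: "real \<Rightarrow> 'b::real_normed_vector"
  assumes "open S" "\<And>x. x \<in> S \<Longrightarrow> (f has_vector_derivative f' x) (at x)" "smooth_on S f'"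
  shows "smooth_on S f"
proof -
  have "Ck_on (Suc k) S f" for k
    using assms unfolding smooth_on_def has_vector_derivative_def
    by (intro Ck_on_SucI[where f'="\<lambda>x v. v *\<^sub>R f' x"] Ck_on_bounded_linear[OF _ bounded_linear_scaleR_right]) auto
  then show ?thesis unfolding smooth_on_def by (metis Ck_on_Suc_imp)
qed

lemma smooth_on_has_vector_derivative:
  fixes f :: "real \<Rightarrow> 'b::real_normed_vector"
  assumes "smooth_on S f" "x \<in> S"
  shows "(f has_vector_derivative frechet_derivative f (at x) 1) (at x)"
proof -
  have d: "(f has_derivative frechet_derivative f (at x)) (at x)"
    by (rule smooth_on_has_derivative[OF assms])
  have "frechet_derivative f (at x) v = v *\<^sub>R frechet_derivative f (at x) 1" for v
    using linear_scale[OF has_derivative_linear[OF d], of v 1] by simp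
  then show ?thesis unfolding has_vector_derivative_def using d by (metis (no_types) ext)
qed

lemma smooth_on_arsinh:
  fixes f :: "real \<Rightarrow> real"
  assumes "open S" "smooth_on S f"
  shows "smooth_on S (\<lambda>x. arsinh (f x))"
proof (rule smooth_on_vector_derivativeI[OF assms(1)])
  show "((\<lambda>x. arsinh (f x)) has_vector_derivative
      frechet_derivative f (at x) 1 / sqrt ((f x)\<^sup>2 + 1)) (at x)" if "x \<in> S" for x
    using smooth_on_has_vector_derivative[OF assms(2) that]
    unfolding has_real_derivative_iff_has_vector_derivative[symmetric]
    by (rule DERIV_cong[OF DERIV_chain2[OF arsinh_real_has_field_derivative]]) simp
  have pos: "(f x)\<^sup>2 + 1 > 0" for x by (simp add: add_nonneg_pos)
  have "smooth_on S (\<lambda>x. sqrt ((f x)\<^sup>2 + 1))"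
    using smooth_on_add[OF assms(1) smooth_on_power[OF assms, of 2] smooth_on_const[OF assms(1), of 1]]
      pos unfolding smooth_on_def by (auto intro: Ck_on_sqrt[OF assms(1)])
  then show "smooth_on S (\<lambda>x. frechet_derivative f (at x) 1 / sqrt ((f x)\<^sup>2 + 1))"
    using pos by (intro smooth_on_divide assms smooth_on_frechet_derivative)
      (auto simp: less_imp_neq[symmetric])
qed

lemma smooth_on_vec:
  fixes f :: "'a::real_normed_vector \<Rightarrow> 'b::euclidean_space ^ 'n"
  assumes "open S" "\<And>i. smooth_on S (\<lambda>p. f p $ i)"
  shows "smooth_on S f"
proof -
  have lin: "bounded_linear (axis i :: 'b \<Rightarrow> 'b ^ 'n)" for i
    unfolding linear_conv_bounded_linear[symmetric]
    by (intro linearI) (auto simp: axis_def vec_eq_iff)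
  have "smooth_on S (\<lambda>p. \<Sum>i\<in>I. axis i (f p $ i))" if "finite I" for I
    using that by induction
      (auto intro!: smooth_on_const smooth_on_add smooth_on_bounded_linear[OF _ lin] assms)
  moreover have "(\<Sum>i\<in>UNIV. axis i (v $ i)) = v" for v :: "'b ^ 'n"
    by (simp add: vec_eq_iff axis_def if_distrib cong: if_cong)
  ultimately show ?thesis using finite[of "UNIV :: 'n set"] by fastforce
qed

lemmas smooth_on_intros = smooth_on_const smooth_on_add smooth_on_diff smooth_on_minus smooth_on_mult
  smooth_on_scaleR smooth_on_power smooth_on_sin_cos

section \<open>Divided differences, mixed partial derivatives, logarithms\<close>

text \<open>
  The average over \<open>t \<in> [0, 1]\<close> of \<open>t\<^sup>j \<phi>(y0 + t (y - y0))\<close> has as its derivative the average of the same kind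
  for \<open>j + 1\<close> and \<open>\<phi>'\<close>, so smoothness follows by induction; \<open>\<phi> = f'\<close>, \<open>j = 0\<close> gives the quotient.
\<close>

lemma smooth_on_divided_difference:
  fixes f :: "real \<Rightarrow> 'a::euclidean_space"
  assumes "open C" "convex C" "y0 \<in> C" "smooth_on C f" "f y0 = 0"
  obtains v where "smooth_on C v" "\<And>y. y \<in> C \<Longrightarrow> f y = (y - y0) *\<^sub>R v y"
proof -
  define avg where "avg j \<phi> y = integral {0..1} (\<lambda>t. t ^ j *\<^sub>R \<phi> (y0 + t * (y - y0)))"
    for j and \<phi> :: "real \<Rightarrow> 'a" and y
  have mem: "y0 + t * (y - y0) \<in> C" if "y \<in> C" "t \<in> {0..1}" for y t
    using convexD[OF assms(2,3) that(1), of "1 - t" t] that(2) by (simp add: algebra_simps)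
  have cont: "continuous_on (C \<times> {0..1}) (\<lambda>(y, t). t ^ j *\<^sub>R \<phi> (y0 + t * (y - y0)))"
    if "smooth_on C \<phi>" for j and \<phi> :: "real \<Rightarrow> 'a"
    unfolding split_beta
    by (intro continuous_intros continuous_on_compose2[OF smooth_on_imp_continuous_on[OF that]])
      (auto intro: mem)
  have integrable: "(\<lambda>t. t ^ j *\<^sub>R \<phi> (y0 + t * (y - y0))) integrable_on {0..1}"
    if "smooth_on C \<phi>" "y \<in> C" for j y and \<phi> :: "real \<Rightarrow> 'a"
    by (intro integrable_continuous_real continuous_intros
        continuous_on_compose2[OF smooth_on_imp_continuous_on[OF that(1)]]) (auto intro: mem that)
  have deriv: "(\<phi> has_vector_derivative frechet_derivative \<phi> (at y) 1) (at y)"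
    if "smooth_on C \<phi>" "y \<in> C" for y and \<phi> :: "real \<Rightarrow> 'a"
    by (rule smooth_on_has_vector_derivative[OF that])
  have comp: "((\<lambda>y. \<phi> (y0 + t * (y - y0))) has_vector_derivative
      t *\<^sub>R frechet_derivative \<phi> (at (y0 + t * (y - y0))) 1) (at y)"
    if "smooth_on C \<phi>" "y \<in> C" "t \<in> {0..1}" for y t and \<phi> :: "real \<Rightarrow> 'a"
  proof -
    have "((\<lambda>y. y0 + t * (y - y0)) has_vector_derivative t) (at y)"
      by (auto intro!: derivative_eq_intros simp: has_real_derivative_iff_has_vector_derivative[symmetric])
    from vector_diff_chain_at[OF this deriv[OF that(1) mem[OF that(2,3)]]]
    show ?thesis by (simp add: o_def)
  qed
  have "(avg j \<phi> has_vector_derivative avg (Suc j) (\<lambda>y. frechet_derivative \<phi> (at y) 1) y) (at y)"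
    if "smooth_on C \<phi>" "y \<in> C" for j y and \<phi> :: "real \<Rightarrow> 'a"
  proof -
    have "((\<lambda>y. integral (cbox 0 1) (\<lambda>t. t ^ j *\<^sub>R \<phi> (y0 + t * (y - y0)))) has_vector_derivative
        integral (cbox 0 1) (\<lambda>t. t ^ Suc j *\<^sub>R frechet_derivative \<phi> (at (y0 + t * (y - y0))) 1))
        (at y within C)"
    proof (rule leibniz_rule_vector_derivative)
      show "((\<lambda>y. t ^ j *\<^sub>R \<phi> (y0 + t * (y - y0))) has_vector_derivative
        t ^ Suc j *\<^sub>R frechet_derivative \<phi> (at (y0 + t * (y - y0))) 1) (at y within C)"
        if "y \<in> C" "t \<in> cbox 0 1" for y t
        using has_vector_derivative_at_within[OF has_vector_derivative_scaleR[OF DERIV_const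
              comp[OF \<open>smooth_on C \<phi>\<close> that(1)]], of t "t ^ j" C] that(2) by (simp add: mult.commute)
    qed (use that assms(2) integrable cont[OF smooth_on_frechet_derivative, where j="Suc j"] in auto)
    then show ?thesis
      by (simp add: avg_def[abs_def] at_within_open[OF that(2) assms(1)])
  qed
  note avg_deriv = this
  have "Ck_on k C (avg j \<phi>)" if "smooth_on C \<phi>" for k j and \<phi> :: "real \<Rightarrow> 'a"
    using that
  proof (induction k arbitrary: j \<phi>)
    case 0
    then show ?case
      using avg_deriv by (auto intro!: continuous_at_imp_continuous_on has_vector_derivative_continuous)
  next
    case (Suc k)
    show ?case
      by (rule Ck_on_SucI[OF assms(1) avg_deriv[OF Suc.prems, unfolded has_vector_derivative_def]])
        (assumption, rule Ck_on_bounded_linear[OF assms(1) bounded_linear_scaleR_right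
          Suc.IH[OF smooth_on_frechet_derivative[OF Suc.prems]]])
  qed
  then have "smooth_on C (avg 0 (\<lambda>y. frechet_derivative f (at y) 1))"
    using assms(4) by (simp add: smooth_on_def[of C "avg _ _"] smooth_on_frechet_derivative)
  moreover have "f y = (y - y0) *\<^sub>R avg 0 (\<lambda>y. frechet_derivative f (at y) 1) y" if "y \<in> C" for y
  proof -
    have "((\<lambda>t. f (y0 + t * (y - y0))) has_vector_derivative
        (y - y0) *\<^sub>R frechet_derivative f (at (y0 + t * (y - y0))) 1) (at t within {0..1})"
      if "t \<in> {0..1}" for t
    proof -
      have "((\<lambda>t. y0 + t * (y - y0)) has_vector_derivative y - y0) (at t)"
        by (auto intro!: derivative_eq_intros simp: has_real_derivative_iff_has_vector_derivative[symmetric])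
      from vector_diff_chain_at[OF this deriv[OF assms(4) mem[OF \<open>y \<in> C\<close> that]]]
      show ?thesis by (simp add: o_def has_vector_derivative_at_within)
    qed
    from fundamental_theorem_of_calculus[OF _ this]
    have "((\<lambda>t. (y - y0) *\<^sub>R frechet_derivative f (at (y0 + t * (y - y0))) 1) has_integral f y) {0..1}"
      using assms(5) by simp
    from integral_unique[OF this] show ?thesis by (simp add: avg_def)
  qed
  ultimately show ?thesis by (rule that)
qed

text \<open>Write \<open>F (x, y)\<close> as \<open>F (a, y)\<close> plus the integral of
  \<open>P\<close> over \<open>[a, x]\<close>. Differentiating under the integral in
  \<open>y\<close> exhibits \<open>Q\<close> as an antiderivative of \<open>Py\<close> in
  \<open>x\<close>, so \<open>Py = Qx\<close> by the fundamental theorem.\<close>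

lemma mixed_partial_derivatives_eq:
  fixes F :: "real \<times> real \<Rightarrow> 'a::euclidean_space"
  assumes "open I" "is_interval I" "open K" "is_interval K"
    and Fx: "\<And>x y. x \<in> I \<Longrightarrow> y \<in> K \<Longrightarrow> ((\<lambda>x. F (x, y)) has_vector_derivative P (x, y)) (at x)"
    and Fy: "\<And>x y. x \<in> I \<Longrightarrow> y \<in> K \<Longrightarrow> ((\<lambda>y. F (x, y)) has_vector_derivative Q (x, y)) (at y)"
    and Py: "\<And>x y. x \<in> I \<Longrightarrow> y \<in> K \<Longrightarrow> ((\<lambda>y. P (x, y)) has_vector_derivative Py (x, y)) (at y)"
    and Qx: "\<And>x y. x \<in> I \<Longrightarrow> y \<in> K \<Longrightarrow> ((\<lambda>x. Q (x, y)) has_vector_derivative Qx (x, y)) (at x)"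
    and contP: "continuous_on (I \<times> K) P" and contPy: "continuous_on (I \<times> K) Py"
    and "x \<in> I" "y \<in> K"
  shows "Py (x, y) = Qx (x, y)"
proof -
  obtain e where e: "e > 0" "cball x e \<subseteq> I"
    using \<open>open I\<close> \<open>x \<in> I\<close> open_contains_cball by blast
  define a where "a = x - e"
  have "a < x" and J: "{a..x} \<subseteq> I" using e by (auto simp: a_def cball_eq_atLeastAtMost)
  have cP: "continuous_on {a..x'} (\<lambda>t. P (t, y'))" and cPy: "continuous_on {a..x'} (\<lambda>t. Py (t, y'))"
    if "x' \<in> {a..x}" "y' \<in> K" for x' y'
    using that J
    by (auto intro!: continuous_on_compose2[OF contP] continuous_on_compose2[OF contPy] continuous_intros)
  have F: "F (x', y') = F (a, y') + integral {a..x'} (\<lambda>t. P (t, y'))" if "x' \<in> {a..x}" "y' \<in> K" for x' y'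
  proof -
    have "((\<lambda>t. P (t, y')) has_integral F (x', y') - F (a, y')) {a..x'}"
      using that J
      by (intro fundamental_theorem_of_calculus has_vector_derivative_at_within[OF Fx]) auto
    then show ?thesis by (simp add: integral_unique)
  qed
  have Q: "Q (x', y) = Q (a, y) + integral {a..x'} (\<lambda>t. Py (t, y))" if x': "x' \<in> {a..x}" for x'
  proof -
    have "((\<lambda>y. integral (cbox a x') (\<lambda>t. P (t, y))) has_vector_derivative
        integral (cbox a x') (\<lambda>t. Py (t, y))) (at y within K)"
    proof (rule leibniz_rule_vector_derivative)
      show "continuous_on (K \<times> cbox a x') (\<lambda>(y, t). Py (t, y))"
        unfolding split_beta using x' J
        by (intro continuous_on_compose2[OF contPy] continuous_intros) auto
    qed (use x' J assms(4) \<open>y \<in> K\<close> in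
        \<open>auto intro!: has_vector_derivative_at_within[OF Py] integrable_continuous_real cP[OF x']
          simp: is_interval_convex_1\<close>)
    then have "((\<lambda>y. F (a, y) + integral {a..x'} (\<lambda>t. P (t, y))) has_vector_derivative
        Q (a, y) + integral {a..x'} (\<lambda>t. Py (t, y))) (at y)"
      using J \<open>a < x\<close> \<open>y \<in> K\<close> x'
      by (intro has_vector_derivative_add Fy) (auto simp: at_within_open[OF \<open>y \<in> K\<close> \<open>open K\<close>])
    then have "((\<lambda>y. F (x', y)) has_vector_derivative Q (a, y) + integral {a..x'} (\<lambda>t. Py (t, y))) (at y)"
      by (rule has_vector_derivative_transform_within_open[OF _ \<open>open K\<close> \<open>y \<in> K\<close>]) (simp add: F[OF x'])
    moreover have "((\<lambda>y. F (x', y)) has_vector_derivative Q (x', y)) (at y)"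
      using x' J \<open>y \<in> K\<close> by (intro Fy) auto
    ultimately show ?thesis by (rule vector_derivative_unique_at[symmetric])
  qed
  \<comment> \<open>The formula for \<open>Q\<close> is available only to the left of
    \<open>x\<close>, so the two derivatives are compared as one-sided ones at the right end of
    \<open>{a..x}\<close>.\<close>
  have "((\<lambda>x'. Q (a, y) + integral {a..x'} (\<lambda>t. Py (t, y))) has_vector_derivative Py (x, y)) (at x within {a..x})"
    using has_vector_derivative_add[OF has_vector_derivative_const
        integral_has_vector_derivative[OF cPy[of x y], of x]] \<open>a < x\<close> \<open>y \<in> K\<close> by simp
  then have "((\<lambda>x'. Q (x', y)) has_vector_derivative Py (x, y)) (at x within {a..x})"
    using \<open>a < x\<close> by (intro has_vector_derivative_transform[OF _ Q]) auto
  moreover have "((\<lambda>x'. Q (x', y)) has_vector_derivative Qx (x, y)) (at x within {a..x})"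
    using Qx[OF \<open>x \<in> I\<close> \<open>y \<in> K\<close>] by (rule has_vector_derivative_at_within)
  ultimately show ?thesis
    using \<open>a < x\<close> vector_derivative_unique_within_closed_interval[of a x x] by auto
qed

text \<open>\<open>D\<close> need not be connected, so every component gets its own base point for
  the integral.\<close>

lemma antiderivative_on_open:
  fixes \<omega> :: "real \<Rightarrow> 'a::euclidean_space"
  assumes "open D" "continuous_on D \<omega>"
  obtains G where "\<And>x. x \<in> D \<Longrightarrow> (G has_vector_derivative \<omega> x) (at x)"
proof -
  define base where "base x = (SOME c. c \<in> connected_component_set D x)" for x
  define G where "G x = (LBINT y=base x..x. \<omega> y)" for x
  have "(G has_vector_derivative \<omega> x) (at x)" if "x \<in> D" for x
  proof -
    let ?C = "connected_component_set D x"
    have C: "open ?C" "is_interval ?C" "x \<in> ?C" "?C \<subseteq> D"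
      using assms(1) that
      by (auto simp: open_connected_component is_interval_connected_1 connected_component_subset)
    have "base x \<in> ?C" unfolding base_def using C(3) by (rule someI)
    \<comment> \<open>The base point is chosen from the component as a set, so all points of the
      component share it.\<close>
    moreover have base: "base x' = base x" if "x' \<in> ?C" for x'
      using that by (simp add: base_def connected_component_eq)
    \<comment> \<open>Both \<open>x\<close> and its base point need room on either side: the
      interval \<open>{a..b}\<close> built below has them in its interior, so the derivative within
      it is a full derivative.\<close>
    have "\<exists>a b. a < z \<and> z < b \<and> {a..b} \<subseteq> ?C" if z: "z \<in> ?C" for z
    proof -
      obtain e where "e > 0" "cball z e \<subseteq> ?C" using C(1) z by (meson open_contains_cball)
      then show ?thesis
        by (intro exI[of _ "z - e"] exI[of _ "z + e"]) (auto simp: cball_eq_atLeastAtMost)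
    qed
    ultimately obtain a1 b1 a2 b2 where ab: "a1 < x" "x < b1" "a2 < base x" "base x < b2"
      "{a1..b1} \<subseteq> ?C" "{a2..b2} \<subseteq> ?C" using C(3) by meson
    define a b where "a = min a1 a2" and "b = max b1 b2"
    have "a1 \<in> ?C" "b1 \<in> ?C" "a2 \<in> ?C" "b2 \<in> ?C"
      using ab by (meson atLeastAtMost_iff less_imp_le less_trans order_refl subsetD)+
    then have "a \<in> ?C" "b \<in> ?C" by (simp_all add: a_def b_def min_def max_def)
    then have "{a..b} \<subseteq> ?C" using C(2) unfolding is_interval_1 by (meson atLeastAtMost_iff subsetI)
    moreover have "a < x" "x < b" "a < base x" "base x < b" using ab by (auto simp: a_def b_def)
    ultimately have "((\<lambda>u. LBINT y=base x..u. \<omega> y) has_vector_derivative \<omega> x) (at x within {a..b})"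
      using C(4) by (intro interval_integral_FTC2 continuous_on_subset[OF assms(2)]) auto
    then have "((\<lambda>u. LBINT y=base x..u. \<omega> y) has_vector_derivative \<omega> x) (at x)"
      using \<open>a < x\<close> \<open>x < b\<close> by (simp add: at_within_Icc_at)
    then show ?thesis
      by (rule has_vector_derivative_transform_within_open[OF _ C(1,3)]) (simp add: G_def base)
  qed
  then show ?thesis by (rule that)
qed

text \<open>With \<open>G\<close> an antiderivative of \<open>w' / w\<close>, the function
  \<open>w * exp (- G)\<close> has derivative zero; its values, possibly different on the components
  of \<open>D\<close>, are absorbed by adding their logarithm to \<open>G\<close>.\<close>

lemma smooth_logarithm:
  fixes w :: "real \<Rightarrow> complex"
  assumes "open D" "smooth_on D w" "\<And>y. y \<in> D \<Longrightarrow> w y \<noteq> 0"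
  obtains l where "smooth_on D l" "\<And>y. y \<in> D \<Longrightarrow> w y = exp (l y)"
proof -
  let ?w' = "\<lambda>y. frechet_derivative w (at y) 1"
  have sm: "smooth_on D (\<lambda>y. ?w' y / w y)"
    using assms by (intro smooth_on_divide smooth_on_frechet_derivative)
  obtain G where G: "\<And>y. y \<in> D \<Longrightarrow> (G has_vector_derivative ?w' y / w y) (at y)"
    using antiderivative_on_open[OF assms(1) smooth_on_imp_continuous_on[OF sm]] by blast
  define c where "c y = w y * exp (- G y)" for y
  have c0: "(c has_vector_derivative 0) (at y)" if "y \<in> D" for y
  proof -
    have "((exp \<circ> (\<lambda>y. - G y)) has_vector_derivative (- (?w' y / w y)) * exp (- G y)) (at y)"
      by (intro field_vector_diff_chain_at DERIV_exp has_vector_derivative_minus G that)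
    from has_vector_derivative_mult[OF smooth_on_has_vector_derivative[OF assms(2) that] this]
    show ?thesis using assms(3)[OF that] by (simp add: c_def[abs_def] o_def)
  qed
  text \<open>\<open>c\<close> is locally constant, so \<open>Ln \<circ> c\<close> is smooth although \<open>Ln\<close> is discontinuous.\<close>
  have cloc: "\<exists>U. open U \<and> y \<in> U \<and> U \<subseteq> D \<and> (\<forall>z\<in>U. c z = c y)" if y: "y \<in> D" for y
  proof -
    obtain e where e: "e > 0" "ball y e \<subseteq> D" using assms(1) y by (meson open_contains_ball)
    have "c z = c y" if "z \<in> ball y e" for z
    proof (rule has_derivative_zero_unique[OF convex_ball _ that])
      show "(c has_derivative (\<lambda>h. 0)) (at u within ball y e)" if "u \<in> ball y e" for u
      proof -
        have "u \<in> D" using e(2) that by blast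
        from has_derivative_at_withinI[OF c0[OF this, unfolded has_vector_derivative_def]]
        show ?thesis by simp
      qed
    qed (simp add: e(1))
    then show ?thesis using e by (metis open_ball centre_in_ball)
  qed
  have "((\<lambda>y. Ln (c y)) has_vector_derivative 0) (at y)" if y: "y \<in> D" for y
  proof -
    obtain U where U: "open U" "y \<in> U" "\<And>z. z \<in> U \<Longrightarrow> c z = c y" using cloc[OF y] by metis
    show ?thesis
      by (rule has_vector_derivative_transform_within_open[OF has_vector_derivative_const[of "Ln (c y)"] U(1,2)])
        (simp add: U(3))
  qed
  then have "((\<lambda>y. G y + Ln (c y)) has_vector_derivative ?w' y / w y) (at y)" if "y \<in> D" for y
    using has_vector_derivative_add[OF G] that by fastforce
  then have "smooth_on D (\<lambda>y. G y + Ln (c y))"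
    by (rule smooth_on_vector_derivativeI[OF assms(1) _ sm])
  moreover have "w y = exp (G y + Ln (c y))" if "y \<in> D" for y
    using assms(3)[OF that] by (simp add: c_def exp_add exp_minus)
  ultimately show ?thesis by (rule that)
qed

section \<open>Smooth polar coordinates\<close>

text \<open>
  The unit curve \<open>\<beta> / cnj \<beta> = exp (2 i \<theta>)\<close> does not see the sign of \<open>r\<close>, hence extends smoothly through
  the simple zeros of \<open>\<beta>\<close>; half of its logarithm is the polar angle.
\<close>

lemma smooth_signed_polar_form:
  fixes \<beta> :: "real \<Rightarrow> complex"
  assumes D: "open D" and \<beta>: "smooth_on D \<beta>"
    and zeros: "\<And>y. y \<in> D \<Longrightarrow> \<beta> y = 0 \<Longrightarrow>
      frechet_derivative \<beta> (at y) 1 \<noteq> 0 \<or> (\<exists>U. open U \<and> y \<in> U \<and> (\<forall>z\<in>U. \<beta> z = 0))"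
  obtains r \<theta> :: "real \<Rightarrow> real" where "smooth_on D r" "smooth_on D \<theta>"
    "\<And>y. y \<in> D \<Longrightarrow> \<beta> y = of_real (r y) * cis (\<theta> y)"
proof -
  let ?\<beta>' = "\<lambda>y. frechet_derivative \<beta> (at y) 1"
  \<comment> \<open>At a zero with nonzero derivative the value is the limit of the phase; where
    \<open>\<beta>\<close> vanishes identically nearby, the constant \<open>1\<close> is
    taken.\<close>
  define w where "w y = (if \<beta> y \<noteq> 0 then \<beta> y / cnj (\<beta> y)
    else if ?\<beta>' y \<noteq> 0 then ?\<beta>' y / cnj (?\<beta>' y) else 1)" for y
  \<comment> \<open>Near a given point the phase is that of some nonvanishing smooth
    \<open>f\<close>: of \<open>\<beta>\<close> itself off its zeros, and of the divided difference
    \<open>v\<close> at a simple zero.\<close>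
  have quot: "\<exists>U. open U \<and> y \<in> U \<and> smooth_on U w"
    if f: "open V" "y \<in> V" "smooth_on V f" "f y \<noteq> 0"
      and eq: "\<And>z. z \<in> V \<Longrightarrow> f z \<noteq> 0 \<Longrightarrow> w z = f z / cnj (f z)"
    for y and f :: "real \<Rightarrow> complex" and V
  proof -
    let ?U = "V \<inter> f -` (- {0})"
    have U: "open ?U"
      using continuous_open_preimage[OF smooth_on_imp_continuous_on[OF f(3)] f(1), of "- {0}"] by auto
    have "smooth_on ?U f" using f(3) by (rule smooth_on_subset) simp
    then have "smooth_on ?U (\<lambda>z. f z / cnj (f z))"
      using U by (intro smooth_on_divide smooth_on_bounded_linear[OF _ bounded_linear_cnj]) auto
    then have "smooth_on ?U w"
      by (rule iffD1[OF smooth_on_cong[OF U], rotated]) (simp add: eq)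
    then show ?thesis using U f(2,4) by (intro exI[of _ ?U]) auto
  qed
  have "\<exists>U. open U \<and> y \<in> U \<and> smooth_on U w" if y: "y \<in> D" for y
  proof (cases "\<beta> y = 0")
    case False
    then show ?thesis by (intro quot[OF D y \<beta>]) (simp_all add: w_def)
  next
    case zero: True
    show ?thesis
    proof (cases "\<exists>U. open U \<and> y \<in> U \<and> (\<forall>z\<in>U. \<beta> z = 0)")
      case True
      then obtain U where U: "open U" "y \<in> U" "\<And>z. z \<in> U \<Longrightarrow> \<beta> z = 0" by blast
      have "?\<beta>' z = 0" if "z \<in> U" for z
        using fun_cong[OF frechet_derivative_transform_within_open[OF _ U(1) that, of "\<lambda>_. 0" \<beta>], of 1]
          U(3) by simp
      then have "w z = 1" if "z \<in> U" for z using that U(3) by (simp add: w_def)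
      then have "smooth_on U w"
        using iffD1[OF smooth_on_cong[OF U(1)] smooth_on_const[OF U(1), of 1]] by metis
      then show ?thesis using U by blast
    next
      case False
      then have nz: "?\<beta>' y \<noteq> 0" using zeros[OF y zero] by blast
      obtain e where e: "e > 0" "ball y e \<subseteq> D" using D y by (meson open_contains_ball)
      have yb: "y \<in> ball y e" using e(1) by simp
      obtain v where v: "smooth_on (ball y e) v" "\<And>z. z \<in> ball y e \<Longrightarrow> \<beta> z = (z - y) *\<^sub>R v z"
        using smooth_on_divided_difference[OF open_ball convex_ball yb smooth_on_subset[OF \<beta> e(2)] zero]
        by blast
      have "((\<lambda>z. z - y) has_real_derivative 1) (at y)" by (auto intro!: derivative_eq_intros)
      from has_vector_derivative_scaleR[OF this smooth_on_has_vector_derivative[OF v(1) yb]]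
      have "((\<lambda>z. (z - y) *\<^sub>R v z) has_vector_derivative v y) (at y)" by simp
      then have "(\<beta> has_vector_derivative v y) (at y)"
        by (rule has_vector_derivative_transform_within_open[OF _ open_ball yb]) (simp add: v(2))
      then have vy: "v y = ?\<beta>' y"
        using smooth_on_has_vector_derivative[OF \<beta> y] by (rule vector_derivative_unique_at)
      show ?thesis
      proof (rule quot[OF open_ball yb v(1)])
        show "v y \<noteq> 0" using vy nz by simp
        \<comment> \<open>Off \<open>y\<close> the real factor \<open>z - y\<close> cancels from
          \<open>\<beta> / cnj \<beta>\<close>; at \<open>y\<close> the value \<open>v y\<close> is
          the derivative of \<open>\<beta>\<close>, matching the second branch of
          \<open>w\<close>.\<close>
        show "w z = v z / cnj (v z)" if "z \<in> ball y e" "v z \<noteq> 0" for z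
          using that v(2)[OF that(1)] zero nz vy
          by (cases "z = y") (auto simp: w_def scaleR_conv_of_real)
      qed
    qed
  qed
  then have "smooth_on D w" by (rule smooth_on_local)
  moreover have "w y \<noteq> 0" for y by (simp add: w_def)
  ultimately obtain l where l: "smooth_on D l" "\<And>y. y \<in> D \<Longrightarrow> w y = exp (l y)"
    using smooth_logarithm[OF D] by metis
  define \<theta> where "\<theta> y = Im (l y) / 2" for y
  \<comment> \<open>As a real part, unlike a modulus, \<open>r\<close> may change sign through a
    simple zero.\<close>
  define r where "r y = Re (\<beta> y * cis (- \<theta> y))" for y
  have \<theta>: "smooth_on D \<theta>"
    unfolding \<theta>_def using D l(1)
    by (intro smooth_on_divide smooth_on_bounded_linear[OF _ bounded_linear_Im] smooth_on_const) auto
  have "smooth_on D (\<lambda>y. Re (\<beta> y) * cos (\<theta> y) + Im (\<beta> y) * sin (\<theta> y))"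
    using D \<beta> \<theta> by (intro smooth_on_intros smooth_on_bounded_linear[OF _ bounded_linear_Im]
      smooth_on_bounded_linear[OF _ bounded_linear_Re])
  then have "smooth_on D r" by (simp add: r_def[abs_def])
  moreover have "\<beta> y = of_real (r y) * cis (\<theta> y)" if y: "y \<in> D" for y
  proof (cases "\<beta> y = 0")
    case True
    then show ?thesis by (simp add: r_def)
  next
    case False
    \<comment> \<open>\<open>z\<close> is shown to equal its conjugate, so nothing is lost by taking
      the real part in \<open>r\<close>.\<close>
    define z where "z = \<beta> y * cis (- \<theta> y)"
    have "cmod (w y) = 1" using False by (simp add: w_def norm_divide)
    then have "Re (l y) = 0" using l(2)[OF y] by simp
    then have "w y = cis (2 * \<theta> y)" using l(2)[OF y] by (simp add: exp_eq_polar \<theta>_def)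
    then have "\<beta> y = cis (\<theta> y) * cis (\<theta> y) * cnj (\<beta> y)"
      using False by (simp add: w_def cis_mult field_simps)
    then have "z = cis (\<theta> y) * cis (\<theta> y) * cnj (\<beta> y) * cis (- \<theta> y)"
      unfolding z_def by (rule arg_cong)
    also have "\<dots> = cis (\<theta> y) * cnj (\<beta> y) * (cis (\<theta> y) * cis (- \<theta> y))"
      by (simp only: mult_ac)
    also have "\<dots> = cnj z"
      unfolding cis_mult by (simp add: z_def cis_cnj mult.commute)
    finally have "z = cnj z" .
    then have "z = of_real (Re z)" by (simp add: complex_eq_iff)
    moreover have "\<beta> y = z * cis (\<theta> y)" by (simp add: z_def cis_mult mult.assoc)
    ultimately show ?thesis unfolding r_def z_def by simp
  qed
  ultimately show ?thesis using \<theta> by (intro that)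
qed

text \<open>
  The ODE that the first row of the matrix \<open>A(y)\<close> of a helix surface satisfies; \<open>h\<close> is a constant multiple
  of \<open>\<eta>\<close>. On the open dense set \<open>D\<close> the zeros of \<open>\<beta>\<close> are simple or \<open>\<beta>\<close> vanishes nearby.
\<close>

locale matrix_ode =
  fixes K :: "real set" and h :: "real \<Rightarrow> real" and \<alpha> \<beta> :: "real \<Rightarrow> complex"
  assumes openK: "open K" and h: "smooth_on K h"
    and \<alpha>': "y \<in> K \<Longrightarrow> (\<alpha> has_vector_derivative \<i> * (\<alpha> y - of_real (h y) * \<beta> y)) (at y)"
    and \<beta>': "y \<in> K \<Longrightarrow> (\<beta> has_vector_derivative \<i> * of_real (h y) * \<alpha> y) (at y)"
    and unit: "y \<in> K \<Longrightarrow> (cmod (\<alpha> y))\<^sup>2 - (cmod (\<beta> y))\<^sup>2 = 1"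
begin

text \<open>At the points left out, \<open>h\<close> vanishes without vanishing nearby: a zero of
  \<open>\<beta>\<close> there has zero derivative, yet \<open>\<beta>\<close> need not be zero
  around it.\<close>

definition D where "D = {y\<in>K. h y \<noteq> 0} \<union> interior {y\<in>K. h y = 0}"

text \<open>Bootstrapping the ODE: entries of class \<open>C^k\<close> make its right-hand sides
  \<open>C^k\<close>, hence the entries \<open>C^(k+1)\<close>.\<close>

lemma smooth_entries: "smooth_on K \<alpha>" "smooth_on K \<beta>"
proof -
  have "Ck_on k K \<alpha> \<and> Ck_on k K \<beta>" for k
  proof (induction k)
    case 0
    then show ?case
      using \<alpha>' \<beta>' by (auto intro!: continuous_at_imp_continuous_on has_vector_derivative_continuous)
  next
    case (Suc k)
    have h: "Ck_on k K (\<lambda>y. complex_of_real (h y))"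
      using h Ck_on_bounded_linear[OF openK bounded_linear_of_real] by (auto simp: smooth_on_def)
    note I = Ck_on_bilinear[OF openK bounded_bilinear_mult] Ck_on_const[OF openK]
    have "Ck_on k K (\<lambda>y. \<i> * of_real (h y) * \<alpha> y)"
      using Suc h by (intro I) auto
    note \<beta>_k = this
    have "Ck_on k K (\<lambda>y. \<i> * (\<alpha> y + - 1 * (of_real (h y) * \<beta> y)))"
      using Suc h by (intro I Ck_on_add[OF openK]) auto
    then have \<alpha>_k: "Ck_on k K (\<lambda>y. \<i> * (\<alpha> y - of_real (h y) * \<beta> y))" by simp
    have step: "Ck_on (Suc k) K f"
      if "\<And>y. y \<in> K \<Longrightarrow> (f has_vector_derivative f' y) (at y)" "Ck_on k K f'" for f f' :: "real \<Rightarrow> complex"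
      by (rule Ck_on_SucI[OF openK that(1)[unfolded has_vector_derivative_def]])
        (assumption, rule Ck_on_bounded_linear[OF openK bounded_linear_scaleR_right that(2)])
    show ?case using step[OF \<alpha>' \<alpha>_k] step[OF \<beta>' \<beta>_k] by blast
  qed
  then show "smooth_on K \<alpha>" "smooth_on K \<beta>" by (simp_all add: smooth_on_def)
qed

lemma D: "open D" "D \<subseteq> K" "{y\<in>K. h y \<noteq> 0} \<subseteq> D" "K \<subseteq> closure D"
proof -
  have o: "open {y\<in>K. h y \<noteq> 0}"
    using continuous_open_preimage[OF smooth_on_imp_continuous_on[OF h] openK, of "- {0}"]
    by (auto simp: vimage_def Int_def)
  then show "open D" by (simp add: D_def open_Un)
  show "D \<subseteq> K" "{y\<in>K. h y \<noteq> 0} \<subseteq> D" using interior_subset by (auto simp: D_def)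
  show "K \<subseteq> closure D"
  proof
    fix y assume y: "y \<in> K"
    show "y \<in> closure D"
    proof (cases "y \<in> closure {y\<in>K. h y \<noteq> 0}")
      case True
      then show ?thesis using closure_mono[of "{y\<in>K. h y \<noteq> 0}" D] by (auto simp: D_def)
    next
      case False
      \<comment> \<open>Away from the closure of the nonzero set, \<open>h\<close> vanishes on an
        open set, which lies in the second part of \<open>D\<close>.\<close>
      let ?U = "K - closure {y\<in>K. h y \<noteq> 0}"
      have "open ?U" using openK by (rule open_Diff) simp
      moreover have "?U \<subseteq> {y\<in>K. h y = 0}" using closure_subset[of "{y\<in>K. h y \<noteq> 0}"] by auto
      ultimately have "?U \<subseteq> interior {y\<in>K. h y = 0}" by (simp add: interior_maximal)
      then have "y \<in> D" using y False by (auto simp: D_def)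
      then show ?thesis using closure_subset by blast
    qed
  qed
qed

lemma \<alpha>_nonzero: "y \<in> K \<Longrightarrow> \<alpha> y \<noteq> 0"
  using unit[of y] by (metis diff_0 neg_equal_iff_equal norm_zero power_zero_numeral zero_le_power2
    neg_le_0_iff_le not_one_le_zero)

text \<open>\<open>\<alpha>\<close> never vanishes, so a logarithm on all of \<open>K\<close> gives
  \<open>\<xi>2\<close>; \<open>\<beta>\<close> may vanish and gets a smooth signed radius and angle
  on \<open>D\<close> only. \<open>\<xi>1\<close> is \<open>arsinh\<close> of the signed radius, and
  the unit condition then makes \<open>cosh \<xi>1\<close> the modulus of
  \<open>\<alpha>\<close>.\<close>

lemma polar_parameters:
  obtains \<xi>1 \<xi>2 \<xi>3 :: "real \<Rightarrow> real" where
    "smooth_on K \<xi>2" "smooth_on D \<xi>1" "smooth_on D \<xi>3"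
    "\<And>y. y \<in> K \<Longrightarrow> \<alpha> y = of_real (cosh (\<xi>1 y)) * cis (\<xi>2 y)"
    "\<And>y. y \<in> K \<Longrightarrow> \<beta> y = of_real (sinh (\<xi>1 y)) * cis (\<xi>3 y)"
proof -
  have zeros: "frechet_derivative \<beta> (at y) 1 \<noteq> 0 \<or> (\<exists>U. open U \<and> y \<in> U \<and> (\<forall>z\<in>U. \<beta> z = 0))"
    if y: "y \<in> D" and zero: "\<beta> y = 0" for y
  proof (cases "h y = 0")
    case False
    have yK: "y \<in> K" using y D(2) by blast
    then have "frechet_derivative \<beta> (at y) 1 = \<i> * of_real (h y) * \<alpha> y"
      using smooth_on_has_vector_derivative[OF smooth_entries(2) yK] \<beta>'[OF yK]
      by (rule_tac vector_derivative_unique_at)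
    then show ?thesis using False \<alpha>_nonzero[OF yK] by simp
  next
    case True
    then have "y \<in> interior {y\<in>K. h y = 0}" using y by (simp add: D_def)
    then obtain e where e: "e > 0" "ball y e \<subseteq> {y\<in>K. h y = 0}" by (meson mem_interior)
    have "\<beta> z = \<beta> y" if z: "z \<in> ball y e" for z
    proof (rule has_derivative_zero_unique[OF convex_ball _ z])
      show "(\<beta> has_derivative (\<lambda>x. 0)) (at u within ball y e)" if "u \<in> ball y e" for u
      proof -
        have u: "u \<in> K" "h u = 0" using that e(2) by auto
        from has_derivative_at_withinI[OF \<beta>'[OF u(1), unfolded has_vector_derivative_def u(2)]]
        show ?thesis by simp
      qed
    qed (simp add: e(1))
    then have "open (ball y e) \<and> y \<in> ball y e \<and> (\<forall>z\<in>ball y e. \<beta> z = 0)" using zero e(1) by simp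
    then show ?thesis by blast
  qed
  obtain r \<theta> where r: "smooth_on D r" "smooth_on D \<theta>" "\<And>y. y \<in> D \<Longrightarrow> \<beta> y = of_real (r y) * cis (\<theta> y)"
    using smooth_signed_polar_form[OF D(1) smooth_on_subset[OF smooth_entries(2) D(2)] zeros] by metis
  obtain l where l: "smooth_on K l" "\<And>y. y \<in> K \<Longrightarrow> \<alpha> y = exp (l y)"
    using smooth_logarithm[OF openK smooth_entries(1) \<alpha>_nonzero] by metis
  \<comment> \<open>Off \<open>D\<close> only a pointwise polar form is required, so modulus and
    \<open>Arg\<close> serve.\<close>
  define s where "s y = (if y \<in> D then r y else cmod (\<beta> y))" for y
  define \<xi>3 where "\<xi>3 y = (if y \<in> D then \<theta> y else Arg (\<beta> y))" for y
  have \<beta>: "\<beta> y = of_real (s y) * cis (\<xi>3 y)" for y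
    by (simp add: s_def \<xi>3_def r(3) rcis_def[symmetric] rcis_cmod_Arg)
  have "smooth_on D s" "smooth_on D \<xi>3"
    using r(1,2) smooth_on_cong[OF D(1), of s r] smooth_on_cong[OF D(1), of \<xi>3 \<theta>]
    by (simp_all add: s_def \<xi>3_def)
  then have "smooth_on D (\<lambda>y. arsinh (s y))" "smooth_on D \<xi>3"
    using D(1) by (auto intro: smooth_on_arsinh)
  moreover have "smooth_on K (\<lambda>y. Im (l y))"
    using openK l(1) by (intro smooth_on_bounded_linear[OF _ bounded_linear_Im])
  moreover have "\<alpha> y = of_real (cosh (arsinh (s y))) * cis (Im (l y))" if "y \<in> K" for y
  proof -
    have "(cmod (\<alpha> y))\<^sup>2 = 1 + (s y)\<^sup>2"
      using unit[OF that] by (simp add: \<beta> norm_mult)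
    then have "cmod (\<alpha> y) = cosh (arsinh (s y))"
      by (metis cosh_arsinh_real norm_ge_zero real_sqrt_unique add.commute)
    moreover have "\<alpha> y = of_real (cmod (\<alpha> y)) * cis (Im (l y))"
      using l(2)[OF that] by (simp add: exp_eq_polar norm_mult)
    ultimately show ?thesis by simp
  qed
  moreover have "\<beta> y = of_real (sinh (arsinh (s y))) * cis (\<xi>3 y)" for y
    by (simp add: \<beta>)
  ultimately show ?thesis using that[of "\<lambda>y. Im (l y)" "\<lambda>y. arsinh (s y)" \<xi>3] by blast
qed

end

section \<open>The matrices\<close>

lemmas J_defs = J1_def J2_def J3_def

lemma bounded_linear_J: "bounded_linear J1" "bounded_linear J2" "bounded_linear J3"
  unfolding linear_conv_bounded_linear[symmetric]
  by (auto intro!: linearI simp: J_defs vec_eq_iff forall_4)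

lemma bounded_bilinear_g0: "bounded_bilinear g0"
  unfolding bilinear_conv_bounded_bilinear[symmetric] bilinear_def
  by (auto intro!: linearI simp: g0_def algebra_simps)

text \<open>\<open>A_mat\<close> is given by rows. Its first and third columns determine it, because
  the second and fourth are their images under \<open>J1\<close>.\<close>

definition A_col1 :: "real \<Rightarrow> real \<Rightarrow> real \<Rightarrow> real \<Rightarrow> real^4" where
  "A_col1 t t1 t2 t3 = vector [cosh t1 * cos t2, cosh t1 * sin t2,
     sinh t1 * sin (t - t3), - sinh t1 * cos (t - t3)]"

definition A_col3 :: "real \<Rightarrow> real \<Rightarrow> real \<Rightarrow> real \<Rightarrow> real^4" where
  "A_col3 t t1 t2 t3 = vector [sinh t1 * cos t3, sinh t1 * sin t3,
     cosh t1 * sin (t - t2), - cosh t1 * cos (t - t2)]"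

lemma A_mat_mult:
  "A_mat t t1 t2 t3 *v v = v$1 *\<^sub>R A_col1 t t1 t2 t3 + v$2 *\<^sub>R J1 (A_col1 t t1 t2 t3)
     + v$3 *\<^sub>R A_col3 t t1 t2 t3 + v$4 *\<^sub>R J1 (A_col3 t t1 t2 t3)"
  by (simp add: A_mat_def Let_def A_row1_def A_col1_def A_col3_def J_defs vec_eq_iff forall_4
      matrix_vector_mult_def sum_4 sin_diff cos_diff algebra_simps)

text \<open>Removes \<open>t\<close> from the products of columns by viewing \<open>t2 - t3\<close>
  as the difference of \<open>t - t3\<close> and \<open>t - t2\<close>.\<close>

lemma angle_differences:
  fixes t t2 t3 :: real
  shows "cos (t - t3) * cos (t - t2) + sin (t - t3) * sin (t - t2) = cos t2 * cos t3 + sin t2 * sin t3"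
    and "sin (t - t3) * cos (t - t2) - cos (t - t3) * sin (t - t2) = sin t2 * cos t3 - cos t2 * sin t3"
  using cos_diff[of "t - t3" "t - t2"] cos_diff[of t2 t3] sin_diff[of "t - t3" "t - t2"] sin_diff[of t2 t3]
  by auto

lemma A_cols_g0:
  "g0 (A_col1 t t1 t2 t3) (A_col1 t t1 t2 t3) = 1"
  "g0 (A_col3 t t1 t2 t3) (A_col3 t t1 t2 t3) = -1"
  "g0 (A_col1 t t1 t2 t3) (A_col3 t t1 t2 t3) = 0"
  "g0 (A_col1 t t1 t2 t3) (J1 (A_col3 t t1 t2 t3)) = 0"
proof -
  have c: "(cosh t1)\<^sup>2 = 1 + (sinh t1)\<^sup>2" by (simp add: cosh_square_eq)
  have a: "(sin x)\<^sup>2 = 1 - (cos x)\<^sup>2" for x :: real by (simp add: sin_squared_eq)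
  note ac = angle_differences[of t t3 t2]
  show "g0 (A_col1 t t1 t2 t3) (A_col1 t t1 t2 t3) = 1"
    using c a[of t2] a[of "t - t3"] by (simp add: g0_def A_col1_def) algebra
  show "g0 (A_col3 t t1 t2 t3) (A_col3 t t1 t2 t3) = -1"
    using c a[of t3] a[of "t - t2"] by (simp add: g0_def A_col3_def) algebra
  show "g0 (A_col1 t t1 t2 t3) (A_col3 t t1 t2 t3) = 0"
    using ac(1) by (simp add: g0_def A_col1_def A_col3_def) algebra
  show "g0 (A_col1 t t1 t2 t3) (J1 (A_col3 t t1 t2 t3)) = 0"
    using ac(2) by (simp add: g0_def A_col1_def A_col3_def J_defs) algebra
qed

lemma g0_J1: "g0 (J1 u) (J1 v) = g0 u v" "g0 (J1 u) v = - g0 u (J1 v)"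
  by (simp_all add: g0_def J_defs)

lemma g0_simps:
  "g0 (u + v) w = g0 u w + g0 v w" "g0 w (u + v) = g0 w u + g0 w v"
  "g0 (u - v) w = g0 u w - g0 v w" "g0 w (u - v) = g0 w u - g0 w v"
  "g0 (- u) w = - g0 u w" "g0 w (- u) = - g0 w u"
  "g0 (a *\<^sub>R u) w = a * g0 u w" "g0 w (a *\<^sub>R u) = a * g0 w u"
  by (simp_all add: g0_def algebra_simps)

lemma g0_commute: "g0 u v = g0 v u"
  by (simp add: g0_def algebra_simps)

lemma J1_simps: "J1 (u + v) = J1 u + J1 v" "J1 (u - v) = J1 u - J1 v" "J1 (- u) = - J1 u"
  "J1 (a *\<^sub>R u) = a *\<^sub>R J1 u" "J1 (J1 u) = - u"
  by (simp_all add: J_defs vec_eq_iff forall_4)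

text \<open>\<open>J1\<close> preserves \<open>g0\<close>, so by \<open>A_cols_g0\<close> the four
  columns form a pseudo-orthonormal basis with the signs of the standard one.\<close>

lemma A_mat_pseudo_orthogonal: "pseudo_orthogonal (A_mat t t1 t2 t3)"
proof -
  let ?a = "A_col1 t t1 t2 t3" and ?b = "A_col3 t t1 t2 t3"
  have "g0 (J1 ?a) ?a = 0" "g0 ?a (J1 ?a) = 0" "g0 (J1 ?b) ?b = 0" "g0 ?b (J1 ?b) = 0"
    by (simp_all add: g0_def J_defs)
  moreover have "g0 ?b ?a = 0" "g0 (J1 ?b) ?a = 0"
    using A_cols_g0(3,4) by (simp_all add: g0_commute)
  moreover have "g0 (J1 ?a) ?b = 0" "g0 ?b (J1 ?a) = 0"
    using A_cols_g0(4)[of t t1 t2 t3] g0_J1(2)[of ?a ?b] g0_commute[of ?b "J1 ?a"] by simp_all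
  ultimately show ?thesis
    by (simp add: pseudo_orthogonal_def A_mat_mult g0_simps A_cols_g0 g0_J1(1))
      (simp add: g0_def)
qed

lemma A_mat_commutes_J1: "A_mat t t1 t2 t3 *v J1 v = J1 (A_mat t t1 t2 t3 *v v)"
  by (simp add: A_mat_mult J1_simps) (simp add: J1_def algebra_simps)

lemma A_mat_gamma_line:
  "A_mat t t1 t2 t3 *v gamma_line \<kappa> \<tau> lam \<nu> x = (2 / sqrt \<kappa>) *\<^sub>R A_col3 t t1 t2 t3 +
     (\<nu>\<^sup>2 * \<tau> * x) *\<^sub>R (A_col1 t t1 t2 t3 + lam *\<^sub>R J1 (A_col3 t t1 t2 t3))"
  by (simp add: A_mat_mult gamma_line_def scaleR_add_right algebra_simps)

lemma A_col3_derivative: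
  assumes "(\<xi> has_real_derivative d) (at y)" "(\<xi>1 has_real_derivative d1) (at y)"
    "(\<xi>2 has_real_derivative d2) (at y)" "(\<xi>3 has_real_derivative d3) (at y)"
    and B: "((\<lambda>y. A_col3 (\<xi> y) (\<xi>1 y) (\<xi>2 y) (\<xi>3 y)) has_vector_derivative B) (at y)"
  shows "B = vector [cosh (\<xi>1 y) * d1 * cos (\<xi>3 y) - sinh (\<xi>1 y) * sin (\<xi>3 y) * d3,
     cosh (\<xi>1 y) * d1 * sin (\<xi>3 y) + sinh (\<xi>1 y) * cos (\<xi>3 y) * d3,
     sinh (\<xi>1 y) * d1 * sin (\<xi> y - \<xi>2 y) + cosh (\<xi>1 y) * cos (\<xi> y - \<xi>2 y) * (d - d2),
     - (sinh (\<xi>1 y) * d1 * cos (\<xi> y - \<xi>2 y)) + cosh (\<xi>1 y) * sin (\<xi> y - \<xi>2 y) * (d - d2)]"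
proof -
  have nth: "((\<lambda>y. A_col3 (\<xi> y) (\<xi>1 y) (\<xi>2 y) (\<xi>3 y) $ i) has_real_derivative B $ i) (at y)" for i
    unfolding has_real_derivative_iff_has_vector_derivative
    by (rule bounded_linear.has_vector_derivative[OF bounded_linear_vec_nth B])
  show ?thesis
    unfolding vec_eq_iff forall_4 vector_4
    using nth[of 1] nth[of 2] nth[of 3] nth[of 4] assms(1-4)
    by (intro conjI) (auto elim!: DERIV_unique simp: A_col3_def intro!: derivative_eq_intros)
qed

text \<open>The origin of the relation between the angles: half of its left-hand side is the
  \<open>g0\<close>-product of \<open>f'\<close> with \<open>A e_1 + lam J1 f\<close>, where
  \<open>f\<close> is the third column.\<close>

lemma A_relation_iff:
  assumes "(\<xi> has_real_derivative d) (at y)" "(\<xi>1 has_real_derivative d1) (at y)"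
    "(\<xi>2 has_real_derivative d2) (at y)" "(\<xi>3 has_real_derivative d3) (at y)"
    and B: "((\<lambda>y. A_col3 (\<xi> y) (\<xi>1 y) (\<xi>2 y) (\<xi>3 y)) has_vector_derivative B) (at y)"
  shows "A_relation lam \<xi> \<xi>1 \<xi>2 \<xi>3 y \<longleftrightarrow>
    g0 (A_col1 (\<xi> y) (\<xi>1 y) (\<xi>2 y) (\<xi>3 y) + lam *\<^sub>R J1 (A_col3 (\<xi> y) (\<xi>1 y) (\<xi>2 y) (\<xi>3 y))) B = 0"
proof -
  let ?t = "\<xi> y" and ?t1 = "\<xi>1 y" and ?t2 = "\<xi>2 y" and ?t3 = "\<xi>3 y"
  have [simp]: "deriv \<xi> y = d" "deriv \<xi>1 y = d1" "deriv \<xi>2 y = d2" "deriv \<xi>3 y = d3"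
    using assms(1-4) by (auto intro: DERIV_imp_deriv)
  note B = A_col3_derivative[OF assms]
  have c: "(cosh ?t1)\<^sup>2 = 1 + (sinh ?t1)\<^sup>2" by (simp add: cosh_square_eq)
  have a: "(sin x)\<^sup>2 = 1 - (cos x)\<^sup>2" for x :: real by (simp add: sin_squared_eq)
  note ac = angle_differences[of ?t ?t3 ?t2]
  have "g0 (A_col1 ?t ?t1 ?t2 ?t3) B = d1 * cos (?t2 - ?t3)
      + cosh ?t1 * sinh ?t1 * (d2 + d3 - d) * sin (?t2 - ?t3)"
    using ac c by (simp add: B g0_def A_col1_def sin_diff[of ?t2] cos_diff[of ?t2]) algebra
  moreover have "g0 (J1 (A_col3 ?t ?t1 ?t2 ?t3)) B = d3 * (sinh ?t1)\<^sup>2 - (d - d2) * (cosh ?t1)\<^sup>2"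
    using a[of ?t3] a[of "?t - ?t2"] by (simp add: B g0_def A_col3_def J_defs) algebra
  ultimately show ?thesis
    by (simp add: A_relation_def g0_simps sinh_double) algebra
qed

section \<open>Structure equations\<close>

text \<open>The entries combine sine and cosine of \<open>\<xi>\<close> with real and imaginary
  parts of \<open>\<alpha>\<close> and \<open>\<beta>\<close>, so the matrix is smooth even where
  \<open>\<xi>1\<close> and \<open>\<xi>3\<close> are not.\<close>

lemma smooth_on_A_mat:
  assumes K: "open K" and "smooth_on K \<xi>" "smooth_on K \<alpha>" "smooth_on K \<beta>"
    and \<alpha>: "\<And>y. y \<in> K \<Longrightarrow> \<alpha> y = of_real (cosh (\<xi>1 y)) * cis (\<xi>2 y)"
    and \<beta>: "\<And>y. y \<in> K \<Longrightarrow> \<beta> y = of_real (sinh (\<xi>1 y)) * cis (\<xi>3 y)"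
  shows "smooth_on K (\<lambda>y. A_mat (\<xi> y) (\<xi>1 y) (\<xi>2 y) (\<xi>3 y))"
proof -
  define r where "r y = (vector [Re (\<alpha> y), - Im (\<alpha> y), Re (\<beta> y), - Im (\<beta> y)] :: real^4)" for y
  define r3 where "r3 y = sin (\<xi> y) *\<^sub>R J2 (r y) + cos (\<xi> y) *\<^sub>R J3 (r y)" for y
  have "smooth_on K (\<lambda>y. r y $ i)" for i
    using exhaust_4[of i] assms(2-4) K
    by (auto simp: r_def intro!: smooth_on_minus smooth_on_bounded_linear[OF _ bounded_linear_Re]
        smooth_on_bounded_linear[OF _ bounded_linear_Im])
  then have r: "smooth_on K r" by (rule smooth_on_vec[OF K])
  then have r3: "smooth_on K r3"
    unfolding r3_def using K assms(2)
    by (intro smooth_on_intros smooth_on_bounded_linear[OF _ bounded_linear_J(2)]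
        smooth_on_bounded_linear[OF _ bounded_linear_J(3)])
  have "smooth_on K (\<lambda>y. (vector [r y, J1 (r y), r3 y, J1 (r3 y)] :: real^4^4))"
  proof (rule smooth_on_vec[OF K])
    fix i :: 4
    show "smooth_on K (\<lambda>y. (vector [r y, J1 (r y), r3 y, J1 (r3 y)] :: real^4^4) $ i)"
      using exhaust_4[of i] r r3 K by (auto intro: smooth_on_bounded_linear[OF _ bounded_linear_J(1)])
  qed
  moreover have "A_row1 (\<xi>1 y) (\<xi>2 y) (\<xi>3 y) = r y" if "y \<in> K" for y
    using \<alpha>[OF that] \<beta>[OF that] by (simp add: A_row1_def r_def)
  ultimately show ?thesis
    by (subst smooth_on_cong[OF K, where g="\<lambda>y. vector [r y, J1 (r y), r3 y, J1 (r3 y)]"])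
      (simp_all add: A_mat_def Let_def r3_def)
qed

lemma smooth_on_partials:
  fixes f :: "real \<times> real \<Rightarrow> 'b::real_normed_vector"
  assumes "smooth_on S f" "(x, y) \<in> S"
  shows "((\<lambda>x. f (x, y)) has_vector_derivative frechet_derivative f (at (x, y)) (1, 0)) (at x)"
    and "((\<lambda>y. f (x, y)) has_vector_derivative frechet_derivative f (at (x, y)) (0, 1)) (at y)"
proof -
  have f: "(f has_derivative frechet_derivative f (at (x, y))) (at (x, y))"
    by (rule smooth_on_has_derivative[OF assms])
  have d: "((\<lambda>x. (x, y)) has_derivative (\<lambda>h. (h, 0))) (at x)"
    "((\<lambda>y. (x, y)) has_derivative (\<lambda>h. (0, h))) (at y)"
    by (auto intro!: derivative_eq_intros)
  have "((\<lambda>x. f (x, y)) has_derivative (\<lambda>h. frechet_derivative f (at (x, y)) (h, 0))) (at x)"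
    "((\<lambda>y. f (x, y)) has_derivative (\<lambda>h. frechet_derivative f (at (x, y)) (0, h))) (at y)"
    using has_derivative_compose[OF d(1) f] has_derivative_compose[OF d(2) f] by simp_all
  moreover have "(\<lambda>h. frechet_derivative f (at (x, y)) (h, 0)) = (\<lambda>h. h *\<^sub>R frechet_derivative f (at (x, y)) (1, 0))"
    "(\<lambda>h. frechet_derivative f (at (x, y)) (0, h)) = (\<lambda>h. h *\<^sub>R frechet_derivative f (at (x, y)) (0, 1))"
    unfolding linear_scale[OF has_derivative_linear[OF f], symmetric] by simp_all
  ultimately show "((\<lambda>x. f (x, y)) has_vector_derivative frechet_derivative f (at (x, y)) (1, 0)) (at x)"
    "((\<lambda>y. f (x, y)) has_vector_derivative frechet_derivative f (at (x, y)) (0, 1)) (at y)"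
    by (simp_all only: has_vector_derivative_def)
qed

lemma frechet_derivative_partials:
  fixes f :: "real \<times> real \<Rightarrow> 'b::real_normed_vector"
  assumes "smooth_on S f" "p \<in> S"
  shows "frechet_derivative f (at p) u =
    fst u *\<^sub>R frechet_derivative f (at p) (1, 0) + snd u *\<^sub>R frechet_derivative f (at p) (0, 1)"
proof -
  have lin: "linear (frechet_derivative f (at p))"
    using smooth_on_has_derivative[OF assms] by (rule has_derivative_linear)
  have "u = fst u *\<^sub>R (1, 0) + snd u *\<^sub>R (0, 1)" by (cases u) simp
  then show ?thesis using linear_add[OF lin] linear_scale[OF lin] by metis
qed

lemma smooth_on_mixed_partials:
  fixes F :: "real \<times> real \<Rightarrow> 'a::euclidean_space"
  assumes IK: "open I" "is_interval I" "open K" "is_interval K" and F: "smooth_on (I \<times> K) F"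
    and p: "p \<in> I \<times> K"
  shows "frechet_derivative (\<lambda>p. frechet_derivative F (at p) (1, 0)) (at p) (0, 1) =
    frechet_derivative (\<lambda>p. frechet_derivative F (at p) (0, 1)) (at p) (1, 0)"
proof -
  note D = smooth_on_frechet_derivative
  obtain x y where [simp]: "p = (x, y)" by (cases p)
  show ?thesis
    using mixed_partial_derivatives_eq[OF IK smooth_on_partials(1)[OF F] smooth_on_partials(2)[OF F]
        smooth_on_partials(2)[OF D[OF F]] smooth_on_partials(1)[OF D[OF F]]
        smooth_on_imp_continuous_on[OF D[OF F]] smooth_on_imp_continuous_on[OF D[OF D[OF F]]], of x y] p
    by simp
qed

text \<open>The vectors \<open>J1 q\<close>, \<open>J2 q\<close>, \<open>J3 q\<close> are
  \<open>g0\<close>-orthogonal with squares \<open>g0 q q\<close> up to sign.\<close>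

lemma J_combination_eq_0:
  assumes "a1 *\<^sub>R J1 q + a2 *\<^sub>R J2 q + a3 *\<^sub>R J3 q = 0" "g0 q q \<noteq> 0"
  shows "a1 = 0" "a2 = 0" "a3 = 0"
proof -
  let ?v = "a1 *\<^sub>R J1 q + a2 *\<^sub>R J2 q + a3 *\<^sub>R J3 q"
  have "g0 ?v (J1 q) = a1 * g0 q q" "g0 ?v (J2 q) = - (a2 * g0 q q)" "g0 ?v (J3 q) = - (a3 * g0 q q)"
    by (simp_all add: g0_def J_defs algebra_simps)
  then show "a1 = 0" "a2 = 0" "a3 = 0"
    using assms by (simp_all add: g0_def)
qed

text \<open>
  The Maurer-Cartan equations: anti-de Sitter space is the group \<open>SL(2, \<real>)\<close>, on which the fields \<open>q \<mapsto> J\<^sub>i q\<close> are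
  invariant under translations from one side.
\<close>

lemma structure_equations:
  fixes F :: "real \<times> real \<Rightarrow> real^4"
  assumes IK: "open I" "is_interval I" "open K" "is_interval K" and F: "smooth_on (I \<times> K) F"
    and nz: "\<And>p. p \<in> I \<times> K \<Longrightarrow> g0 (F p) (F p) \<noteq> 0"
    and Fx: "\<And>p. p \<in> I \<times> K \<Longrightarrow> frechet_derivative F (at p) (1, 0) =
      p1 p *\<^sub>R J1 (F p) + p2 p *\<^sub>R J2 (F p) + p3 p *\<^sub>R J3 (F p)"
    and Fy: "\<And>p. p \<in> I \<times> K \<Longrightarrow> frechet_derivative F (at p) (0, 1) =
      q1 p *\<^sub>R J1 (F p) + q2 p *\<^sub>R J2 (F p) + q3 p *\<^sub>R J3 (F p)"
    and xy: "x \<in> I" "y \<in> K"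
    and p': "((\<lambda>y. p1 (x, y)) has_real_derivative p1') (at y)"
      "((\<lambda>y. p2 (x, y)) has_real_derivative p2') (at y)"
      "((\<lambda>y. p3 (x, y)) has_real_derivative p3') (at y)"
    and q': "((\<lambda>x. q1 (x, y)) has_real_derivative q1') (at x)"
      "((\<lambda>x. q2 (x, y)) has_real_derivative q2') (at x)"
      "((\<lambda>x. q3 (x, y)) has_real_derivative q3') (at x)"
  defines "p \<equiv> (x, y)"
  shows "p1' - q1' = 2 * (p2 p * q3 p - p3 p * q2 p)"
    and "p2' - q2' = 2 * (p1 p * q3 p - p3 p * q1 p)"
    and "p3' - q3' = 2 * (p2 p * q1 p - p1 p * q2 p)"
proof -
  let ?F = "F p" and ?Fx = "frechet_derivative F (at p) (1, 0)" and ?Fy = "frechet_derivative F (at p) (0, 1)"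
  note D = smooth_on_frechet_derivative
  have pIK: "(x, y) \<in> I \<times> K" using xy by simp
  have dx: "((\<lambda>x. J (F (x, y))) has_vector_derivative J ?Fx) (at x)"
    and dy: "((\<lambda>y. J (F (x, y))) has_vector_derivative J ?Fy) (at y)"
    if "bounded_linear J" for J :: "real^4 \<Rightarrow> real^4"
    unfolding p_def using smooth_on_partials[OF F pIK]
    by (auto intro: bounded_linear.has_vector_derivative[OF that])
  have "((\<lambda>y. p1 (x, y) *\<^sub>R J1 (F (x, y)) + p2 (x, y) *\<^sub>R J2 (F (x, y)) + p3 (x, y) *\<^sub>R J3 (F (x, y)))
      has_vector_derivative (p1 p *\<^sub>R J1 ?Fy + p1' *\<^sub>R J1 ?F) + (p2 p *\<^sub>R J2 ?Fy + p2' *\<^sub>R J2 ?F)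
        + (p3 p *\<^sub>R J3 ?Fy + p3' *\<^sub>R J3 ?F)) (at y)"
    unfolding p_def
    by (intro has_vector_derivative_add has_vector_derivative_scaleR p'
        dy[OF bounded_linear_J(1), unfolded p_def] dy[OF bounded_linear_J(2), unfolded p_def] dy[OF bounded_linear_J(3), unfolded p_def])
  then have Py: "((\<lambda>y. frechet_derivative F (at (x, y)) (1, 0))
      has_vector_derivative (p1 p *\<^sub>R J1 ?Fy + p1' *\<^sub>R J1 ?F) + (p2 p *\<^sub>R J2 ?Fy + p2' *\<^sub>R J2 ?F)
        + (p3 p *\<^sub>R J3 ?Fy + p3' *\<^sub>R J3 ?F)) (at y)"
    by (rule has_vector_derivative_transform_within_open[OF _ IK(3) xy(2)]) (simp add: Fx xy)
  have "((\<lambda>x. q1 (x, y) *\<^sub>R J1 (F (x, y)) + q2 (x, y) *\<^sub>R J2 (F (x, y)) + q3 (x, y) *\<^sub>R J3 (F (x, y)))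
      has_vector_derivative (q1 p *\<^sub>R J1 ?Fx + q1' *\<^sub>R J1 ?F) + (q2 p *\<^sub>R J2 ?Fx + q2' *\<^sub>R J2 ?F)
        + (q3 p *\<^sub>R J3 ?Fx + q3' *\<^sub>R J3 ?F)) (at x)"
    unfolding p_def
    by (intro has_vector_derivative_add has_vector_derivative_scaleR q'
        dx[OF bounded_linear_J(1), unfolded p_def] dx[OF bounded_linear_J(2), unfolded p_def] dx[OF bounded_linear_J(3), unfolded p_def])
  then have Qx: "((\<lambda>x. frechet_derivative F (at (x, y)) (0, 1))
      has_vector_derivative (q1 p *\<^sub>R J1 ?Fx + q1' *\<^sub>R J1 ?F) + (q2 p *\<^sub>R J2 ?Fx + q2' *\<^sub>R J2 ?F)
        + (q3 p *\<^sub>R J3 ?Fx + q3' *\<^sub>R J3 ?F)) (at x)"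
    by (rule has_vector_derivative_transform_within_open[OF _ IK(1) xy(1)]) (simp add: Fy xy)
  have "(p1 p *\<^sub>R J1 ?Fy + p1' *\<^sub>R J1 ?F) + (p2 p *\<^sub>R J2 ?Fy + p2' *\<^sub>R J2 ?F)
        + (p3 p *\<^sub>R J3 ?Fy + p3' *\<^sub>R J3 ?F)
      = (q1 p *\<^sub>R J1 ?Fx + q1' *\<^sub>R J1 ?F) + (q2 p *\<^sub>R J2 ?Fx + q2' *\<^sub>R J2 ?F)
        + (q3 p *\<^sub>R J3 ?Fx + q3' *\<^sub>R J3 ?F)"
    using vector_derivative_unique_at[OF Py smooth_on_partials(2)[OF D[OF F] pIK]]
      vector_derivative_unique_at[OF Qx smooth_on_partials(1)[OF D[OF F] pIK]]
      smooth_on_mixed_partials[OF IK F pIK] by simp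
  \<comment> \<open>After inserting \<open>Fx\<close> and \<open>Fy\<close>, terms with equal
    indices cancel; those with different indices leave commutators, where \<open>J_i J_j\<close> is
    the remaining \<open>J_k\<close> up to sign and anticommutation gives the factor
    \<open>2\<close>.\<close>
  then have "(p1' - q1' - 2 * (p2 p * q3 p - p3 p * q2 p)) *\<^sub>R J1 ?F
      + (p2' - q2' - 2 * (p1 p * q3 p - p3 p * q1 p)) *\<^sub>R J2 ?F
      + (p3' - q3' - 2 * (p2 p * q1 p - p1 p * q2 p)) *\<^sub>R J3 ?F = 0"
    using pIK unfolding Fx[OF pIK, folded p_def] Fy[OF pIK, folded p_def]
    by (simp add: vec_eq_iff forall_4 J_defs algebra_simps)
  from J_combination_eq_0[OF this nz[OF pIK, folded p_def]]
  show "p1' - q1' = 2 * (p2 p * q3 p - p3 p * q2 p)"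
    and "p2' - q2' = 2 * (p1 p * q3 p - p3 p * q1 p)"
    and "p3' - q3' = 2 * (p2 p * q1 p - p1 p * q2 p)" by simp_all
qed

text \<open>Rotating \<open>(c, s)\<close> back by the angle \<open>y\<close> gives a constant unit
  vector \<open>(u, v)\<close>, whose angle is \<open>\<phi>\<close>.\<close>

lemma rotation_ode:
  fixes c s :: "real \<Rightarrow> real"
  assumes "is_interval K"
    and c': "\<And>y. y \<in> K \<Longrightarrow> (c has_real_derivative - s y) (at y)"
    and s': "\<And>y. y \<in> K \<Longrightarrow> (s has_real_derivative c y) (at y)"
    and unit: "\<And>y. y \<in> K \<Longrightarrow> (c y)\<^sup>2 + (s y)\<^sup>2 = 1"
  obtains \<phi> where "\<And>y. y \<in> K \<Longrightarrow> c y = cos (y + \<phi>) \<and> s y = sin (y + \<phi>)"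
proof (cases "K = {}")
  case False
  then obtain y0 where y0: "y0 \<in> K" by blast
  define u where "u y = c y * cos y + s y * sin y" for y
  define v where "v y = s y * cos y - c y * sin y" for y
  have const: "f y = f y0" if "\<And>y. y \<in> K \<Longrightarrow> (f has_real_derivative 0) (at y)" "y \<in> K" for f y
    using has_derivative_zero_unique[OF is_interval_convex[OF assms(1)] _ that(2) y0, of f] that(1)
    by (metis has_field_derivative_def has_derivative_at_withinI lambda_zero)
  have "(u has_real_derivative 0) (at y)" "(v has_real_derivative 0) (at y)" if "y \<in> K" for y
    unfolding u_def v_def using c'[OF that] s'[OF that]
    by (auto intro!: derivative_eq_intros simp: algebra_simps)
  then have uv: "u y = u y0" "v y = v y0" if "y \<in> K" for y using const that by blast+
  have "(u y0)\<^sup>2 + (v y0)\<^sup>2 = ((c y0)\<^sup>2 + (s y0)\<^sup>2) * ((sin y0)\<^sup>2 + (cos y0)\<^sup>2)"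
    unfolding u_def v_def by algebra
  then obtain \<phi> where \<phi>: "u y0 = cos \<phi>" "v y0 = sin \<phi>"
    using sincos_total_2pi_le unit[OF y0] by (metis mult_1 sin_cos_squared_add)
  have "c y = cos (y + \<phi>) \<and> s y = sin (y + \<phi>)" if "y \<in> K" for y
  proof -
    have "c y * ((sin y)\<^sup>2 + (cos y)\<^sup>2) = u y * cos y - v y * sin y"
      "s y * ((sin y)\<^sup>2 + (cos y)\<^sup>2) = u y * sin y + v y * cos y"
      unfolding u_def v_def by algebra+
    then show ?thesis using uv[OF that] \<phi> by (simp add: cos_add sin_add algebra_simps)
  qed
  then show ?thesis by (rule that)
qed (use that in blast)

section \<open>The frame of a helix surface\<close>

definition null_op :: "real \<Rightarrow> real \<Rightarrow> real \<Rightarrow> real^4 \<Rightarrow> real^4" where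
  "null_op lam c s v = lam *\<^sub>R J1 v - c *\<^sub>R J2 v - s *\<^sub>R J3 v"

text \<open>The derivative of \<open>null_op lam c s\<close> when \<open>(c, s)\<close> turns with
  unit speed, that is \<open>c' = - s\<close> and \<open>s' = c\<close>.\<close>

definition rot_op :: "real \<Rightarrow> real \<Rightarrow> real^4 \<Rightarrow> real^4" where
  "rot_op c s v = s *\<^sub>R J2 v - c *\<^sub>R J3 v"

lemma bounded_linear_null_op: "bounded_linear (null_op lam c s)"
  unfolding null_op_def
  by (intro bounded_linear_sub bounded_linear_scaleR_right[THEN bounded_linear_compose] bounded_linear_J)

text \<open>The \<open>J_i\<close> anticommute and have squares \<open>-1\<close>, \<open>1\<close>,
  \<open>1\<close>, so the mixed terms drop out of the square.\<close>

lemma null_op_null_op: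
  assumes "lam\<^sup>2 = 1" "c\<^sup>2 + s\<^sup>2 = 1"
  shows "null_op lam c s (null_op lam c s v) = 0"
proof -
  have "null_op lam c s (null_op lam c s v) = (c\<^sup>2 + s\<^sup>2 - lam\<^sup>2) *\<^sub>R v"
    by (simp add: null_op_def vec_eq_iff forall_4 J_defs algebra_simps power2_eq_square)
  then show ?thesis using assms by simp
qed

text \<open>These absorption rules are what removes \<open>x\<close> from the ODE of the curve
  \<open>f\<close>.\<close>

lemma null_op_rot_op:
  assumes "lam\<^sup>2 = 1" "c\<^sup>2 + s\<^sup>2 = 1"
  shows "null_op lam c s (rot_op c s v) = - lam *\<^sub>R null_op lam c s v"
    "rot_op c s (null_op lam c s v) = lam *\<^sub>R null_op lam c s v"
proof -
  have 1: "null_op lam c s (rot_op c s v) = - lam *\<^sub>R null_op lam c s v + (lam\<^sup>2 - (c\<^sup>2 + s\<^sup>2)) *\<^sub>R J1 v"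
    by (simp add: null_op_def rot_op_def vec_eq_iff forall_4 J_defs algebra_simps power2_eq_square)
  have 2: "rot_op c s (null_op lam c s v) = lam *\<^sub>R null_op lam c s v - (lam\<^sup>2 - (c\<^sup>2 + s\<^sup>2)) *\<^sub>R J1 v"
    by (simp add: null_op_def rot_op_def vec_eq_iff forall_4 J_defs algebra_simps power2_eq_square)
  from 1 show "null_op lam c s (rot_op c s v) = - lam *\<^sub>R null_op lam c s v" using assms by simp
  from 2 show "rot_op c s (null_op lam c s v) = lam *\<^sub>R null_op lam c s v" using assms by simp
qed

lemma g0_null_op:
  "g0 (null_op lam c s u) (null_op lam c s v) = (lam\<^sup>2 - (c\<^sup>2 + s\<^sup>2)) * g0 u v"
  "g0 u (null_op lam c s u) = 0"
  "g0 (null_op lam c s u) (rot_op c s u) = 0"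
  by (simp_all add: null_op_def rot_op_def g0_def J_defs algebra_simps power2_eq_square)

text \<open>The first column is the third under \<open>sin t J2 - cos t J3\<close>, which is
  \<open>- c J2 - s J3\<close> for the stated \<open>c\<close>, \<open>s\<close>. This is how the
  angle \<open>\<xi>\<close> of the matrix becomes the angle of the normal.\<close>

lemma null_op_A_col3:
  "null_op lam (- sin t) (cos t) (A_col3 t t1 t2 t3) = A_col1 t t1 t2 t3 + lam *\<^sub>R J1 (A_col3 t t1 t2 t3)"
proof -
  have "cos t2 = cos t * cos (t - t2) + sin t * sin (t - t2)"
    "sin t2 = sin t * cos (t - t2) - cos t * sin (t - t2)"
    using cos_diff[of t "t - t2"] sin_diff[of t "t - t2"] by simp_all
  then show ?thesis
    by (simp add: null_op_def A_col1_def A_col3_def vec_eq_iff forall_4 J_defs sin_diff[of t t3]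
        cos_diff[of t t3] algebra_simps) algebra
qed

locale helix_setup =
  fixes \<kappa> \<tau> lam \<nu> :: real
  assumes pos: "\<kappa> > 0" "\<tau> > 0" and lam: "lam\<^sup>2 = 1" and \<nu>: "\<nu> \<noteq> 0"
    and B0: "\<nu>\<^sup>2 * (\<tau>\<^sup>2 - 1) = lam"
begin

definition e where "e = sqrt \<kappa> / 2"

lemma e_pos: "e > 0"
  using pos by (simp add: e_def)

lemma AdS_iff: "q \<in> AdS \<kappa> \<longleftrightarrow> e\<^sup>2 * g0 q q = - 1"
  using pos by (simp add: AdS_def e_def power_divide field_simps)

lemma E_simps: "E \<kappa> \<tau> 1 q = (e / \<tau>) *\<^sub>R J1 q" "E \<kappa> \<tau> 2 q = e *\<^sub>R J2 q" "E \<kappa> \<tau> 3 q = e *\<^sub>R J3 q"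
  by (simp_all add: E_def X1_def X2_def X3_def e_def)

lemma g0_J: "g0 (J1 q) (J1 q) = g0 q q" "g0 (J2 q) (J2 q) = - g0 q q" "g0 (J3 q) (J3 q) = - g0 q q"
  "g0 (J1 q) (J2 q) = 0" "g0 (J2 q) (J1 q) = 0" "g0 (J1 q) (J3 q) = 0" "g0 (J3 q) (J1 q) = 0"
  "g0 (J2 q) (J3 q) = 0" "g0 (J3 q) (J2 q) = 0" "g0 q (J1 q) = 0" "g0 q (J2 q) = 0" "g0 q (J3 q) = 0"
  by (simp_all add: g0_def J_defs)

text \<open>\<open>X1 \<kappa> q\<close> has \<open>g0\<close>-square \<open>-1\<close>, so the
  correction term scales its direction by \<open>\<tau>^2\<close> and leaves the orthogonal
  directions \<open>J2 q\<close>, \<open>J3 q\<close> alone.\<close>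

lemma g_berger_frame:
  assumes "q \<in> AdS \<kappa>"
  shows "g_berger \<kappa> \<tau> q (J1 q) v = \<tau>\<^sup>2 * g0 (J1 q) v"
    "g_berger \<kappa> \<tau> q (J2 q) v = g0 (J2 q) v" "g_berger \<kappa> \<tau> q (J3 q) v = g0 (J3 q) v"
proof -
  have "g_berger \<kappa> \<tau> q (J1 q) v = g0 (J1 q) v * (1 + (1 - \<tau>\<^sup>2) * (e\<^sup>2 * g0 q q))"
    unfolding g_berger_def X1_def e_def[symmetric] g0_simps g0_J
    by (simp add: g0_commute[of v] power2_eq_square algebra_simps)
  then show "g_berger \<kappa> \<tau> q (J1 q) v = \<tau>\<^sup>2 * g0 (J1 q) v"
    using assms by (simp add: AdS_iff)
  show "g_berger \<kappa> \<tau> q (J2 q) v = g0 (J2 q) v" "g_berger \<kappa> \<tau> q (J3 q) v = g0 (J3 q) v"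
    by (simp_all add: g_berger_def X1_def g0_simps g0_J)
qed

lemma g_berger_simps:
  "g_berger \<kappa> \<tau> q (u + v) w = g_berger \<kappa> \<tau> q u w + g_berger \<kappa> \<tau> q v w"
  "g_berger \<kappa> \<tau> q (u - v) w = g_berger \<kappa> \<tau> q u w - g_berger \<kappa> \<tau> q v w"
  "g_berger \<kappa> \<tau> q (a *\<^sub>R u) w = a * g_berger \<kappa> \<tau> q u w"
  "g_berger \<kappa> \<tau> q u w = g_berger \<kappa> \<tau> q w u"
  by (simp_all add: g_berger_def g0_simps algebra_simps g0_commute)

lemma frame_coord_simps:
  assumes "q \<in> AdS \<kappa>"
  shows "frame_coord \<kappa> \<tau> q v 1 = - (e * \<tau> * g0 v (J1 q))"
    "frame_coord \<kappa> \<tau> q v 2 = e * g0 v (J2 q)" "frame_coord \<kappa> \<tau> q v 3 = e * g0 v (J3 q)"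
  using pos unfolding frame_coord_def E_simps g_berger_simps(4)[of q v]
  by (simp_all add: eps_def g_berger_simps(3) g_berger_frame[OF assms] g0_commute[of v] power2_eq_square)

text \<open>The unit normal with frame coordinates \<open>(- \<lambda> \<nu>, \<nu> \<tau> c, \<nu> \<tau> s)\<close>.\<close>

definition normal :: "real \<Rightarrow> real \<Rightarrow> real^4 \<Rightarrow> real^4" where
  "normal c s q = (- (lam * \<nu> * e / \<tau>)) *\<^sub>R J1 q + (\<nu> * \<tau> * e * c) *\<^sub>R J2 q + (\<nu> * \<tau> * e * s) *\<^sub>R J3 q"

text \<open>The factor \<open>\<tau>^2\<close> along \<open>J1 q\<close> turns the coefficients of
  the normal into a multiple of those of \<open>L\<close>; orthogonality to the surface thus becomes
  a condition on \<open>g0\<close> alone.\<close>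

lemma g_berger_normal:
  assumes "q \<in> AdS \<kappa>"
  shows "g_berger \<kappa> \<tau> q (normal c s q) v = - (\<nu> * \<tau> * e) * g0 (null_op lam c s q) v"
  using pos unfolding normal_def null_op_def g_berger_simps(1,3) g_berger_frame[OF assms] g0_simps
  by (simp add: power2_eq_square algebra_simps)

lemma g0_null_op_normal:
  "g0 (null_op lam c s q) (normal c s q) = (\<nu> * \<tau> * e * (c\<^sup>2 + s\<^sup>2) - \<nu> * e / \<tau>) * g0 q q"
proof -
  have "g0 (null_op lam c s q) (normal c s q) = (\<nu> * \<tau> * e * (c\<^sup>2 + s\<^sup>2) - lam\<^sup>2 * (\<nu> * e / \<tau>)) * g0 q q"
    by (simp add: null_op_def normal_def g0_simps g0_J algebra_simps power2_eq_square)
  then show ?thesis by (simp add: lam)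
qed

lemma normal:
  assumes q: "q \<in> AdS \<kappa>" and cs: "c\<^sup>2 + s\<^sup>2 = 1"
  shows "g0 q (normal c s q) = 0" "g_berger \<kappa> \<tau> q (normal c s q) (normal c s q) = lam"
    "lam * g_berger \<kappa> \<tau> q (normal c s q) (E \<kappa> \<tau> 1 q) = \<nu>"
proof -
  have qq: "e\<^sup>2 * g0 q q = - 1" using q by (simp add: AdS_iff)
  show "g0 q (normal c s q) = 0" by (simp add: normal_def g0_simps g0_J)
  have "g_berger \<kappa> \<tau> q (normal c s q) (normal c s q) = - (\<nu> * \<tau> * (\<nu> * \<tau> - \<nu> / \<tau>) * (e\<^sup>2 * g0 q q))"
    unfolding g_berger_normal[OF q] g0_null_op_normal cs by (simp add: algebra_simps power2_eq_square)
  also have "\<dots> = \<nu>\<^sup>2 * (\<tau>\<^sup>2 - 1)"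
    using pos unfolding qq by (simp add: field_simps power2_eq_square)
  finally show "g_berger \<kappa> \<tau> q (normal c s q) (normal c s q) = lam" by (simp add: B0)
  have "lam * g_berger \<kappa> \<tau> q (normal c s q) (E \<kappa> \<tau> 1 q) = - (lam\<^sup>2 * \<nu> * (e\<^sup>2 * g0 q q))"
    using pos unfolding g_berger_normal[OF q] E_simps
    by (simp add: null_op_def g0_simps g0_J power2_eq_square)
  then show "lam * g_berger \<kappa> \<tau> q (normal c s q) (E \<kappa> \<tau> 1 q) = \<nu>" by (simp add: qq lam)
qed

text \<open>\<open>q\<close>, \<open>J1 q\<close>, \<open>J2 q\<close>, \<open>J3 q\<close> form a
  \<open>g0\<close>-orthogonal basis, and \<open>e^2\<close> is the normalisation
  \<open>- 1 / g0 q q\<close>.\<close>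

lemma J_expansion:
  assumes "q \<in> AdS \<kappa>" "g0 q v = 0"
  shows "v = (- (e\<^sup>2 * g0 v (J1 q))) *\<^sub>R J1 q + (e\<^sup>2 * g0 v (J2 q)) *\<^sub>R J2 q + (e\<^sup>2 * g0 v (J3 q)) *\<^sub>R J3 q"
proof -
  have "g0 q q *\<^sub>R v = g0 q v *\<^sub>R q + g0 v (J1 q) *\<^sub>R J1 q - g0 v (J2 q) *\<^sub>R J2 q - g0 v (J3 q) *\<^sub>R J3 q"
    by (simp add: vec_eq_iff forall_4 g0_def J_defs algebra_simps)
  then have "(- (e\<^sup>2)) *\<^sub>R (g0 q q *\<^sub>R v) = (- (e\<^sup>2)) *\<^sub>R (g0 v (J1 q) *\<^sub>R J1 q - g0 v (J2 q) *\<^sub>R J2 q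
      - g0 v (J3 q) *\<^sub>R J3 q)"
    using assms(2) by simp
  moreover have "(- (e\<^sup>2)) *\<^sub>R (g0 q q *\<^sub>R v) = v"
    using assms(1) by (simp add: AdS_iff)
  ultimately show ?thesis by (simp add: scaleR_diff_right)
qed

text \<open>The angle function fixes the \<open>E_1\<close> coordinate as
  \<open>- lam \<nu>\<close>. Unit length then reads
  \<open>\<nu>^2 (\<tau>^2 (c^2 + s^2) - 1) = lam\<close>, and \<open>B = 0\<close> leaves
  \<open>c^2 + s^2 = 1\<close>.\<close>

lemma normal_unique:
  assumes q: "q \<in> AdS \<kappa>" and v: "g0 q v = 0" "g_berger \<kappa> \<tau> q v v = lam"
    "lam * g_berger \<kappa> \<tau> q v (E \<kappa> \<tau> 1 q) = \<nu>"
  defines "c \<equiv> e * g0 v (J2 q) / (\<nu> * \<tau>)" and "s \<equiv> e * g0 v (J3 q) / (\<nu> * \<tau>)"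
  shows "v = normal c s q" "c\<^sup>2 + s\<^sup>2 = 1"
proof -
  have qq: "e\<^sup>2 * g0 q q = - 1" using q by (simp add: AdS_iff)
  have "g_berger \<kappa> \<tau> q v (E \<kappa> \<tau> 1 q) = e * \<tau> * g0 v (J1 q)"
    using pos unfolding g_berger_simps(4)[of q v] E_simps
    by (simp add: g_berger_simps(3) g_berger_frame[OF q] g0_commute power2_eq_square)
  then have "lam\<^sup>2 * (e * \<tau> * g0 v (J1 q)) = lam * \<nu>"
    using v(3) by (simp add: power2_eq_square)
  then have 1: "e * g0 v (J1 q) = lam * \<nu> / \<tau>"
    using pos by (simp add: lam field_simps)
  have 2: "e * g0 v (J2 q) = \<nu> * \<tau> * c" "e * g0 v (J3 q) = \<nu> * \<tau> * s"
    using \<nu> pos by (simp_all add: c_def s_def)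
  have "v = (- (e * (e * g0 v (J1 q)))) *\<^sub>R J1 q + (e * (e * g0 v (J2 q))) *\<^sub>R J2 q
      + (e * (e * g0 v (J3 q))) *\<^sub>R J3 q"
    using J_expansion[OF q v(1)] by (simp only: power2_eq_square mult.assoc)
  also have "\<dots> = normal c s q"
    unfolding 1 2 normal_def by (simp add: mult_ac)
  finally show v': "v = normal c s q" .
  have "g_berger \<kappa> \<tau> q v v = - (\<nu> * \<tau> * (\<nu> * \<tau> * (c\<^sup>2 + s\<^sup>2) - \<nu> / \<tau>) * (e\<^sup>2 * g0 q q))"
    unfolding v' g_berger_normal[OF q] g0_null_op_normal by (simp add: algebra_simps power2_eq_square)
  also have "\<dots> = \<nu>\<^sup>2 * (\<tau>\<^sup>2 * (c\<^sup>2 + s\<^sup>2) - 1)"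
    using pos unfolding qq by (simp add: field_simps power2_eq_square)
  finally have "\<nu>\<^sup>2 * (\<tau>\<^sup>2 * (c\<^sup>2 + s\<^sup>2) - 1) = \<nu>\<^sup>2 * (\<tau>\<^sup>2 - 1)"
    unfolding v(2) B0 by simp
  then show "c\<^sup>2 + s\<^sup>2 = 1" using \<nu> pos by simp
qed

lemma tangent_frame:
  assumes q: "q \<in> AdS \<kappa>"
  shows "E \<kappa> \<tau> 1 q - \<nu> *\<^sub>R normal c s q = (\<nu>\<^sup>2 * \<tau> * e) *\<^sub>R null_op lam c s q"
    "wedge \<kappa> \<tau> q (normal c s q) ((\<nu>\<^sup>2 * \<tau> * e) *\<^sub>R null_op lam c s q) = (\<nu> * \<tau> * e) *\<^sub>R rot_op c s q"
proof -
  have qq: "e * (e * g0 q q) = - 1" using q by (simp add: AdS_iff power2_eq_square mult.assoc)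
  \<comment> \<open>This is \<open>B = 0\<close> multiplied by \<open>lam\<close>; it balances the
    \<open>J1\<close> components of \<open>E_1 - \<nu> N\<close>.\<close>
  have l1: "lam * (\<nu>\<^sup>2 * (\<tau>\<^sup>2 - 1)) = 1" using lam unfolding B0 by (simp add: power2_eq_square)
  then have "e / \<tau> + \<nu> * (lam * \<nu> * e / \<tau>) = lam * (\<nu>\<^sup>2 * \<tau> * e)"
    using pos by (simp add: field_simps power2_eq_square) algebra
  then have "(e / \<tau> + \<nu> * (lam * \<nu> * e / \<tau>)) *\<^sub>R J1 q = (lam * (\<nu>\<^sup>2 * \<tau> * e)) *\<^sub>R J1 q"
    by (rule arg_cong)
  then show "E \<kappa> \<tau> 1 q - \<nu> *\<^sub>R normal c s q = (\<nu>\<^sup>2 * \<tau> * e) *\<^sub>R null_op lam c s q"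
    by (simp add: E_simps normal_def null_op_def scaleR_add_left algebra_simps power2_eq_square)
  have N: "frame_coord \<kappa> \<tau> q (normal c s q) 1 = - (lam * \<nu>)"
    "frame_coord \<kappa> \<tau> q (normal c s q) 2 = \<nu> * \<tau> * c"
    "frame_coord \<kappa> \<tau> q (normal c s q) 3 = \<nu> * \<tau> * s"
    using qq pos by (simp_all add: frame_coord_simps[OF q] normal_def g0_simps g0_J) algebra+
  have T: "frame_coord \<kappa> \<tau> q ((\<nu>\<^sup>2 * \<tau> * e) *\<^sub>R null_op lam c s q) 1 = lam * \<nu>\<^sup>2 * \<tau>\<^sup>2"
    "frame_coord \<kappa> \<tau> q ((\<nu>\<^sup>2 * \<tau> * e) *\<^sub>R null_op lam c s q) 2 = - (\<nu>\<^sup>2 * \<tau> * c)"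
    "frame_coord \<kappa> \<tau> q ((\<nu>\<^sup>2 * \<tau> * e) *\<^sub>R null_op lam c s q) 3 = - (\<nu>\<^sup>2 * \<tau> * s)"
    using qq pos by (simp_all add: frame_coord_simps[OF q] null_op_def g0_simps g0_J power2_eq_square) algebra+
  have w: "(- (lam * \<nu>)) * (- (\<nu>\<^sup>2 * \<tau> * z)) - \<nu> * \<tau> * z * (lam * \<nu>\<^sup>2 * \<tau>\<^sup>2) = - (\<nu> * \<tau> * z)" for z
    using l1 by algebra
  \<comment> \<open>\<open>N\<close> and \<open>T\<close> have proportional \<open>E_2\<close>,
    \<open>E_3\<close> parts, so \<open>JT\<close> has no component along
    \<open>E_1\<close>.\<close>
  have "wedge \<kappa> \<tau> q (normal c s q) ((\<nu>\<^sup>2 * \<tau> * e) *\<^sub>R null_op lam c s q)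
      = (- (lam * \<nu>) * - (\<nu>\<^sup>2 * \<tau> * c) - \<nu> * \<tau> * c * (lam * \<nu>\<^sup>2 * \<tau>\<^sup>2)) *\<^sub>R E \<kappa> \<tau> 3 q
        - (- (lam * \<nu>) * - (\<nu>\<^sup>2 * \<tau> * s) - \<nu> * \<tau> * s * (lam * \<nu>\<^sup>2 * \<tau>\<^sup>2)) *\<^sub>R E \<kappa> \<tau> 2 q"
    unfolding wedge_def Let_def N T by (simp add: algebra_simps)
  then show "wedge \<kappa> \<tau> q (normal c s q) ((\<nu>\<^sup>2 * \<tau> * e) *\<^sub>R null_op lam c s q) = (\<nu> * \<tau> * e) *\<^sub>R rot_op c s q"
    unfolding w E_simps rot_op_def by (simp add: algebra_simps)
qed

end

section \<open>Converse: matrix families give helix surfaces\<close>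

lemma bounded_linear_matrix_vector_mult: "bounded_linear (\<lambda>M::real^'n^'m. M *v v)"
  unfolding linear_conv_bounded_linear[symmetric]
  by (intro linearI) (simp_all add: matrix_vector_mult_add_rdistrib scaleR_matrix_vector_assoc)

lemma smooth_on_snd:
  fixes f :: "real \<Rightarrow> 'b::real_normed_vector"
  assumes "open I" "open K" "smooth_on K f"
  shows "smooth_on (I \<times> K) (\<lambda>p. f (snd p))"
  using smooth_on_affine[OF open_Times[OF assms(1,2)] assms(2) bounded_linear_snd, of 0 f] assms(3)
  by auto

lemma A_mat_columns:
  "A_mat t t1 t2 t3 *v axis 1 1 = A_col1 t t1 t2 t3"
  "A_mat t t1 t2 t3 *v axis 3 1 = A_col3 t t1 t2 t3"
  by (simp_all add: A_mat_mult axis_def)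

context helix_setup
begin

lemma two_div_sqrt: "2 / sqrt \<kappa> = 1 / e"
  by (simp add: e_def)

lemma gamma_line_AdS: "gamma_line \<kappa> \<tau> lam \<nu> x \<in> AdS \<kappa>"
proof -
  have "g0 (gamma_line \<kappa> \<tau> lam \<nu> x) (gamma_line \<kappa> \<tau> lam \<nu> x) = (1 - lam\<^sup>2) * (\<nu>\<^sup>2 * \<tau> * x)\<^sup>2 - (1 / e)\<^sup>2"
    unfolding gamma_line_def two_div_sqrt by (simp add: g0_def power2_eq_square algebra_simps)
  then show ?thesis using e_pos by (simp add: AdS_iff lam power_divide)
qed

lemma A_mat_gamma_line_null_op:
  "A_mat t t1 t2 t3 *v gamma_line \<kappa> \<tau> lam \<nu> x =
    (1 / e) *\<^sub>R A_col3 t t1 t2 t3 + (\<nu>\<^sup>2 * \<tau> * x) *\<^sub>R null_op lam (- sin t) (cos t) (A_col3 t t1 t2 t3)"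
  by (simp add: A_mat_gamma_line null_op_A_col3 two_div_sqrt)

text \<open>With \<open>b\<close> the third column and \<open>l = L b\<close>, the partial
  derivatives of \<open>F\<close> are combinations of \<open>l\<close>, \<open>b'\<close> and
  \<open>l'\<close>. All three are \<open>g0\<close>-orthogonal to \<open>l\<close>: it is null,
  hence \<open>g0 l l' = 0\<close>, and \<open>g0 l b' = 0\<close> is the angle relation. As
  \<open>L^2 = 0\<close>, \<open>L F\<close> is a multiple of \<open>l\<close>, so the unit field
  with angle \<open>\<xi>\<close> is normal to the surface.\<close>

lemma matrix_family_helix:
  assumes IK: "open I" "open K" and A: "A_family lam K D \<xi> \<xi>1 \<xi>2 \<xi>3"
    and F: "\<And>x y. x \<in> I \<Longrightarrow> y \<in> K \<Longrightarrow>
      F (x, y) = A_mat (\<xi> y) (\<xi>1 y) (\<xi>2 y) (\<xi>3 y) *v gamma_line \<kappa> \<tau> lam \<nu> x"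
    and inj: "\<And>p. p \<in> I \<times> K \<Longrightarrow> inj (frechet_derivative F (at p))"
  shows "\<exists>N. helix_surface \<kappa> \<tau> lam \<nu> (I \<times> K) F N"
proof -
  define M where "M y = A_mat (\<xi> y) (\<xi>1 y) (\<xi>2 y) (\<xi>3 y)" for y
  define b where "b y = M y *v axis 3 1" for y
  \<comment> \<open>\<open>[1, 0, 0, lam]\<close> is the direction of the line up to
    \<open>\<nu>^2 \<tau>\<close>; as a matrix image, \<open>l\<close> is smooth on all of
    \<open>K\<close>, also outside \<open>D\<close>.\<close>
  define l where "l y = M y *v vector [1, 0, 0, lam]" for y
  have b_eq: "b y = A_col3 (\<xi> y) (\<xi>1 y) (\<xi>2 y) (\<xi>3 y)" for y
    by (simp add: b_def M_def A_mat_columns)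
  have l_eq: "l y = A_col1 (\<xi> y) (\<xi>1 y) (\<xi>2 y) (\<xi>3 y) + lam *\<^sub>R J1 (A_col3 (\<xi> y) (\<xi>1 y) (\<xi>2 y) (\<xi>3 y))" for y
    by (simp add: l_def M_def A_mat_mult)
  have l_null: "l y = null_op lam (- sin (\<xi> y)) (cos (\<xi> y)) (b y)" for y
    by (simp add: l_eq b_eq null_op_A_col3)
  have D: "open D" "D \<subseteq> K" "K \<subseteq> closure D" and M: "smooth_on K M"
    and \<xi>: "smooth_on K \<xi>" "smooth_on K \<xi>2" "smooth_on D \<xi>1" "smooth_on D \<xi>3"
    and rel: "\<And>y. y \<in> D \<Longrightarrow> A_relation lam \<xi> \<xi>1 \<xi>2 \<xi>3 y"
    using A by (auto simp: A_family_def M_def[abs_def])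
  have b: "smooth_on K b" and l: "smooth_on K l"
    unfolding b_def l_def using IK(2) M
    by (auto intro: smooth_on_bounded_linear[OF _ bounded_linear_matrix_vector_mult])
  define b' l' where "b' y = frechet_derivative b (at y) 1" and "l' y = frechet_derivative l (at y) 1" for y
  have b': "(b has_vector_derivative b' y) (at y)" and l': "(l has_vector_derivative l' y) (at y)"
    if "y \<in> K" for y
    using that b l by (auto simp: b'_def l'_def intro: smooth_on_has_vector_derivative)
  have ll: "g0 (l y) (l y) = 0" for y
    by (simp add: l_null g0_null_op(1) lam)
  have ll': "g0 (l y) (l' y) = 0" if y: "y \<in> K" for y
  proof -
    have "((\<lambda>y. g0 (l y) (l y)) has_vector_derivative g0 (l y) (l' y) + g0 (l' y) (l y)) (at y)"
      by (rule bounded_bilinear.has_vector_derivative[OF bounded_bilinear_g0 l'[OF y] l'[OF y]])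
    then have "g0 (l y) (l' y) + g0 (l' y) (l y) = 0"
      unfolding ll by (rule vector_derivative_unique_at) simp
    then show ?thesis using g0_commute[of "l y" "l' y"] by simp
  qed
  have lb'_D: "g0 (l y) (b' y) = 0" if y: "y \<in> D" for y
  proof -
    have d: "(f has_real_derivative frechet_derivative f (at y) 1) (at y)" if "smooth_on D f" for f :: "real \<Rightarrow> real"
      using smooth_on_has_vector_derivative[OF that y]
      by (simp add: has_real_derivative_iff_has_vector_derivative)
    have "((\<lambda>y. A_col3 (\<xi> y) (\<xi>1 y) (\<xi>2 y) (\<xi>3 y)) has_vector_derivative b' y) (at y)"
      using b'[of y] y D(2) unfolding b_eq[symmetric] by blast
    from A_relation_iff[OF d d d d this, of lam] rel[OF y]
    show ?thesis
      using \<xi> D(2) by (simp add: l_eq smooth_on_subset)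
  qed
  \<comment> \<open>The relation is given on \<open>D\<close> only; continuity and density carry it
    to \<open>K\<close>.\<close>
  have lb': "g0 (l y) (b' y) = 0" if y: "y \<in> K" for y
  proof (rule ccontr)
    assume nz: "g0 (l y) (b' y) \<noteq> 0"
    have "smooth_on K (\<lambda>y. g0 (l y) (b' y))"
      unfolding b'_def by (intro smooth_on_bilinear[OF IK(2) bounded_bilinear_g0] l smooth_on_frechet_derivative b)
    then have "open (K \<inter> (\<lambda>y. g0 (l y) (b' y)) -` (- {0}))"
      using IK(2) by (intro continuous_open_preimage smooth_on_imp_continuous_on) auto
    moreover have "y \<in> (K \<inter> (\<lambda>y. g0 (l y) (b' y)) -` (- {0})) \<inter> closure D"
      using y nz D(3) by auto
    ultimately have "(K \<inter> (\<lambda>y. g0 (l y) (b' y)) -` (- {0})) \<inter> D \<noteq> {}"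
      using open_Int_closure_eq_empty by blast
    then show False using lb'_D by auto
  qed
  have F_eq: "F p = (1 / e) *\<^sub>R b (snd p) + (\<nu>\<^sup>2 * \<tau> * fst p) *\<^sub>R l (snd p)" if "p \<in> I \<times> K" for p
    using that F[of "fst p" "snd p"] A_mat_gamma_line_null_op by (auto simp: l_null b_eq)
  note oIK = open_Times[OF IK]
  have "smooth_on (I \<times> K) (\<lambda>p. (1 / e) *\<^sub>R b (snd p) + (\<nu>\<^sup>2 * \<tau> * fst p) *\<^sub>R l (snd p))"
    using oIK IK b l by (intro smooth_on_intros smooth_on_snd smooth_on_linear[OF _ bounded_linear_fst])
  then have smF: "smooth_on (I \<times> K) F"
    by (subst smooth_on_cong[OF oIK F_eq])
  \<comment> \<open>Built from \<open>\<xi>\<close> and \<open>F\<close> only, hence smooth also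
    where \<open>\<xi>1\<close> and \<open>\<xi>3\<close> need not be.\<close>
  define N where "N p = normal (- sin (\<xi> (snd p))) (cos (\<xi> (snd p))) (F p)" for p
  have smN: "smooth_on (I \<times> K) N"
    unfolding N_def[abs_def] normal_def using oIK smF smooth_on_snd[OF IK \<xi>(1)]
    by (intro smooth_on_intros smooth_on_bounded_linear[OF _ bounded_linear_J(1)]
      smooth_on_bounded_linear[OF _ bounded_linear_J(2)] smooth_on_bounded_linear[OF _ bounded_linear_J(3)])
  have FAdS: "F p \<in> AdS \<kappa>" if "p \<in> I \<times> K" for p
  proof -
    have "g0 (F p) (F p) = g0 (gamma_line \<kappa> \<tau> lam \<nu> (fst p)) (gamma_line \<kappa> \<tau> lam \<nu> (fst p))"
      using that F[of "fst p" "snd p"] A_mat_pseudo_orthogonal by (auto simp: pseudo_orthogonal_def)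
    then show ?thesis using gamma_line_AdS by (simp add: AdS_iff)
  qed
  have tangent: "g0 (l y) (frechet_derivative F (at p) u) = 0" if p: "p \<in> I \<times> K" "p = (x, y)" for p u x y
  proof -
    have xy: "x \<in> I" "y \<in> K" using p by auto
    have "((\<lambda>x. (1 / e) *\<^sub>R b y + (\<nu>\<^sup>2 * \<tau> * x) *\<^sub>R l y) has_vector_derivative (\<nu>\<^sup>2 * \<tau>) *\<^sub>R l y) (at x)"
      by (auto intro!: derivative_eq_intros simp: has_real_derivative_iff_has_vector_derivative[symmetric])
    then have "((\<lambda>x. F (x, y)) has_vector_derivative (\<nu>\<^sup>2 * \<tau>) *\<^sub>R l y) (at x)"
      by (rule has_vector_derivative_transform_within_open[OF _ IK(1) xy(1)]) (simp add: F_eq xy)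
    then have x: "frechet_derivative F (at p) (1, 0) = (\<nu>\<^sup>2 * \<tau>) *\<^sub>R l y"
      using smooth_on_partials(1)[OF smF, of x y] p by (auto intro: vector_derivative_unique_at)
    have "((\<lambda>y. (1 / e) *\<^sub>R b y + (\<nu>\<^sup>2 * \<tau> * x) *\<^sub>R l y) has_vector_derivative
        (1 / e) *\<^sub>R b' y + (\<nu>\<^sup>2 * \<tau> * x) *\<^sub>R l' y) (at y)"
      using b'[OF xy(2)] l'[OF xy(2)] by (auto intro!: derivative_eq_intros)
    then have "((\<lambda>y. F (x, y)) has_vector_derivative (1 / e) *\<^sub>R b' y + (\<nu>\<^sup>2 * \<tau> * x) *\<^sub>R l' y) (at y)"
      by (rule has_vector_derivative_transform_within_open[OF _ IK(2) xy(2)]) (simp add: F_eq xy)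
    then have y: "frechet_derivative F (at p) (0, 1) = (1 / e) *\<^sub>R b' y + (\<nu>\<^sup>2 * \<tau> * x) *\<^sub>R l' y"
      using smooth_on_partials(2)[OF smF, of x y] p by (auto intro: vector_derivative_unique_at)
    show ?thesis
      unfolding frechet_derivative_partials[OF smF p(1), of u] x y
      by (simp add: g0_simps ll ll' lb' xy)
  qed
  have null_F: "null_op lam (- sin (\<xi> (snd p))) (cos (\<xi> (snd p))) (F p) = (1 / e) *\<^sub>R l (snd p)"
    if "p \<in> I \<times> K" for p
  proof -
    have *: "null_op lam (- sin t) (cos t) (a *\<^sub>R v + a' *\<^sub>R null_op lam (- sin t) (cos t) v)
        = a *\<^sub>R null_op lam (- sin t) (cos t) v" for a a' t v
    proof -
      have "null_op lam (- sin t) (cos t) (null_op lam (- sin t) (cos t) v) = 0"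
        by (rule null_op_null_op) (simp_all add: lam)
      then show ?thesis
        using bounded_linear_null_op[of lam "- sin t" "cos t"]
        by (simp add: bounded_linear.linear linear_add linear_scale)
    qed
    show ?thesis unfolding F_eq[OF that] l_null by (rule *)
  qed
  have "oriented_surface \<kappa> \<tau> lam (I \<times> K) F N"
    unfolding oriented_surface_def
  proof (intro conjI ballI allI)
    fix p u assume p: "p \<in> I \<times> K"
    obtain x y where xy: "p = (x, y)" by (cases p)
    show "N p \<in> AdS_tangent (F p)" "g_berger \<kappa> \<tau> (F p) (N p) (N p) = lam"
      using normal(1,2)[OF FAdS[OF p]] by (simp_all add: N_def AdS_tangent_def)
    show "g_berger \<kappa> \<tau> (F p) (N p) (frechet_derivative F (at p) u) = 0"
      unfolding N_def g_berger_normal[OF FAdS[OF p]] null_F[OF p]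
      using tangent[OF p xy, of u] by (simp add: g0_simps xy)
  qed (use oIK smF smN FAdS inj in auto)
  moreover have "angle_fun \<kappa> \<tau> lam F N p = \<nu>" if "p \<in> I \<times> K" for p
    using normal(3)[OF FAdS[OF that]] by (simp add: N_def angle_fun_def)
  ultimately show ?thesis unfolding helix_surface_def by blast
qed


section \<open>Direct part: from adapted coordinates to the matrix family\<close>

definition m where "m = \<nu> * \<tau> * e"

text \<open>In terms of \<open>m\<close> the tangent frame is \<open>T = \<nu> m L F\<close> and
  \<open>JT = m L' F\<close>.\<close>

lemma m: "m \<noteq> 0" "\<nu>\<^sup>2 * \<tau> * e = \<nu> * m"
  using \<nu> pos e_pos by (simp_all add: m_def power2_eq_square)

lemma helix_frame:
  assumes IK: "open I" "open K" and H: "helix_surface \<kappa> \<tau> lam \<nu> (I \<times> K) F N"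
    and HC: "helix_coordinates \<kappa> \<tau> lam \<nu> I K F N \<mu> \<eta>"
  obtains c s where "smooth_on (I \<times> K) c" "smooth_on (I \<times> K) s"
    "\<And>p. p \<in> I \<times> K \<Longrightarrow> (c p)\<^sup>2 + (s p)\<^sup>2 = 1"
    "\<And>p. p \<in> I \<times> K \<Longrightarrow> frechet_derivative F (at p) (1, 0) = (\<nu> * m) *\<^sub>R null_op lam (c p) (s p) (F p)"
    "\<And>p. p \<in> I \<times> K \<Longrightarrow> frechet_derivative F (at p) (0, 1) =
      (- (\<nu> * m\<^sup>2 * lam * fst p * (\<nu> * fst p + 2 * \<eta> (snd p)))) *\<^sub>R null_op lam (c p) (s p) (F p)
      + ((\<nu> * fst p + \<eta> (snd p)) * m) *\<^sub>R rot_op (c p) (s p) (F p)"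
    "\<And>x y. x \<in> I \<Longrightarrow> y \<in> K \<Longrightarrow> \<nu> * x + \<eta> y \<noteq> 0"
proof -
  define c where "c p = e * g0 (N p) (J2 (F p)) / (\<nu> * \<tau>)" for p
  define s where "s p = e * g0 (N p) (J3 (F p)) / (\<nu> * \<tau>)" for p
  note oIK = open_Times[OF IK]
  have sm: "smooth_on (I \<times> K) F" "smooth_on (I \<times> K) N"
    and AdS: "\<And>p. p \<in> I \<times> K \<Longrightarrow> F p \<in> AdS \<kappa>"
    and inj: "\<And>p. p \<in> I \<times> K \<Longrightarrow> inj (frechet_derivative F (at p))"
    and N: "\<And>p. p \<in> I \<times> K \<Longrightarrow> g0 (F p) (N p) = 0"
      "\<And>p. p \<in> I \<times> K \<Longrightarrow> g_berger \<kappa> \<tau> (F p) (N p) (N p) = lam"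
    and angle: "\<And>p. p \<in> I \<times> K \<Longrightarrow> angle_fun \<kappa> \<tau> lam F N p = \<nu>"
    using H by (auto simp: helix_surface_def oriented_surface_def AdS_tangent_def)
  have angle': "lam * g_berger \<kappa> \<tau> (F p) (N p) (E \<kappa> \<tau> 1 (F p)) = \<nu>" if "p \<in> I \<times> K" for p
    using angle[OF that] by (simp add: angle_fun_def)
  have unit: "(c p)\<^sup>2 + (s p)\<^sup>2 = 1" and Nn: "N p = normal (c p) (s p) (F p)" if "p \<in> I \<times> K" for p
    using normal_unique[OF AdS N angle'] that by (simp_all add: c_def s_def)
  have T: "T_field \<kappa> \<tau> lam F N p = (\<nu> * m) *\<^sub>R null_op lam (c p) (s p) (F p)" if p: "p \<in> I \<times> K" for p
    unfolding T_field_def angle[OF p] Nn[OF p] tangent_frame(1)[OF AdS[OF p]] m(2) ..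
  have JT: "JT_field \<kappa> \<tau> lam F N p = m *\<^sub>R rot_op (c p) (s p) (F p)" if p: "p \<in> I \<times> K" for p
    unfolding JT_field_def T[OF p] unfolding Nn[OF p] m(2)[symmetric] tangent_frame(2)[OF AdS[OF p]]
    by (simp add: m_def)
  have Fx: "frechet_derivative F (at (x, y)) (1, 0) = T_field \<kappa> \<tau> lam F N (x, y)"
    and Fy: "frechet_derivative F (at (x, y)) (0, 1) =
        (- (sqrt \<kappa> / 2) * lam * \<nu> * \<tau> * x * (\<nu> * x + 2 * \<eta> y)) *\<^sub>R T_field \<kappa> \<tau> lam F N (x, y)
        + (\<nu> * x + \<eta> y) *\<^sub>R JT_field \<kappa> \<tau> lam F N (x, y)" if "x \<in> I" "y \<in> K" for x y
    using HC that by (auto simp: helix_coordinates_def Let_def)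
  show ?thesis
  proof (rule that[of c s])
    show "smooth_on (I \<times> K) c" "smooth_on (I \<times> K) s"
      unfolding c_def s_def using oIK \<nu> pos sm
      by (auto intro!: smooth_on_divide smooth_on_const smooth_on_mult
          smooth_on_bilinear[OF _ bounded_bilinear_g0] smooth_on_bounded_linear[OF _ bounded_linear_J(2)]
          smooth_on_bounded_linear[OF _ bounded_linear_J(3)])
  next
    fix p assume p: "p \<in> I \<times> K"
    show "(c p)\<^sup>2 + (s p)\<^sup>2 = 1" by (rule unit[OF p])
    show "frechet_derivative F (at p) (1, 0) = (\<nu> * m) *\<^sub>R null_op lam (c p) (s p) (F p)"
      using Fx[of "fst p" "snd p"] p T by auto
    show "frechet_derivative F (at p) (0, 1) =
      (- (\<nu> * m\<^sup>2 * lam * fst p * (\<nu> * fst p + 2 * \<eta> (snd p)))) *\<^sub>R null_op lam (c p) (s p) (F p)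
      + ((\<nu> * fst p + \<eta> (snd p)) * m) *\<^sub>R rot_op (c p) (s p) (F p)"
      using Fy[of "fst p" "snd p"] p T JT
      by (auto simp: m_def e_def[symmetric] power2_eq_square mult_ac)
  next
    fix x y assume xy: "x \<in> I" "y \<in> K"
    show "\<nu> * x + \<eta> y \<noteq> 0"
    proof
      \<comment> \<open>A zero of the coefficient of \<open>JT\<close> would make the partial
        derivatives of the immersion \<open>F\<close> linearly dependent.\<close>
      assume "\<nu> * x + \<eta> y = 0"
      then have "frechet_derivative F (at (x, y)) (0, 1) = (- (sqrt \<kappa> / 2) * lam * \<nu> * \<tau> * x * (\<nu> * x + 2 * \<eta> y))
          *\<^sub>R frechet_derivative F (at (x, y)) (1, 0)" (is "_ = ?a *\<^sub>R _")
        using Fx[OF xy] Fy[OF xy] by simp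
      also have "\<dots> = frechet_derivative F (at (x, y)) (?a *\<^sub>R (1, 0))"
        using smooth_on_has_derivative[OF sm(1)] xy
        by (intro linear_scale[symmetric] has_derivative_linear) auto
      finally have "(0, 1) = ?a *\<^sub>R (1 :: real, 0 :: real)"
        by (rule injD[OF inj, rotated]) (use xy in simp)
      then show False by simp
    qed
  qed
qed

text \<open>The \<open>J2\<close> and \<open>J3\<close> parts of the structure equations are two
  linear equations for the four partial derivatives of \<open>c\<close> and \<open>s\<close>;
  differentiating \<open>c^2 + s^2 = 1\<close> supplies the other two.\<close>

lemma helix_angle:
  assumes IK: "open I" "is_interval I" "open K" "is_interval K" and F: "smooth_on (I \<times> K) F"
    and AdS: "\<And>p. p \<in> I \<times> K \<Longrightarrow> F p \<in> AdS \<kappa>"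
    and cs: "smooth_on (I \<times> K) c" "smooth_on (I \<times> K) s"
    and unit: "\<And>p. p \<in> I \<times> K \<Longrightarrow> (c p)\<^sup>2 + (s p)\<^sup>2 = 1"
    and Fx: "\<And>p. p \<in> I \<times> K \<Longrightarrow> frechet_derivative F (at p) (1, 0) = (\<nu> * m) *\<^sub>R null_op lam (c p) (s p) (F p)"
    and Fy: "\<And>p. p \<in> I \<times> K \<Longrightarrow> frechet_derivative F (at p) (0, 1) =
      (- (\<nu> * m\<^sup>2 * lam * fst p * (\<nu> * fst p + 2 * \<eta> (snd p)))) *\<^sub>R null_op lam (c p) (s p) (F p)
      + ((\<nu> * fst p + \<eta> (snd p)) * m) *\<^sub>R rot_op (c p) (s p) (F p)"
    and b: "\<And>x y. x \<in> I \<Longrightarrow> y \<in> K \<Longrightarrow> \<nu> * x + \<eta> y \<noteq> 0"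
    and xy: "x \<in> I" "y \<in> K"
  shows "((\<lambda>x. c (x, y)) has_real_derivative 0) (at x)" "((\<lambda>x. s (x, y)) has_real_derivative 0) (at x)"
    "((\<lambda>y. c (x, y)) has_real_derivative - s (x, y)) (at y)"
    "((\<lambda>y. s (x, y)) has_real_derivative c (x, y)) (at y)"
proof -
  define cx cy sx sy where "cx = frechet_derivative c (at (x, y)) (1, 0)"
    and "cy = frechet_derivative c (at (x, y)) (0, 1)"
    and "sx = frechet_derivative s (at (x, y)) (1, 0)" and "sy = frechet_derivative s (at (x, y)) (0, 1)"
  have p: "(x, y) \<in> I \<times> K" using xy by simp
  have d: "((\<lambda>x. c (x, y)) has_real_derivative cx) (at x)" "((\<lambda>y. c (x, y)) has_real_derivative cy) (at y)"
    "((\<lambda>x. s (x, y)) has_real_derivative sx) (at x)" "((\<lambda>y. s (x, y)) has_real_derivative sy) (at y)"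
    using smooth_on_partials[OF cs(1) p] smooth_on_partials[OF cs(2) p]
    by (simp_all add: has_real_derivative_iff_has_vector_derivative cx_def cy_def sx_def sy_def)
  define a where "a p = - (\<nu> * m\<^sup>2 * lam * fst p * (\<nu> * fst p + 2 * \<eta> (snd p)))" for p
  define b where "b p = (\<nu> * fst p + \<eta> (snd p)) * m" for p
  let ?a' = "- (\<nu> * m\<^sup>2 * lam * 2 * (\<nu> * x + \<eta> y))"
  have a': "((\<lambda>x. a (x, y)) has_real_derivative ?a') (at x)"
    and b': "((\<lambda>x. b (x, y)) has_real_derivative \<nu> * m) (at x)"
    unfolding a_def b_def by (auto intro!: derivative_eq_intros simp: algebra_simps)
  have nz: "g0 (F p) (F p) \<noteq> 0" if "p \<in> I \<times> K" for p using AdS[OF that] by (auto simp: AdS_iff)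
  have Fx': "frechet_derivative F (at p) (1, 0) =
      (\<nu> * m * lam) *\<^sub>R J1 (F p) + (- (\<nu> * m * c p)) *\<^sub>R J2 (F p) + (- (\<nu> * m * s p)) *\<^sub>R J3 (F p)"
    if "p \<in> I \<times> K" for p
    unfolding Fx[OF that] by (simp add: null_op_def scaleR_diff_right)
  have Fy': "frechet_derivative F (at p) (0, 1) =
      (a p * lam) *\<^sub>R J1 (F p) + (b p * s p - a p * c p) *\<^sub>R J2 (F p) + (- (a p * s p) - b p * c p) *\<^sub>R J3 (F p)"
    if "p \<in> I \<times> K" for p
    unfolding Fy[OF that, folded a_def b_def] by (simp add: null_op_def rot_op_def algebra_simps)
  have "((\<lambda>y. - (\<nu> * m * c (x, y))) has_real_derivative - (\<nu> * m * cy)) (at y)"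
    "((\<lambda>y. - (\<nu> * m * s (x, y))) has_real_derivative - (\<nu> * m * sy)) (at y)"
    "((\<lambda>y. \<nu> * m * lam) has_real_derivative 0) (at y)"
    "((\<lambda>x. a (x, y) * lam) has_real_derivative ?a' * lam) (at x)"
    "((\<lambda>x. b (x, y) * s (x, y) - a (x, y) * c (x, y)) has_real_derivative
      (b (x, y) * sx + \<nu> * m * s (x, y)) - (a (x, y) * cx + ?a' * c (x, y))) (at x)"
    "((\<lambda>x. - (a (x, y) * s (x, y)) - b (x, y) * c (x, y)) has_real_derivative
      - (a (x, y) * sx + ?a' * s (x, y)) - (b (x, y) * cx + \<nu> * m * c (x, y))) (at x)"
    using d a' b' by (auto intro!: derivative_eq_intros)
  note eqs = structure_equations(2,3)[OF IK F nz Fx' Fy' xy this(3,1,2,4,5,6)]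
  have "((\<lambda>x. (c (x, y))\<^sup>2 + (s (x, y))\<^sup>2) has_real_derivative 2 * c (x, y) * cx + 2 * s (x, y) * sx) (at x)"
    using d by (auto intro!: derivative_eq_intros)
  moreover have "((\<lambda>x. (c (x, y))\<^sup>2 + (s (x, y))\<^sup>2) has_real_derivative 0) (at x)"
    by (rule has_field_derivative_transform_within_open[OF DERIV_const[of 1] IK(1) xy(1)]) (simp add: unit xy)
  ultimately have ux: "c (x, y) * cx + s (x, y) * sx = 0" by (force dest: DERIV_unique)
  have "((\<lambda>y. (c (x, y))\<^sup>2 + (s (x, y))\<^sup>2) has_real_derivative 2 * c (x, y) * cy + 2 * s (x, y) * sy) (at y)"
    using d by (auto intro!: derivative_eq_intros)
  moreover have "((\<lambda>y. (c (x, y))\<^sup>2 + (s (x, y))\<^sup>2) has_real_derivative 0) (at y)"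
    by (rule has_field_derivative_transform_within_open[OF DERIV_const[of 1] IK(3) xy(2)]) (simp add: unit xy)
  ultimately have uy: "c (x, y) * cy + s (x, y) * sy = 0" by (force dest: DERIV_unique)
  define B C S where "B = \<nu> * x + \<eta> y" and "C = c (x, y)" and "S = s (x, y)"
  have u: "C\<^sup>2 + S\<^sup>2 = 1" using unit[OF p] by (simp add: C_def S_def)
  have "B \<noteq> 0" using assms(12)[OF xy] by (simp add: B_def)
  have bB: "b (x, y) = B * m" by (simp add: b_def B_def)
  have E2: "- (\<nu> * m * cy) = B * m * sx + \<nu> * m * S - a (x, y) * cx"
    using eqs(1) lam unfolding bB C_def[symmetric] S_def[symmetric] B_def[symmetric]
    by algebra
  have E3: "- (\<nu> * m * sy) = - (a (x, y) * sx) - B * m * cx - \<nu> * m * C"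
    using eqs(2) lam unfolding bB C_def[symmetric] S_def[symmetric] B_def[symmetric]
    by algebra
  note ux = ux[folded C_def S_def] and uy = uy[folded C_def S_def]
  \<comment> \<open>In \<open>C\<close> times \<open>E2\<close> plus \<open>S\<close> times
    \<open>E3\<close>, the terms in \<open>a\<close> and in the \<open>y\<close>-derivatives vanish
    by \<open>ux\<close> and \<open>uy\<close>.\<close>
  have "B * m * (C * sx - S * cx) = 0" using E2 E3 ux uy by algebra
  then have "C * sx - S * cx = 0" using \<open>B \<noteq> 0\<close> m(1) by simp
  \<comment> \<open>\<open>(cx, sx)\<close> is both parallel and orthogonal to the unit vector
    \<open>(C, S)\<close>.\<close>
  then have x0: "cx = 0" "sx = 0" using ux u by algebra+
  then have "\<nu> * m * (cy + S) = 0" "\<nu> * m * (sy - C) = 0" using E2 E3 by algebra+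
  then have y0: "cy = - S" "sy = C" using \<nu> m(1) by auto
  show "((\<lambda>x. c (x, y)) has_real_derivative 0) (at x)" "((\<lambda>x. s (x, y)) has_real_derivative 0) (at x)"
    "((\<lambda>y. c (x, y)) has_real_derivative - s (x, y)) (at y)"
    "((\<lambda>y. s (x, y)) has_real_derivative c (x, y)) (at y)"
    using d unfolding x0 y0 C_def S_def by auto
qed


text \<open>
  The first column \<open>A e\<^sub>1 = (sin \<xi> J\<^sub>2 - cos \<xi> J\<^sub>3) f\<close> of the matrix with third column \<open>f\<close>
  gives \<open>\<alpha>\<close>, and \<open>f\<close> itself gives \<open>\<beta>\<close>.
\<close>

lemma curve_matrix_family:
  fixes f :: "real \<Rightarrow> real^4" and \<phi> :: real
  defines "\<xi> \<equiv> \<lambda>y. y + \<phi>"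
  assumes K: "open K" and h: "smooth_on K h"
    and f': "\<And>y. y \<in> K \<Longrightarrow> (f has_vector_derivative h y *\<^sub>R rot_op (- sin (\<xi> y)) (cos (\<xi> y)) (f y)) (at y)"
    and ff: "\<And>y. y \<in> K \<Longrightarrow> g0 (f y) (f y) = - 1"
  obtains D \<xi>1 \<xi>2 \<xi>3 where "A_family lam K D \<xi> \<xi>1 \<xi>2 \<xi>3" "{y\<in>K. h y \<noteq> 0} \<subseteq> D"
    "\<And>y. y \<in> K \<Longrightarrow> f y = A_col3 (\<xi> y) (\<xi>1 y) (\<xi>2 y) (\<xi>3 y)"
proof -
  define \<alpha> where "\<alpha> y = Complex (sin (\<xi> y) * f y $ 3 - cos (\<xi> y) * f y $ 4)
    (- (sin (\<xi> y) * f y $ 4) - cos (\<xi> y) * f y $ 3)" for y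
  define \<beta> where "\<beta> y = Complex (f y $ 1) (f y $ 2)" for y
  have comp: "((\<lambda>y. f y $ i) has_real_derivative h y * rot_op (- sin (\<xi> y)) (cos (\<xi> y)) (f y) $ i) (at y)"
    if "y \<in> K" for y i
    using bounded_linear.has_vector_derivative[OF bounded_linear_vec_nth f'[OF that], of i]
    by (simp add: has_real_derivative_iff_has_vector_derivative)
  have trig: "((\<lambda>y. sin (\<xi> y)) has_real_derivative cos (\<xi> y)) (at y)"
    "((\<lambda>y. cos (\<xi> y)) has_real_derivative - sin (\<xi> y)) (at y)" for y
    unfolding \<xi>_def by (auto intro!: derivative_eq_intros)
  \<comment> \<open>In the derivative of \<open>\<alpha>\<close>, the term
    \<open>\<i> \<alpha>\<close> comes from \<open>\<xi>' = 1\<close> and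
    \<open>- \<i> h \<beta>\<close> from the ODE of \<open>f\<close>.\<close>
  have f34: "((\<lambda>y. Re (\<alpha> y)) has_real_derivative Re (\<i> * (\<alpha> y - of_real (h y) * \<beta> y))) (at y)"
    "((\<lambda>y. Im (\<alpha> y)) has_real_derivative Im (\<i> * (\<alpha> y - of_real (h y) * \<beta> y))) (at y)"
    "((\<lambda>y. Re (\<beta> y)) has_real_derivative Re (\<i> * of_real (h y) * \<alpha> y)) (at y)"
    "((\<lambda>y. Im (\<beta> y)) has_real_derivative Im (\<i> * of_real (h y) * \<alpha> y)) (at y)"
    if y: "y \<in> K" for y
  proof -
    have *: "(sin (\<xi> y))\<^sup>2 = 1 - (cos (\<xi> y))\<^sup>2" by (simp add: sin_squared_eq)
    have "((\<lambda>y. sin (\<xi> y) * f y $ 3 - cos (\<xi> y) * f y $ 4) has_real_derivative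
       Re (\<i> * (\<alpha> y - of_real (h y) * \<beta> y))) (at y)"
      by (rule DERIV_cong[OF DERIV_diff[OF DERIV_mult[OF trig(1) comp[OF y]] DERIV_mult[OF trig(2) comp[OF y]]]])
        (simp add: \<alpha>_def \<beta>_def rot_op_def J_defs, insert *, algebra)
    then show "((\<lambda>y. Re (\<alpha> y)) has_real_derivative Re (\<i> * (\<alpha> y - of_real (h y) * \<beta> y))) (at y)"
      by (simp add: \<alpha>_def)
    have "((\<lambda>y. - (sin (\<xi> y) * f y $ 4) - cos (\<xi> y) * f y $ 3) has_real_derivative
       Im (\<i> * (\<alpha> y - of_real (h y) * \<beta> y))) (at y)"
      by (rule DERIV_cong[OF DERIV_diff[OF DERIV_minus[OF DERIV_mult[OF trig(1) comp[OF y]]]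
              DERIV_mult[OF trig(2) comp[OF y]]]])
        (simp add: \<alpha>_def \<beta>_def rot_op_def J_defs, insert *, algebra)
    then show "((\<lambda>y. Im (\<alpha> y)) has_real_derivative Im (\<i> * (\<alpha> y - of_real (h y) * \<beta> y))) (at y)"
      by (simp add: \<alpha>_def)
    show "((\<lambda>y. Re (\<beta> y)) has_real_derivative Re (\<i> * of_real (h y) * \<alpha> y)) (at y)"
      "((\<lambda>y. Im (\<beta> y)) has_real_derivative Im (\<i> * of_real (h y) * \<alpha> y)) (at y)"
      using comp[OF y, of 1] comp[OF y, of 2] by (simp_all add: \<alpha>_def \<beta>_def rot_op_def J_defs algebra_simps)
  qed
  have cplx: "(z has_vector_derivative z') (at y)"
    if "((\<lambda>y. Re (z y)) has_real_derivative Re z') (at y)" "((\<lambda>y. Im (z y)) has_real_derivative Im z') (at y)"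
    for z z' and y :: real
    using that by (simp add: has_vector_derivative_complex_iff has_real_derivative_iff_has_vector_derivative)
  interpret ode: matrix_ode K h \<alpha> \<beta>
  proof
    fix y assume y: "y \<in> K"
    show "(\<alpha> has_vector_derivative \<i> * (\<alpha> y - of_real (h y) * \<beta> y)) (at y)"
      "(\<beta> has_vector_derivative \<i> * of_real (h y) * \<alpha> y) (at y)"
      using f34[OF y] by (auto intro!: cplx)
    have "(sin (\<xi> y))\<^sup>2 = 1 - (cos (\<xi> y))\<^sup>2" by (simp add: sin_squared_eq)
    then have "(cmod (\<alpha> y))\<^sup>2 - (cmod (\<beta> y))\<^sup>2 = - g0 (f y) (f y)"
      unfolding cmod_power2 by (simp add: \<alpha>_def \<beta>_def g0_def) algebra
    then show "(cmod (\<alpha> y))\<^sup>2 - (cmod (\<beta> y))\<^sup>2 = 1" by (simp add: ff[OF y])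
  qed (use K h in auto)
  obtain \<xi>1 \<xi>2 \<xi>3 where \<xi>: "smooth_on K \<xi>2" "smooth_on ode.D \<xi>1" "smooth_on ode.D \<xi>3"
    "\<And>y. y \<in> K \<Longrightarrow> \<alpha> y = of_real (cosh (\<xi>1 y)) * cis (\<xi>2 y)"
    "\<And>y. y \<in> K \<Longrightarrow> \<beta> y = of_real (sinh (\<xi>1 y)) * cis (\<xi>3 y)"
    by (rule ode.polar_parameters) (rule that)
  have \<xi>_smooth: "smooth_on K \<xi>"
    unfolding \<xi>_def using K by (intro smooth_on_add smooth_on_const smooth_on_linear[OF _ bounded_linear_ident])
  have col3: "f y = A_col3 (\<xi> y) (\<xi>1 y) (\<xi>2 y) (\<xi>3 y)" if y: "y \<in> K" for y
  proof -
    have *: "(sin (\<xi> y))\<^sup>2 = 1 - (cos (\<xi> y))\<^sup>2" by (simp add: sin_squared_eq)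
    have "f y $ 1 = sinh (\<xi>1 y) * cos (\<xi>3 y)" "f y $ 2 = sinh (\<xi>1 y) * sin (\<xi>3 y)"
      "sin (\<xi> y) * f y $ 3 - cos (\<xi> y) * f y $ 4 = cosh (\<xi>1 y) * cos (\<xi>2 y)"
      "- (sin (\<xi> y) * f y $ 4) - cos (\<xi> y) * f y $ 3 = cosh (\<xi>1 y) * sin (\<xi>2 y)"
      using \<xi>(4,5)[OF y] by (simp_all add: \<alpha>_def \<beta>_def complex_eq_iff)
    moreover from this(3,4) have "f y $ 3 = cosh (\<xi>1 y) * sin (\<xi> y - \<xi>2 y)"
      "f y $ 4 = - cosh (\<xi>1 y) * cos (\<xi> y - \<xi>2 y)"
      using * unfolding sin_diff cos_diff by algebra+
    ultimately show ?thesis by (simp add: A_col3_def vec_eq_iff forall_4)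
  qed
  have rel: "A_relation lam \<xi> \<xi>1 \<xi>2 \<xi>3 y" if y: "y \<in> ode.D" for y
  proof -
    have yK: "y \<in> K" using ode.D(2) y by blast
    have d: "(g has_real_derivative frechet_derivative g (at y) 1) (at y)" if "smooth_on ode.D g" for g :: "real \<Rightarrow> real"
      using smooth_on_has_vector_derivative[OF that y]
      by (simp add: has_real_derivative_iff_has_vector_derivative)
    have "((\<lambda>y. A_col3 (\<xi> y) (\<xi>1 y) (\<xi>2 y) (\<xi>3 y)) has_vector_derivative
        h y *\<^sub>R rot_op (- sin (\<xi> y)) (cos (\<xi> y)) (f y)) (at y)"
      by (rule has_vector_derivative_transform_within_open[OF f'[OF yK] K yK]) (rule col3)
    note A_relation_iff[OF d d d d this, of lam]
    \<comment> \<open>\<open>f'\<close> is a multiple of \<open>L' f\<close>, to which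
      \<open>L f\<close> is orthogonal.\<close>
    moreover have "g0 (A_col1 (\<xi> y) (\<xi>1 y) (\<xi>2 y) (\<xi>3 y) + lam *\<^sub>R J1 (A_col3 (\<xi> y) (\<xi>1 y) (\<xi>2 y) (\<xi>3 y)))
        (h y *\<^sub>R rot_op (- sin (\<xi> y)) (cos (\<xi> y)) (f y)) = 0"
      unfolding null_op_A_col3[symmetric]
      unfolding col3[OF yK, symmetric] g0_simps(8) g0_null_op(3) by simp
    ultimately show ?thesis
      using \<xi>(1-3) \<xi>_smooth ode.D(2) smooth_on_subset by blast
  qed
  have "A_family lam K ode.D \<xi> \<xi>1 \<xi>2 \<xi>3"
    unfolding A_family_def using ode.D \<xi> \<xi>_smooth rel K
    by (auto intro!: smooth_on_A_mat[OF K \<xi>_smooth ode.smooth_entries])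
  then show ?thesis using ode.D(3) col3 by (rule that)
qed


lemma helix_surface_matrix_family:
  assumes IK: "open I" "is_interval I" "open K" "is_interval K" and "I \<noteq> {}"
    and H: "helix_surface \<kappa> \<tau> lam \<nu> (I \<times> K) F N"
    and HC: "helix_coordinates \<kappa> \<tau> lam \<nu> I K F N \<mu> \<eta>"
  obtains \<phi> D \<xi>1 \<xi>2 \<xi>3 where "A_family lam K D (\<lambda>y. y + \<phi>) \<xi>1 \<xi>2 \<xi>3" "{y\<in>K. \<eta> y \<noteq> 0} \<subseteq> D"
    "0 \<in> I \<Longrightarrow> D = K"
    "\<And>x y. x \<in> I \<Longrightarrow> y \<in> K \<Longrightarrow>
      F (x, y) = A_mat (y + \<phi>) (\<xi>1 y) (\<xi>2 y) (\<xi>3 y) *v gamma_line \<kappa> \<tau> lam \<nu> x"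
proof -
  obtain c s where cs: "smooth_on (I \<times> K) c" "smooth_on (I \<times> K) s"
    and unit: "\<And>p. p \<in> I \<times> K \<Longrightarrow> (c p)\<^sup>2 + (s p)\<^sup>2 = 1"
    and Fx: "\<And>p. p \<in> I \<times> K \<Longrightarrow> frechet_derivative F (at p) (1, 0) = (\<nu> * m) *\<^sub>R null_op lam (c p) (s p) (F p)"
    and Fy: "\<And>p. p \<in> I \<times> K \<Longrightarrow> frechet_derivative F (at p) (0, 1) =
      (- (\<nu> * m\<^sup>2 * lam * fst p * (\<nu> * fst p + 2 * \<eta> (snd p)))) *\<^sub>R null_op lam (c p) (s p) (F p)
      + ((\<nu> * fst p + \<eta> (snd p)) * m) *\<^sub>R rot_op (c p) (s p) (F p)"
    and b: "\<And>x y. x \<in> I \<Longrightarrow> y \<in> K \<Longrightarrow> \<nu> * x + \<eta> y \<noteq> 0"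
    using helix_frame[OF IK(1,3) H HC] by metis
  have F: "smooth_on (I \<times> K) F" and AdS: "\<And>p. p \<in> I \<times> K \<Longrightarrow> F p \<in> AdS \<kappa>"
    using H by (auto simp: helix_surface_def oriented_surface_def)
  have \<eta>: "smooth_on K \<eta>" using HC by (simp add: helix_coordinates_def)
  have angle: "((\<lambda>x. c (x, y)) has_real_derivative 0) (at x)" "((\<lambda>x. s (x, y)) has_real_derivative 0) (at x)"
    "((\<lambda>y. c (x, y)) has_real_derivative - s (x, y)) (at y)"
    "((\<lambda>y. s (x, y)) has_real_derivative c (x, y)) (at y)" if "x \<in> I" "y \<in> K" for x y
    by (rule helix_angle[OF IK F AdS cs unit Fx Fy b that]; assumption)+
  obtain x0 where x0: "x0 \<in> I" using \<open>I \<noteq> {}\<close> by blast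
  have const: "g x = g x0" if "x \<in> I" "\<And>x. x \<in> I \<Longrightarrow> (g has_vector_derivative 0) (at x)"
    for x and g :: "real \<Rightarrow> 'a::real_normed_vector"
  proof (rule has_derivative_zero_unique[OF is_interval_convex[OF IK(2)] _ that(1) x0])
    show "(g has_derivative (\<lambda>h. 0)) (at z within I)" if "z \<in> I" for z
      using has_derivative_at_withinI[OF \<open>\<And>x. x \<in> I \<Longrightarrow> (g has_vector_derivative 0) (at x)\<close>[OF that,
          unfolded has_vector_derivative_def]] by simp
  qed
  \<comment> \<open>The aim is \<open>c = - sin \<xi>\<close>, \<open>s = cos \<xi>\<close>, so the
    rotation lemma is applied to \<open>(s, - c)\<close>, which turns in the same sense as
    \<open>(c, s)\<close>.\<close>
  obtain \<phi> where \<phi>: "\<And>y. y \<in> K \<Longrightarrow> s (x0, y) = cos (y + \<phi>) \<and> - c (x0, y) = sin (y + \<phi>)"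
  proof (rule rotation_ode[OF IK(4), of "\<lambda>y. s (x0, y)" "\<lambda>y. - c (x0, y)"])
    fix y assume y: "y \<in> K"
    show "((\<lambda>y. s (x0, y)) has_real_derivative - (- c (x0, y))) (at y)"
      using angle(4)[OF x0 y] by simp
    show "((\<lambda>y. - c (x0, y)) has_real_derivative s (x0, y)) (at y)"
      using DERIV_minus[OF angle(3)[OF x0 y]] by simp
    show "(s (x0, y))\<^sup>2 + (- c (x0, y))\<^sup>2 = 1"
      using unit[of "(x0, y)"] x0 y by (simp add: add.commute)
  qed (rule that)
  have cs_eq: "c (x, y) = - sin (y + \<phi>)" "s (x, y) = cos (y + \<phi>)" if "x \<in> I" "y \<in> K" for x y
    using const[of x "\<lambda>x. c (x, y)"] const[of x "\<lambda>x. s (x, y)"] angle(1,2) \<phi>[OF that(2)] that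
    by (auto simp: has_real_derivative_iff_has_vector_derivative)
  define L where "L y = null_op lam (- sin (y + \<phi>)) (cos (y + \<phi>))" for y
  define R where "R y = rot_op (- sin (y + \<phi>)) (cos (y + \<phi>))" for y
  have lin: "bounded_linear (L y)" "bounded_linear (R y)" for y
    unfolding L_def R_def rot_op_def
    by (intro bounded_linear_null_op bounded_linear_sub bounded_linear_scaleR_right[THEN bounded_linear_compose] bounded_linear_J)+
  note lin_simps = lin[THEN bounded_linear.linear, THEN linear_add] lin[THEN bounded_linear.linear, THEN linear_diff]
    lin[THEN bounded_linear.linear, THEN linear_scale]
  have LL: "L y (L y v) = 0" and LR: "L y (R y v) = - lam *\<^sub>R L y v" "R y (L y v) = lam *\<^sub>R L y v" for y v
    unfolding L_def R_def by (intro null_op_null_op null_op_rot_op; simp add: lam)+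
  have dx: "((\<lambda>x. F (x, y)) has_vector_derivative (\<nu> * m) *\<^sub>R L y (F (x, y))) (at x)"
    and dy: "((\<lambda>y. F (x, y)) has_vector_derivative
      (- (\<nu> * m\<^sup>2 * lam * x * (\<nu> * x + 2 * \<eta> y))) *\<^sub>R L y (F (x, y))
      + ((\<nu> * x + \<eta> y) * m) *\<^sub>R R y (F (x, y))) (at y)" if "x \<in> I" "y \<in> K" for x y
    using smooth_on_partials[OF F, of x y] that by (simp_all add: Fx Fy cs_eq L_def R_def)
  \<comment> \<open>As \<open>L^2 = 0\<close>, this applies the inverse of
    \<open>1 + x \<nu> m L\<close> to \<open>F\<close>.\<close>
  define \<Phi> where "\<Phi> x y = F (x, y) - (x * (\<nu> * m)) *\<^sub>R L y (F (x, y))" for x y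
  have \<Phi>_const: "\<Phi> x y = \<Phi> x0 y" if "x \<in> I" "y \<in> K" for x y
  proof (rule const[OF that(1)])
    fix x assume x: "x \<in> I"
    have "((\<lambda>x. x * (\<nu> * m)) has_real_derivative \<nu> * m) (at x)" by (auto intro!: derivative_eq_intros)
    from has_vector_derivative_diff[OF dx[OF x that(2)] has_vector_derivative_scaleR[OF this
        bounded_linear.has_vector_derivative[OF lin(1)[of y] dx[OF x that(2)]]]]
    show "((\<lambda>x. \<Phi> x y) has_vector_derivative 0) (at x)"
      by (simp add: \<Phi>_def lin_simps LL)
  qed
  \<comment> \<open>The factor \<open>e\<close> turns \<open>g0 F F = - 1 / e^2\<close> into
    \<open>- 1\<close>, the value for the third column of the matrix.\<close>
  define f where "f y = e *\<^sub>R \<Phi> x0 y" for y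
  have f': "(f has_vector_derivative (m * \<eta> y) *\<^sub>R R y (f y)) (at y)" if y: "y \<in> K" for y
  proof -
    let ?F = "F (x0, y)"
    define Fy where "Fy = (- (\<nu> * m\<^sup>2 * lam * x0 * (\<nu> * x0 + 2 * \<eta> y))) *\<^sub>R L y ?F + ((\<nu> * x0 + \<eta> y) * m) *\<^sub>R R y ?F"
    have dJ: "((\<lambda>y. J (F (x0, y))) has_vector_derivative J Fy) (at y)" if "bounded_linear J" for J :: "real^4 \<Rightarrow> real^4"
      using dy[OF x0 y] unfolding Fy_def[symmetric] by (rule bounded_linear.has_vector_derivative[OF that])
    have "((\<lambda>y. - sin (y + \<phi>)) has_real_derivative - cos (y + \<phi>)) (at y)"
      "((\<lambda>y. cos (y + \<phi>)) has_real_derivative - sin (y + \<phi>)) (at y)"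
      by (auto intro!: derivative_eq_intros)
    then have "((\<lambda>y. lam *\<^sub>R J1 (F (x0, y)) - (- sin (y + \<phi>)) *\<^sub>R J2 (F (x0, y)) - cos (y + \<phi>) *\<^sub>R J3 (F (x0, y)))
        has_vector_derivative (lam *\<^sub>R J1 Fy + 0 *\<^sub>R J1 ?F)
          - ((- sin (y + \<phi>)) *\<^sub>R J2 Fy + (- cos (y + \<phi>)) *\<^sub>R J2 ?F)
          - (cos (y + \<phi>) *\<^sub>R J3 Fy + (- sin (y + \<phi>)) *\<^sub>R J3 ?F)) (at y)"
      by (intro has_vector_derivative_diff has_vector_derivative_scaleR dJ bounded_linear_J DERIV_const)
    \<comment> \<open>The extra term \<open>R F\<close> is the derivative of \<open>L\<close> in
      \<open>y\<close>.\<close>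
    then have dL: "((\<lambda>y. L y (F (x0, y))) has_vector_derivative L y Fy + R y ?F) (at y)"
      by (simp add: L_def R_def null_op_def rot_op_def algebra_simps)
    have d\<Phi>: "((\<lambda>y. \<Phi> x0 y) has_vector_derivative Fy - (x0 * (\<nu> * m)) *\<^sub>R (L y Fy + R y ?F)) (at y)"
      unfolding \<Phi>_def Fy_def
      by (intro has_vector_derivative_diff dy[OF x0 y] dL[unfolded Fy_def]
          bounded_linear.has_vector_derivative[OF bounded_linear_scaleR_right])
    \<comment> \<open>Through \<open>L R = - lam L\<close>, the part of the coefficient of
      \<open>L F\<close> quadratic in \<open>x0\<close> cancels. What remains is a multiple of
      \<open>x0 * \<eta> y\<close>, and it is the \<open>R L = lam L\<close> contribution on the
      right.\<close>
    have "Fy - (x0 * (\<nu> * m)) *\<^sub>R (L y Fy + R y ?F) = (m * \<eta> y) *\<^sub>R R y (\<Phi> x0 y)"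
      unfolding Fy_def \<Phi>_def lin_simps LL LR by (simp add: vec_eq_iff algebra_simps power2_eq_square)
    with bounded_linear.has_vector_derivative[OF bounded_linear_scaleR_right d\<Phi>, of e]
    show ?thesis unfolding f_def by (simp add: lin_simps mult_ac)
  qed
  have ff: "g0 (f y) (f y) = - 1" if y: "y \<in> K" for y
  proof -
    let ?F = "F (x0, y)"
    have "g0 (L y ?F) (L y ?F) = 0" "g0 ?F (L y ?F) = 0" "g0 (L y ?F) ?F = 0"
      using g0_commute[of ?F "L y ?F"] by (simp_all add: L_def g0_null_op lam)
    then have "g0 (f y) (f y) = e\<^sup>2 * g0 ?F ?F"
      by (simp add: f_def \<Phi>_def g0_simps power2_eq_square)
    then show ?thesis using AdS[of "(x0, y)"] x0 y by (simp add: AdS_iff)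
  qed
  have h: "smooth_on K (\<lambda>y. m * \<eta> y)"
    using IK(3) \<eta> by (intro smooth_on_mult smooth_on_const)
  obtain D \<xi>1 \<xi>2 \<xi>3 where A: "A_family lam K D (\<lambda>y. y + \<phi>) \<xi>1 \<xi>2 \<xi>3" "{y\<in>K. m * \<eta> y \<noteq> 0} \<subseteq> D"
    and f: "\<And>y. y \<in> K \<Longrightarrow> f y = A_col3 (y + \<phi>) (\<xi>1 y) (\<xi>2 y) (\<xi>3 y)"
    by (rule curve_matrix_family[OF IK(3) h f'[unfolded R_def] ff]) (assumption, assumption, rule that)
  show ?thesis
  proof (rule that[OF A(1)])
    show sub: "{y\<in>K. \<eta> y \<noteq> 0} \<subseteq> D" using A(2) m(1) by auto
    show "D = K" if "0 \<in> I"
      using sub b[OF that] A(1) by (auto simp: A_family_def)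
    fix x y assume xy: "x \<in> I" "y \<in> K"
    have "F (x, y) = \<Phi> x y + (x * (\<nu> * m)) *\<^sub>R L y (\<Phi> x y)"
      by (simp add: \<Phi>_def lin_simps LL)
    also have "\<dots> = (1 / e) *\<^sub>R f y + (x * (\<nu> * m) / e) *\<^sub>R L y (f y)"
      using e_pos by (simp add: f_def \<Phi>_const[OF xy] lin_simps)
    also have "x * (\<nu> * m) / e = \<nu>\<^sup>2 * \<tau> * x"
      using e_pos by (simp add: m(2)[symmetric])
    finally show "F (x, y) = A_mat (y + \<phi>) (\<xi>1 y) (\<xi>2 y) (\<xi>3 y) *v gamma_line \<kappa> \<tau> lam \<nu> x"
      unfolding A_mat_gamma_line_null_op f[OF xy(2)] L_def .
  qed
qed

end

lemma gamma_line_affine: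
  "gamma_line \<kappa> \<tau> lam \<nu> x = vector [0, 0, 2 / sqrt \<kappa>, 0] + x *\<^sub>R vector [\<nu>\<^sup>2 * \<tau>, 0, 0, \<nu>\<^sup>2 * \<tau> * lam]"
  by (simp add: gamma_line_def vec_eq_iff forall_4)

theorem theorem6p2:
  fixes \<kappa> \<tau> lam \<nu> :: real
  assumes "\<kappa> > 0" and "\<tau> > 0" and "lam \<in> {-1, 1}" and "\<nu> \<noteq> 0"
    and B0: "\<nu>\<^sup>2 * (\<tau>\<^sup>2 - 1) - lam = 0"
  shows
    "(\<exists>q v. v \<noteq> 0 \<and> (\<forall>x. gamma_line \<kappa> \<tau> lam \<nu> x = q + x *\<^sub>R v)) \<and>
     (\<forall>x. gamma_line \<kappa> \<tau> lam \<nu> x \<in> AdS \<kappa> \<and>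
        gamma_line \<kappa> \<tau> lam \<nu> x $ 2 = 0 \<and> gamma_line \<kappa> \<tau> lam \<nu> x $ 3 - 2 / sqrt \<kappa> = 0) \<and>
     (\<forall>I K F N \<mu> \<eta>.
        open I \<and> is_interval I \<and> I \<noteq> {} \<and> open K \<and> is_interval K \<and> K \<noteq> {} \<and>
        helix_surface \<kappa> \<tau> lam \<nu> (I \<times> K) F N \<and> helix_coordinates \<kappa> \<tau> lam \<nu> I K F N \<mu> \<eta>
        \<longrightarrow> (\<exists>D \<xi> \<xi>1 \<xi>2 \<xi>3.
              A_family lam K D \<xi> \<xi>1 \<xi>2 \<xi>3 \<and>
              {y\<in>K. \<eta> y \<noteq> 0} \<subseteq> D \<and> (0 \<in> I \<longrightarrow> D = K) \<and>
              (\<forall>y\<in>K. let A = A_mat (\<xi> y) (\<xi>1 y) (\<xi>2 y) (\<xi>3 y) in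
                 pseudo_orthogonal A \<and> (\<forall>v. A *v J1 v = J1 (A *v v)) \<and>
                 (\<forall>x\<in>I. F (x, y) = A *v gamma_line \<kappa> \<tau> lam \<nu> x)))) \<and>
     (\<forall>I K F D \<xi> \<xi>1 \<xi>2 \<xi>3.
        open I \<and> is_interval I \<and> I \<noteq> {} \<and> open K \<and> is_interval K \<and> K \<noteq> {} \<and>
        A_family lam K D \<xi> \<xi>1 \<xi>2 \<xi>3 \<and>
        (\<forall>x\<in>I. \<forall>y\<in>K. F (x, y) = A_mat (\<xi> y) (\<xi>1 y) (\<xi>2 y) (\<xi>3 y) *v gamma_line \<kappa> \<tau> lam \<nu> x) \<and>
        (\<forall>p\<in>I \<times> K. inj (frechet_derivative F (at p)))
        \<longrightarrow> (\<exists>N. helix_surface \<kappa> \<tau> lam \<nu> (I \<times> K) F N))"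
proof -
  interpret helix_setup \<kappa> \<tau> lam \<nu>
    using assms by unfold_locales (auto simp: power2_eq_square)
  have "(vector [\<nu>\<^sup>2 * \<tau>, 0, 0, \<nu>\<^sup>2 * \<tau> * lam] :: real^4) \<noteq> 0"
    using assms by (simp add: vec_eq_iff forall_4)
  then have "\<exists>q v. v \<noteq> 0 \<and> (\<forall>x. gamma_line \<kappa> \<tau> lam \<nu> x = q + x *\<^sub>R v)"
    using gamma_line_affine by blast
  moreover have "\<forall>x. gamma_line \<kappa> \<tau> lam \<nu> x \<in> AdS \<kappa> \<and>
        gamma_line \<kappa> \<tau> lam \<nu> x $ 2 = 0 \<and> gamma_line \<kappa> \<tau> lam \<nu> x $ 3 - 2 / sqrt \<kappa> = 0"
    using gamma_line_AdS by (simp add: gamma_line_def)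
  moreover have "\<exists>D \<xi> \<xi>1 \<xi>2 \<xi>3.
      A_family lam K D \<xi> \<xi>1 \<xi>2 \<xi>3 \<and>
      {y\<in>K. \<eta> y \<noteq> 0} \<subseteq> D \<and> (0 \<in> I \<longrightarrow> D = K) \<and>
      (\<forall>y\<in>K. let A = A_mat (\<xi> y) (\<xi>1 y) (\<xi>2 y) (\<xi>3 y) in
         pseudo_orthogonal A \<and> (\<forall>v. A *v J1 v = J1 (A *v v)) \<and>
         (\<forall>x\<in>I. F (x, y) = A *v gamma_line \<kappa> \<tau> lam \<nu> x))"
    if H: "open I \<and> is_interval I \<and> I \<noteq> {} \<and> open K \<and> is_interval K \<and> K \<noteq> {} \<and>
        helix_surface \<kappa> \<tau> lam \<nu> (I \<times> K) F N \<and> helix_coordinates \<kappa> \<tau> lam \<nu> I K F N \<mu> \<eta>"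
    for I K F N \<mu> \<eta>
  proof (rule helix_surface_matrix_family[of I K F N \<mu> \<eta>])
    fix \<phi> D \<xi>1 \<xi>2 \<xi>3
    assume "A_family lam K D (\<lambda>y. y + \<phi>) \<xi>1 \<xi>2 \<xi>3" "{y\<in>K. \<eta> y \<noteq> 0} \<subseteq> D" "0 \<in> I \<Longrightarrow> D = K"
      "\<And>x y. x \<in> I \<Longrightarrow> y \<in> K \<Longrightarrow>
        F (x, y) = A_mat (y + \<phi>) (\<xi>1 y) (\<xi>2 y) (\<xi>3 y) *v gamma_line \<kappa> \<tau> lam \<nu> x"
    then show ?thesis
      by (intro exI[of _ D] exI[of _ "\<lambda>y. y + \<phi>"] exI[of _ \<xi>1] exI[of _ \<xi>2] exI[of _ \<xi>3])
        (simp add: Let_def A_mat_pseudo_orthogonal A_mat_commutes_J1)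
  qed (use H in simp_all)
  moreover have "\<exists>N. helix_surface \<kappa> \<tau> lam \<nu> (I \<times> K) F N"
    if "open I \<and> is_interval I \<and> I \<noteq> {} \<and> open K \<and> is_interval K \<and> K \<noteq> {} \<and>
        A_family lam K D \<xi> \<xi>1 \<xi>2 \<xi>3 \<and>
        (\<forall>x\<in>I. \<forall>y\<in>K. F (x, y) = A_mat (\<xi> y) (\<xi>1 y) (\<xi>2 y) (\<xi>3 y) *v gamma_line \<kappa> \<tau> lam \<nu> x) \<and>
        (\<forall>p\<in>I \<times> K. inj (frechet_derivative F (at p)))"
    for I K F D \<xi> \<xi>1 \<xi>2 \<xi>3
    using that by (intro matrix_family_helix) auto
  ultimately show ?thesis by (intro conjI allI impI) simp_all
qed

end
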